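(* Let $N\in\mathbb Z$, let $L\in\mathbb N_0$ with $L\ge |N|$, let $b=\cos\theta\in(0,1)$, and let $R=\{\xi(t,\varphi)\in\Omega : b\le t\le 1\}$ be the polar cap. The kernel function $$\mathcal K^N(\xi,\eta)=\sum_{n=|N|}^{L}\sum_{j=-n}^{n}\overline{{}_NY_{n,j}(\xi)}\;{}_NY_{n,j}(\eta)$$ commutes with the differential operator $$\mathcal I^N_\xi=(b-t)\,\Delta^{\ast,N}_\xi+(t^2-1)\,\partial_t-L(L+2)\,t,\qquad \xi=\xi(t,\varphi),$$ in the following sense: for every function $u\in \mathrm X^2(\Omega_0)$ (a space depending on $N$, defined in the context) and every $\xi\in\Omega_0$, $$\int_R \overline{\mathcal K^N(\xi,\eta)}\,\bigl[\mathcal I^N_\eta u(\eta)\bigr]\,\mathrm d\omega(\eta)=\int_R \bigl[\mathcal I^N_\xi\,\overline{\mathcal K^N(\xi,\eta)}\bigr]\,u(\eta)\,\mathrm d\omega(\eta)=\mathcal I^N_\xi\int_R \overline{\mathcal K^N(\xi,\eta)}\,u(\eta)\,\mathrm d\omega(\eta).$$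
   Context: $\Omega$ is the unit sphere in $\mathbb R^3$, parametrized by $\xi(t,\varphi)=(\sqrt{1-t^2}\cos\varphi,\sqrt{1-t^2}\sin\varphi,t)^{\mathrm T}$, $t\in[-1,1]$, $\varphi\in[0,2\pi)$; the surface measure is $\mathrm d\omega=\mathrm dt\,\mathrm d\varphi$. $\Omega_0$ is $\Omega$ without the two poles $t=\pm1$. Scalar spherical harmonics: for $n\in\mathbb N_0$, $j=-n,\dots,n$, $Y_{n,j}(\xi(t,\varphi))=(-1)^j\sqrt{\tfrac{2n+1}{4\pi}}\sqrt{\tfrac{(n-j)!}{(n+j)!}}\,P_{n,j}(t)e^{ij\varphi}$ for $j\ge0$ and $Y_{n,j}=(-1)^j\overline{Y_{n,-j}}$ for $j<0$, where $P_{n,j}(t)=(1-t^2)^{j/2}\frac{\mathrm d^j}{\mathrm dt^j}P_n(t)$ and $P_n(t)=\frac1{2^nn!}\frac{\mathrm d^n}{\mathrm dt^n}(t^2-1)^n$. Spin-weighted operators on functions on $\Omega_0$: $\eth_N F=\bigl(\sqrt{1-t^2}\,\partial_t+\frac{Nt-i\partial_\varphi}{\sqrt{1-t^2}}\bigr)F$ and $\overline\eth_N F=\bigl(\sqrt{1-t^2}\,\partial_t-\frac{Nt-i\partial_\varphi}{\sqrt{1-t^2}}\bigr)F$; $\eth_0^M=\eth_{M-1}\cdots\eth_1\eth_0$ and $\overline\eth_0^M=\overline\eth_{-M+1}\cdots\overline\eth_{-1}\overline\eth_0$ for $M\ge1$, and $\eth_0^0=\overline\eth_0^0=\mathrm{Id}$.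 Spin-weighted spherical harmonics, for $N\in\mathbb Z$, $n\ge|N|$, $j=-n,\dots,n$: ${}_NY_{n,j}=\sqrt{\tfrac{(n-N)!}{(n+N)!}}\,\eth_0^N Y_{n,j}$ if $0\le N\le n$, and ${}_NY_{n,j}=(-1)^N\sqrt{\tfrac{(n+N)!}{(n-N)!}}\,\overline\eth_0^{-N}Y_{n,j}$ if $-n\le N\le0$. Spin-weighted Beltrami operator: $\Delta^{\ast,N}_\xi=\partial_t\bigl((1-t^2)\partial_t\bigr)+\frac1{1-t^2}\partial_\varphi^2-\frac{N^2-2itN\partial_\varphi}{1-t^2}$. For the fixed spin weight $N$, $\mathrm X^2(\Omega_0)$ is the set of all $F\in \mathrm C^{(2)}(\Omega_0)\cap \mathrm L^2(\Omega)$ (complex-valued) such that: $F$ has the form $F(\xi(t,\varphi))=H(t)e^{im\varphi}$ for some $m\in\mathbb Z$; $F$ is bounded; $\partial_t^{i}F(\xi)=\mathcal O\bigl((1-t^2)^{1/2-i}\bigr)$ as $t\to\pm1$ for $i=1,2$; and $\Delta^{\ast,N}_\xi F(\xi)=\mathcal O(1)$ as $t\to\pm1$. *)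

theory Defs
  imports "HOL-Analysis.Analysis" "HOL-Library.Landau_Symbols"
begin

section \<open>The unit sphere in polar coordinates\<close>

definition Omega :: "(real ^ 3) set" where
  "Omega = sphere 0 1"

definition north_pole :: "real ^ 3" where
  "north_pole = vector [0, 0, 1]"

definition south_pole :: "real ^ 3" where
  "south_pole = vector [0, 0, - 1]"

definition Omega0 :: "(real ^ 3) set" where
  "Omega0 = Omega - {north_pole, south_pole}"

definition xi :: "real \<Rightarrow> real \<Rightarrow> real ^ 3" where
  "xi t \<phi> = vector [sqrt (1 - t\<^sup>2) * cos \<phi>, sqrt (1 - t\<^sup>2) * sin \<phi>, t]"

text \<open>
  The inverse of the parametrization: \<open>xi (lat x) (lon x) = x\<close> for \<open>x\<close> in \<open>Omega\<close>, with
  \<open>lon x\<close> in the interval from 0 (included) to \<open>2 * pi\<close> (excluded).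
\<close>

definition lat :: "real ^ 3 \<Rightarrow> real" where
  "lat x = x $ 3"

definition lon :: "real ^ 3 \<Rightarrow> real" where
  "lon x = Arg2pi (Complex (x $ 1) (x $ 2))"

definition surface_measure :: "(real ^ 3) measure" where
  "surface_measure =
     distr (restrict_space lborel ({- 1..1} \<times> {0..<2 * pi})) borel (\<lambda>(t, \<phi>). xi t \<phi>)"

definition polar_cap :: "real \<Rightarrow> (real ^ 3) set" where
  "polar_cap b = {xi t \<phi> | t \<phi>. b \<le> t \<and> t \<le> 1 \<and> 0 \<le> \<phi> \<and> \<phi> < 2 * pi}"


section \<open>Differentiation along the coordinates\<close>

text \<open>
  Functions on \<open>Omega0\<close> are rendered as functions on the ambient space whose values outside
  \<open>Omega0\<close> are irrelevant. Since \<open>xi\<close> is defined, and \<open>2 * pi\<close>-periodic, for all real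
  longitudes, the coordinate derivatives below are two-sided also at longitude 0.
\<close>

definition d_t :: "(real ^ 3 \<Rightarrow> complex) \<Rightarrow> real ^ 3 \<Rightarrow> complex" where
  "d_t F x = vector_derivative (\<lambda>s. F (xi s (lon x))) (at (lat x))"

definition d_phi :: "(real ^ 3 \<Rightarrow> complex) \<Rightarrow> real ^ 3 \<Rightarrow> complex" where
  "d_phi F x = vector_derivative (\<lambda>p. F (xi (lat x) p)) (at (lon x))"

text \<open>
  \<open>C_diff k F\<close> says that \<open>F\<close> is \<open>k\<close> times continuously differentiable on the surface
  \<open>Omega0\<close>. As \<open>xi\<close> is a local diffeomorphism from the strip of all \<open>(t, \<phi>)\<close> with
  \<open>- 1 < t < 1\<close> onto \<open>Omega0\<close>, it is enough to ask for existence and continuity of all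
  coordinate derivatives up to order \<open>k\<close>.
\<close>

primrec C_diff :: "nat \<Rightarrow> (real ^ 3 \<Rightarrow> complex) \<Rightarrow> bool" where
  "C_diff 0 F \<longleftrightarrow> continuous_on Omega0 F"
| "C_diff (Suc k) F \<longleftrightarrow>
     continuous_on Omega0 F \<and>
     (\<forall>x\<in>Omega0. (\<lambda>s. F (xi s (lon x))) differentiable (at (lat x))) \<and>
     (\<forall>x\<in>Omega0. (\<lambda>p. F (xi (lat x) p)) differentiable (at (lon x))) \<and>
     C_diff k (d_t F) \<and> C_diff k (d_phi F)"


section \<open>Spherical harmonics\<close>

definition legendre :: "nat \<Rightarrow> real \<Rightarrow> real" where
  "legendre n t = 1 / (2 ^ n * fact n) * (deriv ^^ n) (\<lambda>s. (s\<^sup>2 - 1) ^ n) t"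

text \<open>
  The factor \<open>(1 - t\<^sup>2)\<^bsup>j/2\<^esup>\<close> is written as a power of the square root, because
  \<open>0 powr 0 = 0\<close> would give the wrong value for \<open>j = 0\<close> at the poles.
\<close>

definition assoc_legendre :: "nat \<Rightarrow> nat \<Rightarrow> real \<Rightarrow> real" where
  "assoc_legendre n j t = sqrt (1 - t\<^sup>2) ^ j * (deriv ^^ j) (legendre n) t"

definition sph_Y_nonneg :: "nat \<Rightarrow> nat \<Rightarrow> real ^ 3 \<Rightarrow> complex" where
  "sph_Y_nonneg n j x =
     (- 1) ^ j
     * complex_of_real (sqrt ((2 * real n + 1) / (4 * pi)) * sqrt (fact (n - j) / fact (n + j))
         * assoc_legendre n j (lat x))
     * exp (\<i> * of_nat j * complex_of_real (lon x))"

definition sph_Y :: "nat \<Rightarrow> int \<Rightarrow> real ^ 3 \<Rightarrow> complex" where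
  "sph_Y n j x =
     (if 0 \<le> j then sph_Y_nonneg n (nat j) x
      else (- 1) powi j * cnj (sph_Y_nonneg n (nat (- j)) x))"


section \<open>Spin-weighted operators and spin-weighted spherical harmonics\<close>

definition eth :: "int \<Rightarrow> (real ^ 3 \<Rightarrow> complex) \<Rightarrow> real ^ 3 \<Rightarrow> complex" where
  "eth N F x =
     complex_of_real (sqrt (1 - (lat x)\<^sup>2)) * d_t F x
     + (of_int N * complex_of_real (lat x) * F x - \<i> * d_phi F x)
         / complex_of_real (sqrt (1 - (lat x)\<^sup>2))"

definition ethbar :: "int \<Rightarrow> (real ^ 3 \<Rightarrow> complex) \<Rightarrow> real ^ 3 \<Rightarrow> complex" where
  "ethbar N F x =
     complex_of_real (sqrt (1 - (lat x)\<^sup>2)) * d_t F x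
     - (of_int N * complex_of_real (lat x) * F x - \<i> * d_phi F x)
         / complex_of_real (sqrt (1 - (lat x)\<^sup>2))"

primrec eth0_pow :: "nat \<Rightarrow> (real ^ 3 \<Rightarrow> complex) \<Rightarrow> real ^ 3 \<Rightarrow> complex" where
  "eth0_pow 0 F = F"
| "eth0_pow (Suc M) F = eth (int M) (eth0_pow M F)"

primrec ethbar0_pow :: "nat \<Rightarrow> (real ^ 3 \<Rightarrow> complex) \<Rightarrow> real ^ 3 \<Rightarrow> complex" where
  "ethbar0_pow 0 F = F"
| "ethbar0_pow (Suc M) F = ethbar (- int M) (ethbar0_pow M F)"

text \<open>Meaningful for \<open>\<bar>N\<bar> \<le> n\<close> and \<open>\<bar>j\<bar> \<le> n\<close> only.\<close>

definition spin_Y :: "int \<Rightarrow> nat \<Rightarrow> int \<Rightarrow> real ^ 3 \<Rightarrow> complex" where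
  "spin_Y N n j x =
     (if 0 \<le> N
      then complex_of_real (sqrt (fact (nat (int n - N)) / fact (nat (int n + N))))
             * eth0_pow (nat N) (sph_Y n j) x
      else (- 1) powi N
             * complex_of_real (sqrt (fact (nat (int n + N)) / fact (nat (int n - N))))
             * ethbar0_pow (nat (- N)) (sph_Y n j) x)"

definition beltrami :: "int \<Rightarrow> (real ^ 3 \<Rightarrow> complex) \<Rightarrow> real ^ 3 \<Rightarrow> complex" where
  "beltrami N F x =
     d_t (\<lambda>y. complex_of_real (1 - (lat y)\<^sup>2) * d_t F y) x
     + d_phi (d_phi F) x / complex_of_real (1 - (lat x)\<^sup>2)
     - ((of_int N)\<^sup>2 * F x - 2 * \<i> * complex_of_real (lat x) * of_int N * d_phi F x)
         / complex_of_real (1 - (lat x)\<^sup>2)"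


section \<open>The function space, the kernel and the differential operator\<close>

definition L2 :: "(real ^ 3 \<Rightarrow> complex) \<Rightarrow> bool" where
  "L2 F \<longleftrightarrow>
     set_borel_measurable surface_measure Omega0 F \<and>
     set_integrable surface_measure Omega0 (\<lambda>x. (cmod (F x))\<^sup>2)"

text \<open>
  On the sphere, \<open>t\<close> tends to 1 or to -1 exactly if the point tends to the corresponding pole,
  so the growth conditions are stated with the punctured neighbourhood filters of the poles
  within the sphere.
\<close>

definition X2 :: "int \<Rightarrow> (real ^ 3 \<Rightarrow> complex) set" where
  "X2 N = {F.
     C_diff 2 F \<and> L2 F \<and>
     (\<exists>(H :: real \<Rightarrow> complex) (m :: int). \<forall>t\<in>{- 1<..<1}. \<forall>\<phi>\<in>{0..<2 * pi}.
        F (xi t \<phi>) = H t * exp (\<i> * of_int m * complex_of_real \<phi>)) \<and>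
     bounded (F ` Omega0) \<and>
     (\<forall>p\<in>{north_pole, south_pole}.
        (\<forall>i\<in>{1, 2 :: nat}.
           (\<lambda>x. cmod ((d_t ^^ i) F x))
             \<in> O[at p within Omega](\<lambda>x. (1 - (lat x)\<^sup>2) powr (1 / 2 - real i))) \<and>
        (\<lambda>x. cmod (beltrami N F x)) \<in> O[at p within Omega](\<lambda>_. 1))}"

definition spin_kernel :: "int \<Rightarrow> nat \<Rightarrow> real ^ 3 \<Rightarrow> real ^ 3 \<Rightarrow> complex" where
  "spin_kernel N L x y =
     (\<Sum>n = nat \<bar>N\<bar>..L. \<Sum>j = - int n..int n. cnj (spin_Y N n j x) * spin_Y N n j y)"

definition I_op ::
  "real \<Rightarrow> nat \<Rightarrow> int \<Rightarrow> (real ^ 3 \<Rightarrow> complex) \<Rightarrow> real ^ 3 \<Rightarrow> complex" where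
  "I_op b L N F x =
     complex_of_real (b - lat x) * beltrami N F x
     + complex_of_real ((lat x)\<^sup>2 - 1) * d_t F x
     - of_nat (L * (L + 2)) * complex_of_real (lat x) * F x"

end

theory Submission
  imports Defs "HOL-Computational_Algebra.Polynomial"
begin

text \<open>
  On \<open>\<Omega>\<^sub>0\<close> the harmonic of degree \<open>n\<close> and order \<open>j\<close> is a constant times
  \<open>(1 - t)\<^bsup>(M + m)/2\<^esup> (1 + t)\<^bsup>(M - m)/2\<^esup> q\<^sub>n(t)\<close> times a character of the longitude, where
  \<open>M = \<bar>N\<bar>\<close>, \<open>m = \<plusminus> j\<close> with the sign of \<open>N\<close>, and the \<open>q\<^sub>n\<close> are polynomials on which the raising
  operators act as \<open>d/dt\<close>. Differentiating their differential equation and their first-order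
  ladder relations raises \<open>M\<close>, so both follow from the case of Legendre polynomials. The ladder
  relations make the operator tridiagonal on the \<open>q\<^sub>n\<close>, symmetric with respect to the
  normalization constants and without an entry from degree \<open>L\<close> to degree \<open>L + 1\<close>; hence applying
  it to either argument of the kernel gives the same result. On the cap the operator is formally
  self-adjoint in \<open>t\<close>: \<open>b - t\<close> removes the boundary term at the rim and \<open>1 - t\<^sup>2\<close> the one at the
  pole. Integration over the longitude leaves only the order \<open>j\<close> of \<open>u\<close>.
\<close>

section \<open>Differential equation and ladder relations\<close>

text \<open>\<open>spin_ode\<close> is Jacobi's equation with parameters \<open>N + m\<close> and
  \<open>N - m\<close> and degree \<open>n - N\<close>. The exponents of the weight carry a signed
  \<open>m\<close> because the weight is the integrating factor of the zero-order term of the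
  raising operator: raising is then plain differentiation for every \<open>M\<close>, without a case
  split. The price is a weight that is singular at \<open>t = 1\<close> when
  \<open>M + m < 0\<close>; a zero of the polynomial has to compensate.

  The coefficients of the operator are forced. Together, \<open>(b - t)\<close> times the
  second-order part and \<open>(t^2 - 1) y'\<close> form the divergence
  \<open>((b - t) (1 - t^2) y')'\<close>. The entry from degree \<open>n\<close> to
  \<open>n + 1\<close> and the entry back share the factor \<open>n (n + 2) - L (L + 2)\<close>,
  which vanishes at \<open>n = L\<close>.

  The obstacle at the pole is that derivatives of \<open>u\<close> and of the harmonics may be
  unbounded there. Only \<open>(1 - t^2) H'\<close> and the Beltrami operator as a whole are
  controlled, so boundary terms and integrability are expressed through these two.\<close>

definition spin_ode :: "real \<Rightarrow> real \<Rightarrow> real \<Rightarrow> real poly \<Rightarrow> bool" where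
  "spin_ode N m n q \<longleftrightarrow>
     (\<forall>t. (1 - t\<^sup>2) * poly (pderiv (pderiv q)) t - 2 * ((N + 1) * t + m) * poly (pderiv q) t
        + (n - N) * (n + N + 1) * poly q t = 0)"

text \<open>
  With \<open>n\<close> read as the degree this is the relation between degrees \<open>n\<close> and \<open>n + 1\<close>; as
  \<open>spin_ode\<close> is invariant under \<open>n \<mapsto> - n - 1\<close>, a degree \<open>n\<close> entered as \<open>- n - 1\<close> gives the relation
  between \<open>n\<close> and \<open>n - 1\<close>.
\<close>

definition ladder :: "real \<Rightarrow> real \<Rightarrow> real \<Rightarrow> real \<Rightarrow> real poly \<Rightarrow> real poly \<Rightarrow> bool" where
  "ladder N m n c q r \<longleftrightarrow>
     (\<forall>t. (n + 1) * ((t\<^sup>2 - 1) * poly (pderiv q) t + ((N + n + 1) * t + m) * poly q t)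
        + N * m * poly q t = (n + 1 - N) * c * poly r t)"

lemma poly_eq_imp_pderiv_eq:
  fixes p q :: "real poly"
  assumes "\<And>t. poly p t = poly q t"
  shows "poly (pderiv p) t = poly (pderiv q) t"
  using assms poly_eq_poly_eq_iff[of p q] by auto

text \<open>Differentiation adds \<open>- 2 t\<close> to the first-order coefficient and
  \<open>- 2 (N + 1)\<close> to the constant; the latter still factors, since
  \<open>(n - N) (n + N + 1) - 2 (N + 1) = (n - N - 1) (n + N + 2)\<close>.\<close>

lemma spin_ode_pderiv:
  assumes "spin_ode N m n q"
  shows "spin_ode (N + 1) m n (pderiv q)"
  unfolding spin_ode_def
proof
  fix t
  let ?e = "[:1, 0, -1:] * pderiv (pderiv q) - [:2 * m, 2 * (N + 1):] * pderiv q
        + [:(n - N) * (n + N + 1):] * q"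
  have "poly ?e s = poly 0 s" for s
    using assms[unfolded spin_ode_def, rule_format, of s] by (simp add: algebra_simps power2_eq_square)
  then have "poly (pderiv ?e) t = poly (pderiv 0) t"
    by (rule poly_eq_imp_pderiv_eq)
  then show "(1 - t\<^sup>2) * poly (pderiv (pderiv (pderiv q))) t
      - 2 * ((N + 1 + 1) * t + m) * poly (pderiv (pderiv q)) t
      + (n - (N + 1)) * (n + (N + 1) + 1) * poly (pderiv q) t = 0"
    by (simp add: pderiv_mult pderiv_add pderiv_diff pderiv_smult pderiv_minus pderiv_pCons algebra_simps power2_eq_square)
qed

text \<open>The differentiated relation still contains \<open>q\<close> itself. After multiplication
  by \<open>n - N\<close>, the differential equation trades it for the first two derivatives of
  \<open>q\<close>. The result carries the common factor \<open>n + 1 - N\<close>, which must be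
  nonzero to be cancelled; \<open>c\<close> passes through unchanged.\<close>

lemma ladder_pderiv:
  assumes ode: "spin_ode N m n q" and lad: "ladder N m n c q r" and nz: "n + 1 - N \<noteq> 0"
  shows "ladder (N + 1) m n c (pderiv q) (pderiv r)"
  unfolding ladder_def
proof
  fix t
  let ?l = "[:n + 1:] * ([:-1, 0, 1:] * pderiv q + [:m, N + n + 1:] * q) + [:N * m:] * q"
  have "poly ?l s = poly ([:(n + 1 - N) * c:] * r) s" for s
    using lad[unfolded ladder_def, rule_format, of s] by (simp add: algebra_simps power2_eq_square)
  then have "poly (pderiv ?l) t = poly (pderiv ([:(n + 1 - N) * c:] * r)) t"
    by (rule poly_eq_imp_pderiv_eq)
  then have e1: "(n + 1) * ((t\<^sup>2 - 1) * poly (pderiv (pderiv q)) t + 2 * t * poly (pderiv q) t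
       + ((N + n + 1) * t + m) * poly (pderiv q) t + (N + n + 1) * poly q t)
       + N * m * poly (pderiv q) t = (n + 1 - N) * c * poly (pderiv r) t"
    by (simp add: pderiv_mult pderiv_add pderiv_diff pderiv_smult pderiv_minus pderiv_pCons algebra_simps power2_eq_square)
  have e2: "(1 - t\<^sup>2) * poly (pderiv (pderiv q)) t - 2 * ((N + 1) * t + m) * poly (pderiv q) t
        + (n - N) * (n + N + 1) * poly q t = 0"
    using ode unfolding spin_ode_def by blast
  have "(n + 1 - N) * ((n + 1) * ((t\<^sup>2 - 1) * poly (pderiv (pderiv q)) t + ((N + 1 + n + 1) * t + m) * poly (pderiv q) t)
        + (N + 1) * m * poly (pderiv q) t) = (n + 1 - N) * ((n + 1 - (N + 1)) * c * poly (pderiv r) t)"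
    using e1 e2 by algebra
  then show "(n + 1) * ((t\<^sup>2 - 1) * poly (pderiv (pderiv q)) t + ((N + 1 + n + 1) * t + m) * poly (pderiv q) t)
        + (N + 1) * m * poly (pderiv q) t = (n + 1 - (N + 1)) * c * poly (pderiv r) t"
    using nz by simp
qed

section \<open>Legendre polynomials: first-order recurrences from the Rodrigues formula\<close>

definition legendre_poly :: "nat \<Rightarrow> real poly" where
  "legendre_poly n = smult (1 / (2 ^ n * fact n)) ((pderiv ^^ n) ([:-1, 0, 1:] ^ n))"

lemma pderiv_funpow_Suc: "(pderiv ^^ Suc n) p = (pderiv ^^ n) (pderiv p)"
  by (simp add: funpow_swap1)

lemma pderiv_funpow_smult: "(pderiv ^^ n) (smult c p) = smult c ((pderiv ^^ n) p)"
  for p :: "real poly"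
  by (induction n) (auto simp: pderiv_smult)

lemma pderiv_funpow_X_mult:
  fixes p :: "real poly"
  shows "(pderiv ^^ Suc n) ([:0, 1:] * p)
    = [:0, 1:] * (pderiv ^^ Suc n) p + smult (real (Suc n)) ((pderiv ^^ n) p)"
proof (induction n)
  case 0
  show ?case by (simp add: pderiv_mult pderiv_pCons)
next
  case (Suc n)
  have "(pderiv ^^ Suc (Suc n)) ([:0, 1:] * p)
     = pderiv ([:0, 1:] * (pderiv ^^ Suc n) p + smult (real (Suc n)) ((pderiv ^^ n) p))"
    using Suc.IH by (metis funpow_simps_right(2) funpow_swap1 comp_apply funpow.simps(2))
  also have "\<dots> = [:0, 1:] * (pderiv ^^ Suc (Suc n)) p + smult (real (Suc (Suc n))) ((pderiv ^^ Suc n) p)"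
    by (simp add: pderiv_mult pderiv_add pderiv_smult pderiv_pCons poly_eq_poly_eq_iff[symmetric] fun_eq_iff algebra_simps)
  finally show ?case .
qed

lemma pderiv_funpow_X2_mult:
  fixes p :: "real poly"
  shows "(pderiv ^^ Suc (Suc n)) ([:-1, 0, 1:] * p)
    = [:-1, 0, 1:] * (pderiv ^^ Suc (Suc n)) p + smult (2 * real (Suc (Suc n))) ([:0, 1:] * (pderiv ^^ Suc n) p)
      + smult (real (Suc n) * real (Suc (Suc n))) ((pderiv ^^ n) p)"
proof (induction n)
  case 0
  have "pderiv ([:-1, 0, 1:] * p) = [:-1, 0, 1:] * pderiv p + [:0, 2:] * p"
    by (simp del: mult_pCons_left add: pderiv_mult pderiv_pCons) simp
  then have "(pderiv ^^ Suc (Suc 0)) ([:-1, 0, 1:] * p) = pderiv ([:-1, 0, 1:] * pderiv p + [:0, 2:] * p)"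
    by (simp only: funpow.simps comp_apply id_apply)
  also have "\<dots> = [:-1, 0, 1:] * pderiv (pderiv p) + [:0, 4:] * pderiv p + smult 2 p"
    by (simp del: mult_pCons_left add: pderiv_mult pderiv_add pderiv_pCons) (simp add: poly_eq_poly_eq_iff[symmetric] fun_eq_iff algebra_simps)
  finally show ?case by simp
next
  case (Suc n)
  have "(pderiv ^^ Suc (Suc (Suc n))) ([:-1, 0, 1:] * p) = pderiv ((pderiv ^^ Suc (Suc n)) ([:-1, 0, 1:] * p))"
    by simp
  also have "\<dots> = [:-1, 0, 1:] * (pderiv ^^ Suc (Suc (Suc n))) p + smult (2 * real (Suc (Suc (Suc n)))) ([:0, 1:] * (pderiv ^^ Suc (Suc n)) p)
      + smult (real (Suc (Suc n)) * real (Suc (Suc (Suc n)))) ((pderiv ^^ Suc n) p)"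
    unfolding Suc.IH
    by (simp del: mult_pCons_left add: pderiv_mult pderiv_add pderiv_smult pderiv_pCons)
      (simp add: poly_eq_poly_eq_iff[symmetric] fun_eq_iff algebra_simps)
  finally show ?case .
qed

lemma pderiv_rodrigues:
  "pderiv ([:-1, 0, 1:] ^ Suc n) = smult (2 * real (Suc n)) ([:0, 1:] * [:-1, 0, 1:] ^ n :: real poly)"
  by (simp del: mult_pCons_left power_Suc add: pderiv_power_Suc pderiv_pCons poly_eq_poly_eq_iff[symmetric] fun_eq_iff algebra_simps)

lemma rodrigues_pderiv_Suc:
  "(pderiv ^^ Suc (Suc n)) ([:-1, 0, 1:] ^ Suc n) =
     smult (2 * real (Suc n)) ([:0, 1:] * (pderiv ^^ Suc n) ([:-1, 0, 1:] ^ n)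
       + smult (real (Suc n)) ((pderiv ^^ n) ([:-1, 0, 1:] ^ n :: real poly)))"
  by (subst pderiv_funpow_Suc) (simp only: pderiv_rodrigues pderiv_funpow_smult pderiv_funpow_X_mult)

text \<open>There are two Leibniz expansions of the left side: splitting off a factor
  \<open>t^2 - 1\<close>, or differentiating the power once before expanding. Twice the first minus
  the second removes the derivative of order \<open>n - 1\<close>.\<close>

lemma rodrigues_Suc:
  "(pderiv ^^ Suc n) ([:-1, 0, 1:] ^ Suc n) =
     2 * [:-1, 0, 1:] * (pderiv ^^ Suc n) ([:-1, 0, 1:] ^ n)
       + smult (2 * real (Suc n)) ([:0, 1:] * (pderiv ^^ n) ([:-1, 0, 1:] ^ n :: real poly))"
proof (cases n)
  case 0
  then show ?thesis by (simp add: pderiv_pCons)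
next
  case (Suc k)
  let ?v = "[:-1, 0, 1:] ^ n :: real poly"
  have "(pderiv ^^ Suc n) ([:-1, 0, 1:] ^ Suc n) = (pderiv ^^ Suc (Suc k)) ([:-1, 0, 1:] * ?v)"
    by (simp only: Suc power_Suc)
  then have 1: "(pderiv ^^ Suc n) ([:-1, 0, 1:] ^ Suc n) = [:-1, 0, 1:] * (pderiv ^^ Suc n) ?v
      + smult (2 * real (Suc n)) ([:0, 1:] * (pderiv ^^ n) ?v)
      + smult (real n * real (Suc n)) ((pderiv ^^ k) ?v)"
    unfolding pderiv_funpow_X2_mult by (simp only: Suc)
  have "(pderiv ^^ Suc n) ([:-1, 0, 1:] ^ Suc n) = (pderiv ^^ n) (pderiv ([:-1, 0, 1:] ^ Suc n))"
    by (rule pderiv_funpow_Suc)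
  also have "\<dots> = smult (2 * real (Suc n)) ((pderiv ^^ Suc k) ([:0, 1:] * ?v))"
    by (simp only: pderiv_rodrigues pderiv_funpow_smult Suc)
  finally have 2: "(pderiv ^^ Suc n) ([:-1, 0, 1:] ^ Suc n) = smult (2 * real (Suc n))
      ([:0, 1:] * (pderiv ^^ n) ?v + smult (real n) ((pderiv ^^ k) ?v))"
    unfolding pderiv_funpow_X_mult by (simp only: Suc)
  have "2 * (pderiv ^^ Suc n) ([:-1, 0, 1:] ^ Suc n) - (pderiv ^^ Suc n) ([:-1, 0, 1:] ^ Suc n)
     = 2 * [:-1, 0, 1:] * (pderiv ^^ Suc n) ?v + smult (2 * real (Suc n)) ([:0, 1:] * (pderiv ^^ n) ?v)"
    by (subst 1, subst 2, simp only: poly_eq_poly_eq_iff[symmetric] fun_eq_iff) (simp add: algebra_simps del: funpow.simps)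
  then show ?thesis by simp
qed

lemma rodrigues_coeff_Suc:
  "real (Suc n) * (1 / (2 ^ Suc n * fact (Suc n)) * x) = 1 / (2 ^ n * fact n) / 2 * x"
  by (simp del: of_nat_Suc)

lemma legendre_poly_Suc:
  "real (Suc n) * poly (legendre_poly (Suc n)) t
     = (t\<^sup>2 - 1) * poly (pderiv (legendre_poly n)) t + real (Suc n) * t * poly (legendre_poly n) t"
proof -
  let ?c = "1 / (2 ^ n * fact n) :: real"
  have "real (Suc n) * poly (legendre_poly (Suc n)) t =
      ?c / 2 * poly ((pderiv ^^ Suc n) ([:-1, 0, 1:] ^ Suc n)) t"
    unfolding legendre_poly_def poly_smult by (rule rodrigues_coeff_Suc)
  also have "\<dots> = ?c * ((t\<^sup>2 - 1) * poly ((pderiv ^^ Suc n) ([:-1, 0, 1:] ^ n)) t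
       + real (Suc n) * t * poly ((pderiv ^^ n) ([:-1, 0, 1:] ^ n)) t)"
    unfolding rodrigues_Suc by (simp add: field_simps power2_eq_square del: funpow.simps)
  also have "\<dots> = (t\<^sup>2 - 1) * poly (pderiv (legendre_poly n)) t + real (Suc n) * t * poly (legendre_poly n) t"
    by (simp add: legendre_poly_def pderiv_smult algebra_simps add_divide_distrib diff_divide_distrib)
  finally show ?thesis .
qed

lemma pderiv_legendre_poly_Suc:
  "poly (pderiv (legendre_poly (Suc n))) t
     = t * poly (pderiv (legendre_poly n)) t + real (Suc n) * poly (legendre_poly n) t"
proof -
  let ?c = "1 / (2 ^ n * fact n) :: real"
  have "real (Suc n) * poly (pderiv (legendre_poly (Suc n))) t =
      ?c / 2 * poly ((pderiv ^^ Suc (Suc n)) ([:-1, 0, 1:] ^ Suc n)) t"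
    unfolding legendre_poly_def pderiv_smult poly_smult funpow.simps(2)[of "Suc n"] comp_apply by (rule rodrigues_coeff_Suc)
  also have "\<dots> = real (Suc n) * (?c * (t * poly ((pderiv ^^ Suc n) ([:-1, 0, 1:] ^ n)) t
       + real (Suc n) * poly ((pderiv ^^ n) ([:-1, 0, 1:] ^ n)) t))"
    unfolding rodrigues_pderiv_Suc by (simp add: field_simps power2_eq_square del: funpow.simps)
  also have "\<dots> = real (Suc n) * (t * poly (pderiv (legendre_poly n)) t + real (Suc n) * poly (legendre_poly n) t)"
    by (simp add: legendre_poly_def pderiv_smult algebra_simps add_divide_distrib diff_divide_distrib)
  finally show ?thesis by (simp del: of_nat_Suc)
qed

lemma ladder_legendre: "ladder 0 0 (real n) (real n + 1) (legendre_poly n) (legendre_poly (Suc n))"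
  unfolding ladder_def
proof
  fix t
  show "(real n + 1) * ((t\<^sup>2 - 1) * poly (pderiv (legendre_poly n)) t
        + ((0 + real n + 1) * t + 0) * poly (legendre_poly n) t)
        + 0 * 0 * poly (legendre_poly n) t = (real n + 1 - 0) * (real n + 1) * poly (legendre_poly (Suc n)) t"
    using legendre_poly_Suc[of n t] unfolding of_nat_Suc by algebra
qed

text \<open>Differentiating \<open>legendre_poly_Suc\<close> gives a second expression for the
  derivative in degree \<open>n + 1\<close>; comparison with \<open>pderiv_legendre_poly_Suc\<close>
  eliminates that degree and leaves Legendre's equation.\<close>

lemma spin_ode_legendre: "spin_ode 0 0 (real n) (legendre_poly n)"
  unfolding spin_ode_def
proof
  fix t
  let ?l = "smult (real (Suc n)) (legendre_poly (Suc n))"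
  let ?r = "[:-1, 0, 1:] * pderiv (legendre_poly n) + [:0, real (Suc n):] * legendre_poly n"
  have "poly ?l s = poly ?r s" for s
    using legendre_poly_Suc[of n s] by (simp add: algebra_simps power2_eq_square)
  then have "poly (pderiv ?l) t = poly (pderiv ?r) t"
    by (rule poly_eq_imp_pderiv_eq)
  then have "(real n + 1) * poly (pderiv (legendre_poly (Suc n))) t
     = (t\<^sup>2 - 1) * poly (pderiv (pderiv (legendre_poly n))) t + 2 * t * poly (pderiv (legendre_poly n)) t
       + (real n + 1) * (t * poly (pderiv (legendre_poly n)) t + poly (legendre_poly n) t)"
    by (simp add: pderiv_mult pderiv_add pderiv_diff pderiv_smult pderiv_minus pderiv_pCons algebra_simps power2_eq_square)
  then show "(1 - t\<^sup>2) * poly (pderiv (pderiv (legendre_poly n))) t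
      - 2 * ((0 + 1) * t + 0) * poly (pderiv (legendre_poly n)) t
      + (real n - 0) * (real n + 0 + 1) * poly (legendre_poly n) t = 0"
    unfolding pderiv_legendre_poly_Suc by (simp add: algebra_simps)
qed

text \<open>Here \<open>- n - 2\<close> is the degree \<open>n + 1\<close> in reflected form. The
  relation follows by eliminating the derivative in degree \<open>n\<close> between the two
  recurrences.\<close>

lemma ladder_down_legendre:
  "ladder 0 0 (- real n - 2) (- real n - 1) (legendre_poly (Suc n)) (legendre_poly n)"
  unfolding ladder_def
proof
  fix t
  show "(- real n - 2 + 1) * ((t\<^sup>2 - 1) * poly (pderiv (legendre_poly (Suc n))) t
        + ((0 + (- real n - 2) + 1) * t + 0) * poly (legendre_poly (Suc n)) t)
        + 0 * 0 * poly (legendre_poly (Suc n)) t = (- real n - 2 + 1 - 0) * (- real n - 1) * poly (legendre_poly n) t"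
    using legendre_poly_Suc[of n t] pderiv_legendre_poly_Suc[of n t] unfolding of_nat_Suc by algebra
qed

section \<open>Trading the weight parameter for the order by a power of a linear factor\<close>

lemma poly_pderiv_linear_power:
  fixes \<sigma> :: real
  shows "(1 + \<sigma> * t) * poly (pderiv ([:1, \<sigma>:] ^ k)) t = real k * \<sigma> * (1 + \<sigma> * t) ^ k"
proof (cases k)
  case (Suc l)
  have "pderiv ([:1, \<sigma>:] ^ k) = smult (real k * \<sigma>) ([:1, \<sigma>:] ^ l)"
    unfolding Suc pderiv_power_Suc by (simp add: pderiv_pCons mult.commute)
  then show ?thesis by (simp add: Suc mult.commute del: power_Suc) (simp add: mult.commute)
qed simp

lemma poly_pderiv2_linear_power:
  fixes \<sigma> :: real
  shows "(1 + \<sigma> * t)\<^sup>2 * poly (pderiv (pderiv ([:1, \<sigma>:] ^ k))) t = real k * (real k - 1) * \<sigma>\<^sup>2 * (1 + \<sigma> * t) ^ k"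
proof -
  have "poly ([:1, \<sigma>:] * pderiv ([:1, \<sigma>:] ^ k)) s = poly (smult (real k * \<sigma>) ([:1, \<sigma>:] ^ k)) s" for s
    using poly_pderiv_linear_power[of \<sigma> s k] by (simp add: algebra_simps)
  then have "poly (pderiv ([:1, \<sigma>:] * pderiv ([:1, \<sigma>:] ^ k))) t = poly (pderiv (smult (real k * \<sigma>) ([:1, \<sigma>:] ^ k))) t"
    by (rule poly_eq_imp_pderiv_eq)
  then have "(1 + \<sigma> * t) * poly (pderiv (pderiv ([:1, \<sigma>:] ^ k))) t = (real k - 1) * \<sigma> * poly (pderiv ([:1, \<sigma>:] ^ k)) t"
    by (simp add: pderiv_mult pderiv_smult pderiv_pCons algebra_simps del: mult_pCons_left)
  moreover have "a\<^sup>2 * v = k' * (k' - 1) * \<sigma>\<^sup>2 * b" if "a * v = (k' - 1) * \<sigma> * d" "a * d = k' * \<sigma> * b"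
    for a v d b k' :: real
    using that by algebra
  ultimately show ?thesis
    using poly_pderiv_linear_power[of \<sigma> t k] by blast
qed

text \<open>The function \<open>(1 - t^2)^(k/2) * r\<close> has two readings: the weight for
  \<open>N = k\<close>, \<open>m = 0\<close> times \<open>r\<close>, and the weight for
  \<open>N = 0\<close>, \<open>m = \<sigma> * k\<close> times
  \<open>(1 + \<sigma> * t)^k * r\<close>. Being one function, it satisfies one equation, which
  takes the form \<open>spin_ode\<close> in either reading.\<close>

lemma spin_ode_linear_power:
  fixes \<sigma> :: real
  assumes ode: "spin_ode (real k) 0 n r" and \<sigma>: "\<sigma>\<^sup>2 = 1"
  shows "spin_ode 0 (\<sigma> * real k) n ([:1, \<sigma>:] ^ k * r)"
proof -
  let ?u = "[:1, \<sigma>:] ^ k"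
  let ?q = "?u * r"
  let ?E = "[:1, 0, -1:] * pderiv (pderiv ?q) - [:2 * (\<sigma> * real k), 2:] * pderiv ?q + smult (n * (n + 1)) ?q"
  \<comment> \<open>The square of the linear factor turns the first two derivatives of its power
    into multiples of the power, avoiding the exponents \<open>k - 1\<close> and
    \<open>k - 2\<close>. It is cancelled afterwards because polynomials have no zero
    divisors.\<close>
  have "poly ([:1, \<sigma>:] ^ 2 * ?E) t = poly 0 t" for t
  proof -
    define a where "a = 1 + \<sigma> * t"
    define u u' u'' where "u = poly ?u t" and "u' = poly (pderiv ?u) t" and "u'' = poly (pderiv (pderiv ?u)) t"
    define r0 r' r'' where "r0 = poly r t" and "r' = poly (pderiv r) t" and "r'' = poly (pderiv (pderiv r)) t"
    have u: "a * u' = real k * \<sigma> * u" "a\<^sup>2 * u'' = real k * (real k - 1) * \<sigma>\<^sup>2 * u"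
      using poly_pderiv_linear_power[of \<sigma> t k] poly_pderiv2_linear_power[of \<sigma> t k]
      by (simp_all add: a_def u_def u'_def u''_def mult.commute)
    have o: "(1 - t\<^sup>2) * r'' - 2 * (real k + 1) * t * r' + (n - real k) * (n + real k + 1) * r0 = 0"
      using ode[unfolded spin_ode_def, rule_format, of t] unfolding r0_def r'_def r''_def by algebra
    have "a\<^sup>2 * ((1 - t\<^sup>2) * (u'' * r0 + 2 * u' * r' + u * r'') - 2 * (t + \<sigma> * real k) * (u' * r0 + u * r') + n * (n + 1) * (u * r0)) = 0"
      using u o \<sigma> a_def by algebra
    moreover have "poly ([:1, \<sigma>:] ^ 2 * ?E) t = a\<^sup>2 * ((1 - t\<^sup>2) * (u'' * r0 + 2 * u' * r' + u * r'') - 2 * (t + \<sigma> * real k) * (u' * r0 + u * r') + n * (n + 1) * (u * r0))"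
      by (simp add: pderiv_mult pderiv_add a_def u_def u'_def u''_def r0_def r'_def r''_def power2_eq_square algebra_simps del: mult_pCons_left)
    ultimately show ?thesis by simp
  qed
  then have "[:1, \<sigma>:] ^ 2 * ?E = 0"
    using poly_eq_poly_eq_iff[of "[:1, \<sigma>:] ^ 2 * ?E" 0] by auto
  then have E: "?E = 0" by simp
  show ?thesis
    unfolding spin_ode_def
  proof
    fix t
    have "poly ?E t = 0" using E by simp
    then show "(1 - t\<^sup>2) * poly (pderiv (pderiv ?q)) t - 2 * ((0 + 1) * t + \<sigma> * real k) * poly (pderiv ?q) t
        + (n - 0) * (n + 0 + 1) * poly ?q t = 0"
      by (simp add: power2_eq_square algebra_simps)
  qed
qed

lemma ladder_linear_power:
  fixes \<sigma> :: real
  assumes lad: "ladder (real k) 0 n (n + 1) q r" and \<sigma>: "\<sigma>\<^sup>2 = 1"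
  shows "ladder 0 (\<sigma> * real k) n (n + 1 - real k) ([:1, \<sigma>:] ^ k * q) ([:1, \<sigma>:] ^ k * r)"
  unfolding ladder_def
proof
  fix t
  define u u' where "u = poly ([:1, \<sigma>:] ^ k) t" and "u' = poly (pderiv ([:1, \<sigma>:] ^ k)) t"
  define q0 q' r0 where "q0 = poly q t" and "q' = poly (pderiv q) t" and "r0 = poly r t"
  have u: "(1 + \<sigma> * t) * u' = real k * \<sigma> * u"
    using poly_pderiv_linear_power[of \<sigma> t k] by (simp add: u_def u'_def mult.commute)
  have l: "(n + 1) * ((t\<^sup>2 - 1) * q' + ((real k + n + 1) * t) * q0) = (n + 1 - real k) * (n + 1) * r0"
    using lad[unfolded ladder_def, rule_format, of t] unfolding q0_def q'_def r0_def by algebra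
  have "(n + 1) * ((t\<^sup>2 - 1) * (u' * q0 + u * q') + ((n + 1) * t + \<sigma> * real k) * (u * q0)) = (n + 1) * (n + 1 - real k) * (u * r0)"
    using u l \<sigma> by algebra
  then show "(n + 1) * ((t\<^sup>2 - 1) * poly (pderiv ([:1, \<sigma>:] ^ k * q)) t
        + ((0 + n + 1) * t + \<sigma> * real k) * poly ([:1, \<sigma>:] ^ k * q) t)
        + 0 * (\<sigma> * real k) * poly ([:1, \<sigma>:] ^ k * q) t
        = (n + 1 - 0) * (n + 1 - real k) * poly ([:1, \<sigma>:] ^ k * r) t"
    by (simp add: pderiv_mult u_def u'_def q0_def q'_def r0_def algebra_simps del: mult_pCons_left)
qed

lemma spin_ode_assoc_legendre: "spin_ode (real k) 0 (real n) ((pderiv ^^ k) (legendre_poly n))"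
proof (induction k)
  case (Suc k)
  from spin_ode_pderiv[OF this] show ?case by (simp add: add.commute)
qed (simp add: spin_ode_legendre)

lemma ladder_assoc_legendre:
  "k \<le> n \<Longrightarrow> ladder (real k) 0 (real n) (real n + 1)
     ((pderiv ^^ k) (legendre_poly n)) ((pderiv ^^ k) (legendre_poly (Suc n)))"
proof (induction k)
  case (Suc k)
  then have "ladder (real k + 1) 0 (real n) (real n + 1)
     (pderiv ((pderiv ^^ k) (legendre_poly n))) (pderiv ((pderiv ^^ k) (legendre_poly (Suc n))))"
    by (intro ladder_pderiv spin_ode_assoc_legendre) auto
  then show ?case by (simp add: add.commute)
qed (simp add: ladder_legendre)

lemma spin_ode_reflect: "spin_ode N m (- n - 1) q \<longleftrightarrow> spin_ode N m n q"
proof -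
  have "(- n - 1 - N) * (- n - 1 + N + 1) = (n - N) * (n + N + 1)" by algebra
  then show ?thesis unfolding spin_ode_def by simp
qed

lemma ladder_down_assoc_legendre:
  "ladder (real k) 0 (- real n - 2) (- real n - 1)
     ((pderiv ^^ k) (legendre_poly (Suc n))) ((pderiv ^^ k) (legendre_poly n))"
proof (induction k)
  case (Suc k)
  have "spin_ode (real k) 0 (- real (Suc n) - 1) ((pderiv ^^ k) (legendre_poly (Suc n)))"
    unfolding spin_ode_reflect by (rule spin_ode_assoc_legendre)
  then have "spin_ode (real k) 0 (- real n - 2) ((pderiv ^^ k) (legendre_poly (Suc n)))"
    by (simp add: algebra_simps)
  then have "ladder (real k + 1) 0 (- real n - 2) (- real n - 1)
     (pderiv ((pderiv ^^ k) (legendre_poly (Suc n)))) (pderiv ((pderiv ^^ k) (legendre_poly n)))"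
    using Suc by (intro ladder_pderiv) auto
  then show ?case by (simp add: add.commute)
qed (simp add: ladder_down_legendre)

section \<open>The polynomial factors for all spins and both signs of the order\<close>

definition sgn_unit :: "int \<Rightarrow> real" where
  "sgn_unit m = (if 0 \<le> m then 1 else - 1)"

lemma sgn_unit_square: "(sgn_unit m)\<^sup>2 = 1" and sgn_unit_mult_abs: "sgn_unit m * real (nat \<bar>m\<bar>) = of_int m"
  by (auto simp: sgn_unit_def)

text \<open>The polynomial that is differentiated \<open>M\<close> times is the associated Legendre
  function divided by the weight for \<open>M = 0\<close>; the sign of \<open>m\<close> decides
  which of \<open>1 + t\<close> and \<open>1 - t\<close> is left over by the division. Each outer
  derivative stands for one raising operator.\<close>

definition spin_poly :: "nat \<Rightarrow> int \<Rightarrow> nat \<Rightarrow> real poly" where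
  "spin_poly M m n =
     (pderiv ^^ M) ([:1, sgn_unit m:] ^ nat \<bar>m\<bar> * (pderiv ^^ nat \<bar>m\<bar>) (legendre_poly n))"

lemma pderiv_spin_poly: "pderiv (spin_poly M m n) = spin_poly (Suc M) m n"
  by (simp add: spin_poly_def)

lemma spin_ode_spin_poly: "spin_ode (real M) (of_int m) (real n) (spin_poly M m n)"
proof (induction M)
  case 0
  show ?case
    using spin_ode_linear_power[OF spin_ode_assoc_legendre sgn_unit_square[of m], of "nat \<bar>m\<bar>" n]
    unfolding sgn_unit_mult_abs by (simp add: spin_poly_def)
next
  case (Suc M)
  from spin_ode_pderiv[OF this] show ?case by (simp add: add.commute pderiv_spin_poly)
qed

text \<open>The bound \<open>M \<le> n\<close> keeps the factor cancelled in
  \<open>ladder_pderiv\<close> away from zero at every step.\<close>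

lemma ladder_spin_poly:
  assumes "nat \<bar>m\<bar> \<le> n"
  shows "M \<le> n \<Longrightarrow> ladder (real M) (of_int m) (real n) (real n + 1 - real (nat \<bar>m\<bar>))
     (spin_poly M m n) (spin_poly M m (Suc n))"
proof (induction M)
  case 0
  show ?case
    using ladder_linear_power[OF ladder_assoc_legendre[OF assms] sgn_unit_square, of m]
    unfolding sgn_unit_mult_abs by (simp add: spin_poly_def)
next
  case (Suc M)
  then have "ladder (real M + 1) (of_int m) (real n) (real n + 1 - real (nat \<bar>m\<bar>))
     (pderiv (spin_poly M m n)) (pderiv (spin_poly M m (Suc n)))"
    by (intro ladder_pderiv spin_ode_spin_poly) auto
  then show ?case by (simp add: add.commute pderiv_spin_poly)
qed

text \<open>For the reflected degree the factor cancelled in \<open>ladder_pderiv\<close> is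
  \<open>- n - 1 - M\<close>, which is negative, so the induction runs through all
  \<open>M\<close>.\<close>

lemma ladder_down_spin_poly:
  "ladder (real M) (of_int m) (- real n - 2) (- real n - 1 - real (nat \<bar>m\<bar>))
     (spin_poly M m (Suc n)) (spin_poly M m n)"
proof (induction M)
  case 0
  have "ladder (real (nat \<bar>m\<bar>)) 0 (- real n - 2) (- real n - 2 + 1)
     ((pderiv ^^ nat \<bar>m\<bar>) (legendre_poly (Suc n))) ((pderiv ^^ nat \<bar>m\<bar>) (legendre_poly n))"
  proof -
    have "- real n - 2 + 1 = - real n - 1" by simp
    then show ?thesis using ladder_down_assoc_legendre[of "nat \<bar>m\<bar>" n] by (simp only:)
  qed
  moreover have "- real n - 2 + 1 - real (nat \<bar>m\<bar>) = - real n - 1 - real (nat \<bar>m\<bar>)" by simp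
  ultimately show ?case
    using ladder_linear_power[OF _ sgn_unit_square[of m], of "nat \<bar>m\<bar>" "- real n - 2"]
    unfolding sgn_unit_mult_abs spin_poly_def by (metis funpow_0 of_nat_0)
next
  case (Suc M)
  have "spin_ode (real M) (of_int m) (- real (Suc n) - 1) (spin_poly M m (Suc n))"
    unfolding spin_ode_reflect by (rule spin_ode_spin_poly)
  then have "spin_ode (real M) (of_int m) (- real n - 2) (spin_poly M m (Suc n))"
    by (simp add: algebra_simps)
  then have "ladder (real M + 1) (of_int m) (- real n - 2) (- real n - 1 - real (nat \<bar>m\<bar>))
     (pderiv (spin_poly M m (Suc n))) (pderiv (spin_poly M m n))"
    using Suc by (intro ladder_pderiv) auto
  then show ?case by (simp add: add.commute pderiv_spin_poly)
qed

lemma degree_pderiv_funpow: "degree ((pderiv ^^ k) p) = degree p - k"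
  for p :: "real poly"
  by (induction k) (simp_all add: degree_pderiv)

lemma pderiv_funpow_eq_0:
  fixes p :: "real poly"
  assumes "degree p < k"
  shows "(pderiv ^^ k) p = 0"
proof -
  obtain l where "k = Suc l" using assms by (cases k) auto
  then show ?thesis using assms degree_pderiv_funpow[of l p] by (simp add: pderiv_eq_0_iff)
qed

lemma degree_legendre_poly_le: "degree (legendre_poly n) \<le> n"
proof -
  have "degree ([:-1, 0, 1:] ^ n :: real poly) \<le> 2 * n"
    using degree_power_le[of "[:-1, 0, 1:] :: real poly" n] by simp
  then show ?thesis by (simp add: legendre_poly_def degree_pderiv_funpow)
qed

text \<open>A polynomial of degree at most \<open>n\<close> is differentiated too often. This is
  what closes the tridiagonal system at its lowest degree.\<close>

lemma spin_poly_eq_0: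
  assumes "n < max M (nat \<bar>m\<bar>)"
  shows "spin_poly M m n = 0"
proof (cases "n < nat \<bar>m\<bar>")
  case True
  then have "(pderiv ^^ nat \<bar>m\<bar>) (legendre_poly n) = 0"
    using degree_legendre_poly_le[of n] by (intro pderiv_funpow_eq_0) auto
  moreover have "(pderiv ^^ M) 0 = (0 :: real poly)"
    by (induction M) auto
  ultimately show ?thesis by (simp add: spin_poly_def)
next
  case False
  let ?k = "nat \<bar>m\<bar>"
  have "degree ([:1, sgn_unit m:] ^ ?k * (pderiv ^^ ?k) (legendre_poly n))
     \<le> degree ([:1, sgn_unit m:] ^ ?k) + degree ((pderiv ^^ ?k) (legendre_poly n))"
    by (rule degree_mult_le)
  also have "\<dots> \<le> ?k + (n - ?k)"
    using degree_legendre_poly_le[of n] degree_power_le[of "[:1, sgn_unit m:]" ?k]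
    by (intro add_mono) (auto simp: degree_pderiv_funpow sgn_unit_def intro: diff_le_mono)
  also have "\<dots> < M" using False assms by auto
  finally show ?thesis unfolding spin_poly_def by (rule pderiv_funpow_eq_0)
qed

section \<open>Commutation of the kernel\<close>

text \<open>The radial part of \<open>I_op\<close> on the weight times \<open>q\<^sub>n\<close>, divided by the weight; the second
  derivative has been eliminated by the differential equation.\<close>

definition tridiag_op :: "real \<Rightarrow> nat \<Rightarrow> nat \<Rightarrow> int \<Rightarrow> nat \<Rightarrow> real \<Rightarrow> real" where
  "tridiag_op b L M m n t =
     (- b * real n * (real n + 1) + (real n * (real n + 1) - real (L * (L + 2))) * t + (real M * t + of_int m))
        * poly (spin_poly M m n) t
     + (t\<^sup>2 - 1) * poly (pderiv (spin_poly M m n)) t"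

text \<open>In the three-term expansion of \<open>t\<close> times the polynomial of degree
  \<open>n\<close>, this is the coefficient of the polynomial of degree \<open>n + 1\<close>, and
  \<open>coeff_down\<close> that of degree \<open>n - 1\<close>.\<close>

definition coeff_up :: "nat \<Rightarrow> int \<Rightarrow> nat \<Rightarrow> real" where
  "coeff_up M m n = (real n + 1 - real M) * (real n + 1 - real (nat \<bar>m\<bar>)) / ((real n + 1) * (2 * real n + 1))"

text \<open>For \<open>n = 0\<close> the denominator vanishes and the value is 0, as it should be.\<close>

definition coeff_down :: "nat \<Rightarrow> int \<Rightarrow> nat \<Rightarrow> real" where
  "coeff_down M m n = (real n + real M) * (real n + real (nat \<bar>m\<bar>)) / (real n * (2 * real n + 1))"

text \<open>The upward and the downward ladder are two linear equations for \<open>X\<close>,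
  multiplication by \<open>t\<close>, and \<open>Y\<close>, the first-order part with the weight
  removed. In the solution the upward coefficient of \<open>Y\<close> is \<open>n\<close> times that
  of \<open>X\<close> and the downward one is \<open>- (n + 1)\<close> times; added to
  \<open>n (n + 1) - L (L + 2)\<close> this gives the factors \<open>n (n + 2) - L (L + 2)\<close>
  and \<open>(n - 1) (n + 1) - L (L + 2)\<close>.\<close>

lemma tridiag_op_eq:
  assumes n: "max M (nat \<bar>m\<bar>) \<le> n"
  shows "tridiag_op b L M m n t =
      (real n * (real n + 2) - real (L * (L + 2))) * coeff_up M m n * poly (spin_poly M m (Suc n)) t
      + (- b * real n * (real n + 1) - (real n * (real n + 1) - real (L * (L + 2)) - 1) * (real M * of_int m / (real n * (real n + 1)))) * poly (spin_poly M m n) t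
      + ((real n - 1) * (real n + 1) - real (L * (L + 2))) * coeff_down M m n * poly (spin_poly M m (n - 1)) t"
proof (cases n)
  \<comment> \<open>Degree 0 forces \<open>M = m = 0\<close>. The divisions by zero in
    \<open>coeff_down\<close> and in the diagonal entry evaluate to 0, and the truncated
    \<open>n - 1 = 0\<close> stands under a zero coefficient.\<close>
  case 0
  then have z: "M = 0" "m = 0" using n by auto
  have "spin_poly 0 0 0 = 1" by (simp add: spin_poly_def legendre_poly_def)
  moreover have "spin_poly 0 0 (Suc 0) = [:0, 1:]"
    by (simp add: spin_poly_def legendre_poly_def pderiv_pCons)
  ultimately show ?thesis
    using 0 z by (simp add: tridiag_op_def coeff_up_def coeff_down_def)
next
  case (Suc k)
  define \<nu> where "\<nu> = real n"
  have \<nu>: "\<nu> > 0" "real k = \<nu> - 1" using Suc by (auto simp: \<nu>_def)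
  define \<mu> :: real where "\<mu> = of_int m"
  define K where "K = real (nat \<bar>m\<bar>)"
  define \<Lambda> where "\<Lambda> = real (L * (L + 2))"
  define q q' qu qd where "q = poly (spin_poly M m n) t" and "q' = poly (pderiv (spin_poly M m n)) t"
    and "qu = poly (spin_poly M m (Suc n)) t" and "qd = poly (spin_poly M m (n - 1)) t"
  define X Y where "X = t * q" and "Y = (t\<^sup>2 - 1) * q' + (real M * t + \<mu>) * q"
  have l1: "ladder (real M) \<mu> \<nu> (\<nu> + 1 - K) (spin_poly M m n) (spin_poly M m (Suc n))"
    using ladder_spin_poly[of m n M] n by (simp add: \<nu>_def \<mu>_def K_def)
  have up: "(\<nu> + 1) * Y + (\<nu> + 1)\<^sup>2 * X + real M * \<mu> * q = (\<nu> + 1 - real M) * (\<nu> + 1 - K) * qu"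
    using l1[unfolded ladder_def, rule_format, of t, folded q_def q'_def qu_def] unfolding X_def Y_def by algebra
  have l2: "ladder (real M) \<mu> (- \<nu> - 1) (- \<nu> - K) (spin_poly M m n) (spin_poly M m (n - 1))"
  proof -
    have "- \<nu> - 1 = - real k - 2" "- \<nu> - K = - real k - 1 - K" "n - 1 = k" using \<nu> Suc by auto
    then show ?thesis using ladder_down_spin_poly[of M m k] unfolding \<mu>_def K_def by (simp only: Suc)
  qed
  have down: "\<nu>\<^sup>2 * X - \<nu> * Y + real M * \<mu> * q = (\<nu> + real M) * (\<nu> + K) * qd"
    using l2[unfolded ladder_def, rule_format, of t, folded q_def q'_def qd_def] unfolding X_def Y_def by algebra
  define A where "A = coeff_up M m n"
  define D where "D = coeff_down M m n"
  define G where "G = real M * \<mu> / (\<nu> * (\<nu> + 1))"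
  have A: "(\<nu> + 1) * (2 * \<nu> + 1) * A = (\<nu> + 1 - real M) * (\<nu> + 1 - K)"
    using \<nu> by (simp add: A_def coeff_up_def \<nu>_def K_def)
  have D: "\<nu> * (2 * \<nu> + 1) * D = (\<nu> + real M) * (\<nu> + K)"
    using \<nu> by (simp add: D_def coeff_down_def \<nu>_def K_def)
  have G: "\<nu> * (\<nu> + 1) * G = real M * \<mu>"
    using \<nu> by (simp add: G_def)
  have "\<nu> * (\<nu> + 1) * (2 * \<nu> + 1) * X = \<nu> * (\<nu> + 1) * (2 * \<nu> + 1) * (A * qu + D * qd - G * q)"
    using up down A D G by algebra
  then have X: "X = A * qu + D * qd - G * q" using \<nu> by simp
  have "\<nu> * (\<nu> + 1) * (2 * \<nu> + 1) * Y = \<nu> * (\<nu> + 1) * (2 * \<nu> + 1) * (\<nu> * A * qu - (\<nu> + 1) * D * qd + G * q)"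
    using up down A D G by algebra
  then have Y: "Y = \<nu> * A * qu - (\<nu> + 1) * D * qd + G * q" using \<nu> by simp
  have "tridiag_op b L M m n t = - b * \<nu> * (\<nu> + 1) * q + (\<nu> * (\<nu> + 1) - \<Lambda>) * X + Y"
    by (simp add: tridiag_op_def X_def Y_def q_def q'_def \<nu>_def \<mu>_def \<Lambda>_def algebra_simps)
  also have "\<dots> = (\<nu> * (\<nu> + 2) - \<Lambda>) * A * qu + (- b * \<nu> * (\<nu> + 1) - (\<nu> * (\<nu> + 1) - \<Lambda> - 1) * G) * q
      + ((\<nu> - 1) * (\<nu> + 1) - \<Lambda>) * D * qd"
    unfolding X Y by algebra
  finally show ?thesis
    by (simp add: A_def D_def G_def q_def qu_def qd_def \<nu>_def \<mu>_def \<Lambda>_def)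
qed

text \<open>The square of the normalization constant, times \<open>4 * pi\<close>.\<close>

definition spin_norm :: "nat \<Rightarrow> int \<Rightarrow> nat \<Rightarrow> real" where
  "spin_norm M m n = (2 * real n + 1) * (fact (n - nat \<bar>m\<bar>) / fact (n + nat \<bar>m\<bar>)) * (fact (n - M) / fact (n + M))"

text \<open>This is the symmetry of multiplication by \<open>t\<close> with respect to the squared
  norms. The two factorial quotients in \<open>spin_norm\<close> each contribute one linear factor
  to \<open>coeff_up\<close> and one to \<open>coeff_down\<close>.\<close>

lemma spin_norm_rec:
  assumes n: "max M (nat \<bar>m\<bar>) \<le> n"
  shows "spin_norm M m n * coeff_up M m n = spin_norm M m (Suc n) * coeff_down M m (Suc n)"
proof -
  have f: "fact (Suc n - k) / fact (Suc n + k) * (real (Suc n) + real k) = (real n + 1 - real k) * (fact (n - k) / fact (n + k))"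
    if "k \<le> n" for k :: nat
  proof -
    have "fact (Suc n - k) = (real n + 1 - real k) * fact (n - k)"
      using that by (simp add: Suc_diff_le)
    moreover have "fact (Suc n + k) = (real n + 1 + real k) * fact (n + k)"
      by simp
    moreover have "real n + 1 + real k \<noteq> 0" by linarith
    ultimately show ?thesis
      by (simp del: fact_Suc add: divide_simps)
  qed
  define x where "x = (\<lambda>k. fact (n - k) / fact (n + k) :: real)"
  define y where "y = (\<lambda>k. fact (Suc n - k) / fact (Suc n + k) :: real)"
  define K where "K = nat \<bar>m\<bar>"
  have fK: "y K * (real (Suc n) + real K) = (real n + 1 - real K) * x K"
    and fM: "y M * (real (Suc n) + real M) = (real n + 1 - real M) * x M"
    unfolding x_def y_def using n by (auto intro: f simp only: K_def max.bounded_iff)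
  have "spin_norm M m n * coeff_up M m n = ((real n + 1 - real K) * x K) * ((real n + 1 - real M) * x M) / (real n + 1)"
  proof -
    have "2 * real n + 1 \<noteq> 0" by linarith
    then show ?thesis unfolding spin_norm_def coeff_up_def x_def K_def[symmetric] by (simp add: ac_simps)
  qed
  also have "\<dots> = (y K * (real (Suc n) + real K)) * (y M * (real (Suc n) + real M)) / (real n + 1)"
    unfolding fK fM ..
  also have "\<dots> = spin_norm M m (Suc n) * coeff_down M m (Suc n)"
  proof -
    have "2 * real (Suc n) + 1 \<noteq> 0" by linarith
    then show ?thesis unfolding spin_norm_def coeff_down_def y_def K_def[symmetric] by (simp add: ac_simps)
  qed
  finally show ?thesis .
qed

text \<open>Christoffel--Darboux telescoping; the boundary term at \<open>n = L\<close> vanishes because of the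
  summand \<open>- L * (L + 2) * t\<close> of the operator.\<close>

lemma tridiag_kernel_commute:
  fixes s t :: real
  shows "(\<Sum>n = max M (nat \<bar>m\<bar>)..L. spin_norm M m n * (poly (spin_poly M m n) s * tridiag_op b L M m n t))
    = (\<Sum>n = max M (nat \<bar>m\<bar>)..L. spin_norm M m n * (tridiag_op b L M m n s * poly (spin_poly M m n) t))"
proof -
  let ?n0 = "max M (nat \<bar>m\<bar>)"
  define q where "q = (\<lambda>n. poly (spin_poly M m n))"
  define F where "F = (\<lambda>n. (real n * (real n + 2) - real (L * (L + 2))) * (spin_norm M m n * coeff_up M m n)
     * (q n s * q (Suc n) t - q (Suc n) s * q n t))"
  define trm where "trm = (\<lambda>n. spin_norm M m n * (q n s * tridiag_op b L M m n t - tridiag_op b L M m n s * q n t))"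
  have tm: "trm n = F n + ((real n - 1) * (real n + 1) - real (L * (L + 2))) * (spin_norm M m n * coeff_down M m n)
     * (q n s * q (n - 1) t - q (n - 1) s * q n t)" if "?n0 \<le> n" for n
    unfolding trm_def F_def tridiag_op_eq[OF that] q_def by algebra
  \<comment> \<open>Nothing enters from below: at degree 0 \<open>coeff_down\<close> is 0, and
    otherwise the polynomial one degree lower vanishes.\<close>
  have base: "trm ?n0 = F ?n0"
  proof (cases "?n0 = 0")
    case True
    then show ?thesis using tm[of ?n0] by (simp add: coeff_down_def)
  next
    case False
    then have "q (?n0 - 1) = (\<lambda>_. 0)" unfolding q_def by (subst spin_poly_eq_0) auto
    then show ?thesis using tm[of ?n0] by simp
  qed
  \<comment> \<open>The downward factor \<open>(n - 1) (n + 1) - L (L + 2)\<close>, taken at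
    \<open>n + 1\<close>, is the upward factor at \<open>n\<close>.\<close>
  have step_diff: "trm (Suc n) = F (Suc n) - F n" if "?n0 \<le> n" for n
  proof -
    have e: "real (Suc n) - 1 = real n" "real (Suc n) + 1 = real n + 2" by auto
    have "trm (Suc n) = F (Suc n) + (real n * (real n + 2) - real (L * (L + 2))) * (spin_norm M m n * coeff_up M m n)
        * (q (Suc n) s * q n t - q n s * q (Suc n) t)"
      using tm[OF le_SucI[OF that]] unfolding spin_norm_rec[OF that] diff_Suc_1 e .
    also have "\<dots> = F (Suc n) - F n"
      unfolding F_def diff_conv_add_uminus minus_mult_right by simp
    finally show ?thesis .
  qed
  have telescope: "(\<Sum>n = ?n0..k. trm n) = F k" if "?n0 \<le> k" for k
    using that
  proof (induction k rule: dec_induct)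
    case (step k)
    then show ?case by (subst sum.nat_ivl_Suc') (simp_all only: le_SucI step_diff add.commute diff_add_cancel)
  qed (simp only: base atLeastAtMost_singleton sum.insert[OF finite.emptyI] sum.empty empty_iff not_False_eq_True add_0_right)
  have "(\<Sum>n = ?n0..L. trm n) = 0" if "?n0 \<le> L"
    using telescope[OF that] by (simp add: F_def distrib_left mult.commute)
  \<comment> \<open>An order larger than \<open>L\<close> in absolute value leaves an empty
    sum.\<close>
  then have "(\<Sum>n = ?n0..L. trm n) = 0" by (cases "?n0 \<le> L") auto
  then show ?thesis
    unfolding trm_def by (simp add: q_def right_diff_distrib sum_subtractf)
qed

section \<open>Geometry of the sphere\<close>

lemma lat_xi [simp]: "lat (xi t \<phi>) = t"
  by (simp add: lat_def xi_def)

lemma continuous_on_xi: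
  fixes f g :: "'a :: t2_space \<Rightarrow> real"
  assumes "continuous_on S f" "continuous_on S g"
  shows "continuous_on S (\<lambda>p. xi (f p) (g p))"
proof -
  have xi: "xi t \<phi> = (\<chi> i. if i = 1 then sqrt (1 - t\<^sup>2) * cos \<phi> else if i = 2 then sqrt (1 - t\<^sup>2) * sin \<phi> else t)" for t \<phi>
    by (simp add: xi_def vec_eq_iff forall_3)
  have "continuous_on S (\<lambda>p. if i = 1 then sqrt (1 - (f p)\<^sup>2) * cos (g p) else if i = 2 then sqrt (1 - (f p)\<^sup>2) * sin (g p) else f p)"
    for i :: 3
    using assms by (cases "i = 1"; cases "i = 2") (auto intro!: continuous_intros)
  then show ?thesis unfolding xi by (rule continuous_on_vec_lambda)
qed

lemma one_minus_square_pos: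
  fixes t :: real
  assumes "t \<in> {-1<..<1}"
  shows "0 < 1 - t\<^sup>2" "0 < 1 - t" "0 < 1 + t" "1 - t\<^sup>2 = (1 - t) * (1 + t)"
  using assms abs_square_less_1[of t] by (auto simp: algebra_simps power2_eq_square)

lemma Omega_iff: "x \<in> Omega \<longleftrightarrow> (x $ 1)\<^sup>2 + (x $ 2)\<^sup>2 + (x $ 3)\<^sup>2 = 1"
  by (simp add: Omega_def norm_eq_1 inner_vec_def sum_3 power2_eq_square)

lemma xi_in_Omega:
  assumes "t \<in> {-1..1}"
  shows "xi t \<phi> \<in> Omega"
proof -
  have "0 \<le> 1 - t\<^sup>2" using assms abs_square_le_1[of t] by auto
  then have "(sqrt (1 - t\<^sup>2) * cos \<phi>)\<^sup>2 + (sqrt (1 - t\<^sup>2) * sin \<phi>)\<^sup>2 + t\<^sup>2 = (1 - t\<^sup>2) * ((cos \<phi>)\<^sup>2 + (sin \<phi>)\<^sup>2) + t\<^sup>2"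
    by (simp add: power_mult_distrib distrib_left del: sin_cos_squared_add sin_cos_squared_add2)
  then show ?thesis by (simp add: Omega_iff xi_def)
qed

lemma xi_in_Omega0:
  assumes "t \<in> {-1<..<1}"
  shows "xi t \<phi> \<in> Omega0"
proof -
  have "lat north_pole = 1" "lat south_pole = -1"
    by (simp_all add: lat_def north_pole_def south_pole_def)
  then have "xi t \<phi> \<noteq> north_pole" "xi t \<phi> \<noteq> south_pole"
    using assms lat_xi[of t \<phi>] by (auto simp del: lat_xi)
  then show ?thesis using assms by (simp add: Omega0_def xi_in_Omega)
qed

lemma Omega0_lat:
  assumes "x \<in> Omega0"
  shows "lat x \<in> {-1<..<1}"
proof -
  have 1: "(x $ 1)\<^sup>2 + (x $ 2)\<^sup>2 + (x $ 3)\<^sup>2 = 1" and ne: "x \<noteq> north_pole" "x \<noteq> south_pole"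
    using assms by (auto simp: Omega0_def Omega_iff)
  then have "(x $ 3)\<^sup>2 \<le> 1" by (smt (verit) zero_le_power2)
  moreover have "(x $ 3)\<^sup>2 \<noteq> 1"
  proof
    assume 3: "(x $ 3)\<^sup>2 = 1"
    with 1 have "x $ 1 = 0" "x $ 2 = 0" by (auto simp: sum_power2_eq_zero_iff)
    moreover have "x $ 3 = 1 \<or> x $ 3 = -1" using 3 by (simp add: power2_eq_1_iff)
    ultimately show False
      using ne by (auto simp: north_pole_def south_pole_def vec_eq_iff forall_3)
  qed
  ultimately have "(x $ 3)\<^sup>2 < 1" by simp
  then show ?thesis by (auto simp: lat_def abs_square_less_1 abs_less_iff)
qed

lemma cis_lon:
  assumes "x \<in> Omega"
  shows "complex_of_real (sqrt (1 - (lat x)\<^sup>2)) * cis (lon x) = Complex (x $ 1) (x $ 2)"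
proof -
  let ?z = "Complex (x $ 1) (x $ 2)"
  have "cmod ?z = sqrt (1 - (lat x)\<^sup>2)"
    using assms by (simp add: Omega_iff lat_def cmod_def algebra_simps)
  then show ?thesis
    using Arg2pi[of ?z] by (simp add: is_Arg_def lon_def cis_conv_exp)
qed

lemma xi_lat_lon:
  assumes "x \<in> Omega"
  shows "xi (lat x) (lon x) = x"
  using cis_lon[OF assms] by (auto simp: complex_eq_iff xi_def vec_eq_iff forall_3 lat_def)

text \<open>\<open>lon\<close> recovers \<open>\<phi>\<close> only modulo \<open>2 * pi\<close>,
  which integer frequencies cannot detect. The coordinate derivatives are taken at
  \<open>lon x\<close>, so every computation with them passes through this identity.\<close>

lemma cis_lon_xi:
  assumes "t \<in> {-1<..<1}"
  shows "cis (of_int m * lon (xi t \<phi>)) = cis (of_int m * \<phi>)"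
proof -
  have "complex_of_real (sqrt (1 - t\<^sup>2)) * cis (lon (xi t \<phi>)) = complex_of_real (sqrt (1 - t\<^sup>2)) * cis \<phi>"
  proof -
    have "xi t \<phi> \<in> Omega" using assms by (intro xi_in_Omega) auto
    from cis_lon[OF this] show ?thesis unfolding lat_xi by (simp add: xi_def complex_eq_iff)
  qed
  moreover have "sqrt (1 - t\<^sup>2) \<noteq> 0" using one_minus_square_pos[OF assms] by simp
  ultimately show ?thesis by (simp flip: cis_power_int)
qed

section \<open>Fourier expansions in the longitude\<close>

text \<open>All real \<open>\<phi>\<close> are included so that the longitude can be differentiated
  at 0 as well. The index is separate from the frequency \<open>m\<close>, so that pairs of degree
  and order can serve as indices although many of them share a frequency.\<close>

definition modes :: "'i set \<Rightarrow> ('i \<Rightarrow> int) \<Rightarrow> ('i \<Rightarrow> real \<Rightarrow> complex) \<Rightarrow> (real ^ 3 \<Rightarrow> complex) \<Rightarrow> bool" where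
  "modes I m H F \<longleftrightarrow>
     (\<forall>t\<in>{-1<..<1}. \<forall>\<phi>. F (xi t \<phi>) = (\<Sum>i\<in>I. H i t * cis (of_int (m i) * \<phi>)))"

lemma modesD: "modes I m H F \<Longrightarrow> t \<in> {-1<..<1} \<Longrightarrow> F (xi t \<phi>) = (\<Sum>i\<in>I. H i t * cis (of_int (m i) * \<phi>))"
  by (simp add: modes_def)

lemma modes_at:
  assumes "modes I m H F" "x \<in> Omega0"
  shows "F x = (\<Sum>i\<in>I. H i (lat x) * cis (of_int (m i) * lon x))"
  using modesD[OF assms(1) Omega0_lat[OF assms(2)], of "lon x"] xi_lat_lon[of x] assms(2)
  by (simp add: Omega0_def)

lemma modes_has_vector_derivative_lat:
  assumes F: "modes I m H F" and t: "t \<in> {-1<..<1}"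
    and H: "\<And>i. i \<in> I \<Longrightarrow> (H i has_vector_derivative H' i) (at t)"
  shows "((\<lambda>s. F (xi s \<phi>)) has_vector_derivative (\<Sum>i\<in>I. H' i * cis (of_int (m i) * \<phi>))) (at t)"
proof -
  have "((\<lambda>s. \<Sum>i\<in>I. H i s * cis (of_int (m i) * \<phi>)) has_vector_derivative (\<Sum>i\<in>I. H' i * cis (of_int (m i) * \<phi>))) (at t)"
    by (intro has_vector_derivative_sum has_vector_derivative_mult_left H)
  then show ?thesis
    by (rule has_vector_derivative_transform_within_open[OF _ open_greaterThanLessThan t])
      (simp add: modesD[OF F])
qed

lemma cis_has_vector_derivative:
  "((\<lambda>p. cis (of_int k * p)) has_vector_derivative \<i> * of_int k * cis (of_int k * \<phi>)) (at \<phi> within S)"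
  unfolding has_vector_derivative_def
  by (rule has_derivative_eq_rhs, rule has_derivative_cis, rule has_derivative_mult_right, rule has_derivative_ident)
    (simp add: fun_eq_iff scaleR_conv_of_real mult.assoc mult.left_commute)

lemma modes_has_vector_derivative_lon:
  assumes F: "modes I m H F" and t: "t \<in> {-1<..<1}"
  shows "((\<lambda>p. F (xi t p)) has_vector_derivative (\<Sum>i\<in>I. \<i> * of_int (m i) * H i t * cis (of_int (m i) * \<phi>))) (at \<phi>)"
proof -
  have "((\<lambda>p. \<Sum>i\<in>I. H i t * cis (of_int (m i) * p)) has_vector_derivative
      (\<Sum>i\<in>I. H i t * (\<i> * of_int (m i) * cis (of_int (m i) * \<phi>)))) (at \<phi>)"
    by (rule has_vector_derivative_sum, rule has_vector_derivative_mult_right, rule cis_has_vector_derivative)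
  moreover have "(\<lambda>p. F (xi t p)) = (\<lambda>p. \<Sum>i\<in>I. H i t * cis (of_int (m i) * p))"
    using modesD[OF F t] by (rule ext)
  moreover have "H i t * (\<i> * of_int (m i) * cis (of_int (m i) * \<phi>)) = \<i> * of_int (m i) * H i t * cis (of_int (m i) * \<phi>)" for i
    by (simp only: mult.assoc mult.left_commute)
  ultimately show ?thesis by (simp only:)
qed

lemma modes_d_t:
  assumes F: "modes I m H F"
    and H: "\<And>i t. i \<in> I \<Longrightarrow> t \<in> {-1<..<1} \<Longrightarrow> (H i has_vector_derivative H' i t) (at t)"
  shows "modes I m H' (d_t F)"
  unfolding modes_def
proof (intro ballI allI)
  fix t \<phi> :: real assume t: "t \<in> {-1<..<1}"
  from modes_has_vector_derivative_lat[OF F t H[OF _ t], of "lon (xi t \<phi>)"]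
  show "d_t F (xi t \<phi>) = (\<Sum>i\<in>I. H' i t * cis (of_int (m i) * \<phi>))"
    by (simp add: d_t_def vector_derivative_at cis_lon_xi[OF t])
qed

lemma modes_d_phi:
  assumes F: "modes I m H F"
  shows "modes I m (\<lambda>i t. \<i> * of_int (m i) * H i t) (d_phi F)"
  unfolding modes_def
proof (intro ballI allI)
  fix t \<phi> :: real assume t: "t \<in> {-1<..<1}"
  from modes_has_vector_derivative_lon[OF F t, of "lon (xi t \<phi>)"]
  show "d_phi F (xi t \<phi>) = (\<Sum>i\<in>I. \<i> * of_int (m i) * H i t * cis (of_int (m i) * \<phi>))"
    by (simp add: d_phi_def vector_derivative_at cis_lon_xi[OF t])
qed

lemma modes_times_lat: "modes I m H F \<Longrightarrow> modes I m (\<lambda>i t. g t * H i t) (\<lambda>x. g (lat x) * F x)"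
  unfolding modes_def by (intro ballI allI) (simp only: lat_xi sum_distrib_left mult.assoc)

lemma modes_add: "modes I m H F \<Longrightarrow> modes I m G E \<Longrightarrow> modes I m (\<lambda>i t. H i t + G i t) (\<lambda>x. F x + E x)"
  unfolding modes_def by (intro ballI allI) (simp only: sum.distrib distrib_right)

lemma modes_cong:
  assumes "modes I m H F" "\<And>i t. i \<in> I \<Longrightarrow> t \<in> {-1<..<1} \<Longrightarrow> H i t = G i t"
  shows "modes I m G F"
  unfolding modes_def
proof (intro ballI allI)
  fix t \<phi> :: real assume t: "t \<in> {-1<..<1}"
  show "F (xi t \<phi>) = (\<Sum>i\<in>I. G i t * cis (of_int (m i) * \<phi>))"
    unfolding modesD[OF assms(1) t] using assms(2)[OF _ t] by (intro sum.cong) auto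
qed

text \<open>\<open>K\<close> is meant to be the derivative of \<open>(1 - t^2) * H'\<close>, as in
  \<open>modes_beltrami\<close>. As a separate argument it can be supplied in closed form, for the
  harmonics and for \<open>u\<close> alike.\<close>

definition beltrami_radial :: "int \<Rightarrow> int \<Rightarrow> (real \<Rightarrow> complex) \<Rightarrow> (real \<Rightarrow> complex) \<Rightarrow> real \<Rightarrow> complex" where
  "beltrami_radial N m H K t =
     K t - complex_of_real (((of_int m)\<^sup>2 + (of_int N)\<^sup>2 + 2 * of_int N * of_int m * t) / (1 - t\<^sup>2)) * H t"

definition I_radial :: "real \<Rightarrow> nat \<Rightarrow> int \<Rightarrow> int \<Rightarrow> (real \<Rightarrow> complex) \<Rightarrow> (real \<Rightarrow> complex) \<Rightarrow> (real \<Rightarrow> complex) \<Rightarrow> real \<Rightarrow> complex" where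
  "I_radial b L N m H H' K t =
     complex_of_real (b - t) * beltrami_radial N m H K t + complex_of_real (t\<^sup>2 - 1) * H' t
     - of_nat (L * (L + 2)) * complex_of_real t * H t"

lemma modes_beltrami:
  assumes F: "modes I m H F"
    and H: "\<And>i t. i \<in> I \<Longrightarrow> t \<in> {-1<..<1} \<Longrightarrow> (H i has_vector_derivative H' i t) (at t)"
    and K: "\<And>i t. i \<in> I \<Longrightarrow> t \<in> {-1<..<1} \<Longrightarrow>
       ((\<lambda>t. complex_of_real (1 - t\<^sup>2) * H' i t) has_vector_derivative K i t) (at t)"
  shows "modes I m (\<lambda>i. beltrami_radial N (m i) (H i) (K i)) (beltrami N F)"
proof -
  let ?c = "\<lambda>t. complex_of_real (1 - t\<^sup>2)"
  have 1: "modes I m K (d_t (\<lambda>y. ?c (lat y) * d_t F y))"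
    by (rule modes_d_t[OF modes_times_lat[OF modes_d_t[OF F H], of ?c] K])
  have 2: "modes I m (\<lambda>i t. inverse (?c t) * (\<i> * of_int (m i) * (\<i> * of_int (m i) * H i t)))
      (\<lambda>y. inverse (?c (lat y)) * d_phi (d_phi F) y)"
    by (rule modes_times_lat[OF modes_d_phi[OF modes_d_phi[OF F]], of "\<lambda>t. inverse (?c t)"])
  have 3: "modes I m (\<lambda>i t. (- (of_int N)\<^sup>2 / ?c t) * H i t) (\<lambda>y. (- (of_int N)\<^sup>2 / ?c (lat y)) * F y)"
    by (rule modes_times_lat[OF F, of "\<lambda>t. - (of_int N)\<^sup>2 / ?c t"])
  have 4: "modes I m (\<lambda>i t. (2 * \<i> * complex_of_real t * of_int N / ?c t) * (\<i> * of_int (m i) * H i t))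
       (\<lambda>y. (2 * \<i> * complex_of_real (lat y) * of_int N / ?c (lat y)) * d_phi F y)"
    by (rule modes_times_lat[OF modes_d_phi[OF F], of "\<lambda>t. 2 * \<i> * complex_of_real t * of_int N / ?c t"])
  have "beltrami N F = (\<lambda>y. d_t (\<lambda>y. ?c (lat y) * d_t F y) y + inverse (?c (lat y)) * d_phi (d_phi F) y
     + (- (of_int N)\<^sup>2 / ?c (lat y)) * F y + (2 * \<i> * complex_of_real (lat y) * of_int N / ?c (lat y)) * d_phi F y)"
  proof
    fix y
    have "a + p / c - (n * f - w * d) / c = a + inverse c * p + (- n / c) * f + (w / c) * d" for a p c n f w d :: complex
      unfolding divide_inverse by algebra
    then show "beltrami N F y = d_t (\<lambda>y. ?c (lat y) * d_t F y) y + inverse (?c (lat y)) * d_phi (d_phi F) y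
     + (- (of_int N)\<^sup>2 / ?c (lat y)) * F y + (2 * \<i> * complex_of_real (lat y) * of_int N / ?c (lat y)) * d_phi F y"
      unfolding beltrami_def .
  qed
  then have "modes I m (\<lambda>i t. K i t + inverse (?c t) * (\<i> * of_int (m i) * (\<i> * of_int (m i) * H i t))
      + (- (of_int N)\<^sup>2 / ?c t) * H i t + (2 * \<i> * complex_of_real t * of_int N / ?c t) * (\<i> * of_int (m i) * H i t)) (beltrami N F)"
    using modes_add[OF modes_add[OF modes_add[OF 1 2] 3] 4] by (simp only:)
  then show ?thesis
  proof (rule modes_cong)
    fix i and t :: real assume t: "t \<in> {-1<..<1}"
    have alg: "k + inverse c * (\<i> * \<mu> * (\<i> * \<mu> * h)) + (- \<nu>\<^sup>2 / c) * h + (2 * \<i> * \<tau> * \<nu> / c) * (\<i> * \<mu> * h)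
      = k - ((\<mu>\<^sup>2 + \<nu>\<^sup>2 + 2 * \<nu> * \<mu> * \<tau>) / c) * h" for k c \<mu> \<nu> \<tau> h :: complex
proof -
  have "k + inverse c * (\<i> * \<mu> * (\<i> * \<mu> * h)) + (- \<nu>\<^sup>2 / c) * h + (2 * \<i> * \<tau> * \<nu> / c) * (\<i> * \<mu> * h)
    = k + inverse c * (\<i>\<^sup>2 * \<mu>\<^sup>2 * h - \<nu>\<^sup>2 * h + \<i>\<^sup>2 * (2 * \<tau> * \<nu> * \<mu>) * h)"
    by (simp add: divide_inverse algebra_simps power2_eq_square)
  then show ?thesis by (simp add: divide_inverse algebra_simps)
qed
    show "K i t + inverse (?c t) * (\<i> * of_int (m i) * (\<i> * of_int (m i) * H i t))
      + (- (of_int N)\<^sup>2 / ?c t) * H i t + (2 * \<i> * complex_of_real t * of_int N / ?c t) * (\<i> * of_int (m i) * H i t)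
      = beltrami_radial N (m i) (H i) (K i) t"
      unfolding beltrami_radial_def of_real_divide alg by simp
  qed
qed

lemma modes_I_op:
  assumes F: "modes I m H F"
    and H: "\<And>i t. i \<in> I \<Longrightarrow> t \<in> {-1<..<1} \<Longrightarrow> (H i has_vector_derivative H' i t) (at t)"
    and K: "\<And>i t. i \<in> I \<Longrightarrow> t \<in> {-1<..<1} \<Longrightarrow>
       ((\<lambda>t. complex_of_real (1 - t\<^sup>2) * H' i t) has_vector_derivative K i t) (at t)"
  shows "modes I m (\<lambda>i. I_radial b L N (m i) (H i) (H' i) (K i)) (I_op b L N F)"
proof -
  have 1: "modes I m (\<lambda>i t. complex_of_real (b - t) * beltrami_radial N (m i) (H i) (K i) t)
     (\<lambda>y. complex_of_real (b - lat y) * beltrami N F y)"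
    by (rule modes_times_lat[OF modes_beltrami[OF F H K], of "\<lambda>t. complex_of_real (b - t)"])
  have 2: "modes I m (\<lambda>i t. complex_of_real (t\<^sup>2 - 1) * H' i t) (\<lambda>y. complex_of_real ((lat y)\<^sup>2 - 1) * d_t F y)"
    by (rule modes_times_lat[OF modes_d_t[OF F H], of "\<lambda>t. complex_of_real (t\<^sup>2 - 1)"])
  have 3: "modes I m (\<lambda>i t. (- of_nat (L * (L + 2)) * complex_of_real t) * H i t)
     (\<lambda>y. (- of_nat (L * (L + 2)) * complex_of_real (lat y)) * F y)"
    by (rule modes_times_lat[OF F, of "\<lambda>t. - of_nat (L * (L + 2)) * complex_of_real t"])
  show ?thesis
    using modes_add[OF modes_add[OF 1 2] 3]
    unfolding I_op_def[abs_def] I_radial_def[abs_def] mult_minus_left diff_conv_add_uminus .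
qed

text \<open>\<open>lon\<close> jumps at longitude 0. The character is therefore written as an
  integer power of the horizontal coordinate \<open>x_1 + \<i> x_2\<close> divided by its modulus,
  which is continuous on \<open>Omega0\<close> and never zero, so that negative powers are
  covered.\<close>

lemma modes_continuous_on:
  assumes F: "modes I m H F" and H: "\<And>i. i \<in> I \<Longrightarrow> continuous_on {-1<..<1} (H i)"
  shows "continuous_on Omega0 F"
proof -
  define e where "e = (\<lambda>x :: real ^ 3. Complex (x $ 1) (x $ 2) / complex_of_real (sqrt (1 - (lat x)\<^sup>2)))"
  have pos: "0 < 1 - (lat x)\<^sup>2" if "x \<in> Omega0" for x
    using one_minus_square_pos Omega0_lat[OF that] by blast
  have cis: "e x = cis (lon x)" if "x \<in> Omega0" for x
    using cis_lon[of x] pos[OF that] that by (simp add: e_def Omega0_def field_simps del: of_real_diff)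
  have lat: "continuous_on Omega0 lat"
    unfolding lat_def by (intro continuous_intros)
  have e: "continuous_on Omega0 e"
    unfolding e_def Complex_eq using pos
    by (intro continuous_intros lat) (auto simp: less_le simp del: of_real_diff)
  have "continuous_on Omega0 (\<lambda>x. \<Sum>i\<in>I. H i (lat x) * e x powi m i)"
  proof (rule continuous_on_sum)
    fix i assume "i \<in> I"
    have "continuous_on Omega0 (\<lambda>x. H i (lat x))"
      by (rule continuous_on_compose2[OF H[OF \<open>i \<in> I\<close>] lat]) (use Omega0_lat in blast)
    then show "continuous_on Omega0 (\<lambda>x. H i (lat x) * e x powi m i)"
      by (rule continuous_on_mult[OF _ continuous_on_power_int[OF e]]) (simp add: cis)
  qed
  then show ?thesis
    by (rule continuous_on_eq) (simp add: modes_at[OF F] cis cis_power_int)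
qed

text \<open>\<open>D i k\<close> is the \<open>k\<close>-th derivative of a profile. The class is
  closed under both coordinate derivatives: \<open>d_t\<close> shifts the sequence and
  \<open>d_phi\<close> multiplies it by \<open>\<i> * m\<close>, hence the induction over arbitrary
  \<open>D\<close> and \<open>F\<close>.\<close>

lemma C_diff_modes:
  assumes "modes I m (\<lambda>i. D i 0) F"
    and "\<And>i k t. i \<in> I \<Longrightarrow> t \<in> {-1<..<1} \<Longrightarrow> (D i k has_vector_derivative D i (Suc k) t) (at t)"
  shows "C_diff k F"
  using assms
proof (induction k arbitrary: D F)
  case (0 D F)
  have "continuous_on {-1<..<1} (D i 0)" if "i \<in> I" for i
    by (rule continuous_at_imp_continuous_on) (use 0(2)[OF that] has_vector_derivative_continuous in blast)
  with 0(1) show ?case by (simp add: modes_continuous_on)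
next
  case (Suc k D F)
  have "continuous_on {-1<..<1} (D i 0)" if "i \<in> I" for i
    by (rule continuous_at_imp_continuous_on) (use Suc.prems(2)[OF that] has_vector_derivative_continuous in blast)
  with Suc.prems(1) have "continuous_on Omega0 F" by (simp add: modes_continuous_on)
  moreover have "(\<lambda>s. F (xi s (lon x))) differentiable at (lat x)" if "x \<in> Omega0" for x
    using modes_has_vector_derivative_lat[OF Suc.prems(1) Omega0_lat[OF that] Suc.prems(2)[OF _ Omega0_lat[OF that]]]
    by (rule differentiableI_vector)
  moreover have "(\<lambda>p. F (xi (lat x) p)) differentiable at (lon x)" if "x \<in> Omega0" for x
    using modes_has_vector_derivative_lon[OF Suc.prems(1) Omega0_lat[OF that]]
    by (rule differentiableI_vector)
  moreover have "C_diff k (d_t F)"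
    by (rule Suc.IH[of "\<lambda>i k. D i (Suc k)", OF modes_d_t[OF Suc.prems] Suc.prems(2)])
  moreover have "C_diff k (d_phi F)"
    by (rule Suc.IH[of "\<lambda>i k t. \<i> * of_int (m i) * D i k t", OF modes_d_phi[OF Suc.prems(1)]
          has_vector_derivative_mult_right[OF Suc.prems(2)]])
  ultimately show ?case by simp
qed

abbreviation mode :: "int \<Rightarrow> (real \<Rightarrow> complex) \<Rightarrow> (real ^ 3 \<Rightarrow> complex) \<Rightarrow> bool" where
  "mode m H \<equiv> modes {()} (\<lambda>_. m) (\<lambda>_. H)"

lemma mode_radial_eq: "mode m H F \<Longrightarrow> t \<in> {-1<..<1} \<Longrightarrow> H t = F (xi t 0)"
  by (simp add: modesD)

lemma mode_continuous_on_radial: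
  assumes F: "mode m H F" and c: "continuous_on Omega0 F"
  shows "continuous_on {-1<..<1} H"
proof -
  have "continuous_on {-1<..<1} (\<lambda>t. xi t 0)"
    by (intro continuous_on_xi continuous_intros)
  then have "continuous_on {-1<..<1} (\<lambda>t. F (xi t 0))"
    by (rule continuous_on_compose2[OF c]) (auto intro: xi_in_Omega0)
  then show ?thesis
    by (rule continuous_on_eq) (simp add: mode_radial_eq[OF F])
qed

text \<open>\<open>C_diff\<close> speaks of the meridian of longitude \<open>lon (xi t 0)\<close>.
  The character equals 1 there, so the restriction of \<open>F\<close> is the profile
  itself.\<close>

lemma mode_C_diff_Suc:
  assumes F: "mode m H F" and C: "C_diff (Suc k) F" and t: "t \<in> {-1<..<1}"
  shows "(H has_vector_derivative d_t F (xi t 0)) (at t)"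
proof -
  let ?p = "lon (xi t 0)"
  have "(\<lambda>s. F (xi s ?p)) differentiable at t"
    using C[unfolded C_diff.simps] xi_in_Omega0[OF t, of 0] by (metis lat_xi)
  then have "((\<lambda>s. F (xi s ?p)) has_vector_derivative d_t F (xi t 0)) (at t)"
    by (simp add: d_t_def vector_derivative_works)
  then show ?thesis
    by (rule has_vector_derivative_transform_within_open[OF _ open_greaterThanLessThan t])
      (simp add: modesD[OF F] cis_lon_xi[OF t])
qed

section \<open>Integration over the cap\<close>

text \<open>This disposes of the pole \<open>t = 1\<close>, where profiles carry no information, and
  of the edge \<open>\<phi> = 2 * pi\<close>, when the parameter region of the cap is exchanged for
  \<open>{b..<1} \<times> {0..2 * pi}\<close>.\<close>

lemma AE_lborel_fst_snd_neq:
  "AE p in (lborel :: (real \<times> real) measure). fst p \<noteq> a \<and> snd p \<noteq> c"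
proof (rule AE_I')
  have "{a} \<times> UNIV \<in> null_sets (lborel \<Otimes>\<^sub>M lborel :: (real \<times> real) measure)"
    by (rule lborel.times_in_null_sets1) auto
  moreover have "UNIV \<times> {c} \<in> null_sets (lborel \<Otimes>\<^sub>M lborel :: (real \<times> real) measure)"
    by (rule lborel.times_in_null_sets2) auto
  ultimately show "{a} \<times> UNIV \<union> UNIV \<times> {c} \<in> null_sets (lborel :: (real \<times> real) measure)"
    unfolding lborel_prod by blast
qed auto

lemma integral_cis:
  "(LINT \<phi>:{0..2 * pi}|lborel. cis (of_int k * \<phi>)) = (if k = 0 then complex_of_real (2 * pi) else 0)"
proof (cases "k = 0")
  case True
  then show ?thesis by (simp add: set_lebesgue_integral_def scaleR_conv_of_real)
next
  case False
  have "(LINT \<phi>:{0..2 * pi}|lborel. cis (of_int k * \<phi>))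
    = cis (of_int k * (2 * pi)) / (\<i> * of_int k) - cis (of_int k * 0) / (\<i> * of_int k)"
    unfolding set_lebesgue_integral_def
  proof (rule integral_FTC_Icc)
    fix x :: real
    have "((\<lambda>p. inverse (\<i> * of_int k) * cis (of_int k * p)) has_vector_derivative cis (of_int k * x)) (at x within {0..2 * pi})"
    proof -
      have "inverse (\<i> * of_int k) * (\<i> * of_int k * cis (of_int k * x)) = cis (of_int k * x)"
        using left_inverse[of "\<i> * of_int k :: complex"] False unfolding mult.assoc[symmetric] by simp
      then show ?thesis using has_vector_derivative_mult_right[OF cis_has_vector_derivative[of k x], of "inverse (\<i> * of_int k)"] by (simp only:)
    qed
    then show "((\<lambda>p. cis (of_int k * p) / (\<i> * of_int k)) has_vector_derivative cis (of_int k * x)) (at x within {0..2 * pi})"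
      by (simp only: divide_inverse mult.commute)
  qed (auto intro!: continuous_intros)
  also have "cis (of_int k * (2 * pi)) = 1"
    using cis_multiple_2pi[of "of_int k"] by (simp add: mult.commute)
  finally show ?thesis using False by simp
qed

lemma bounded_integrable_product_cis:
  fixes H :: "real \<Rightarrow> complex"
  assumes H: "continuous_on {b..<1} H" "bounded (H ` {b..<1})"
  shows "set_integrable lborel ({b..<1} \<times> {0..2 * pi}) (\<lambda>p. H (fst p) * cis (of_int k * snd p))"
    and "(LINT p:{b..<1} \<times> {0..2 * pi}|lborel. H (fst p) * cis (of_int k * snd p))
      = (if k = 0 then complex_of_real (2 * pi) * (LINT t:{b..<1}|lborel. H t) else 0)"
proof -
  let ?A = "{b..<1}" and ?B = "{0..2 * pi}"
  have AB: "?A \<times> ?B \<in> sets borel" by (simp add: borel_prod[symmetric])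
  obtain B where B: "\<And>t. t \<in> ?A \<Longrightarrow> cmod (H t) \<le> B" using H(2) unfolding bounded_iff by (metis imageI)
  let ?f = "\<lambda>p. H (fst p) * cis (of_int k * snd p)"
  have meas: "(\<lambda>p. indicator (?A \<times> ?B) p *\<^sub>R ?f p) \<in> borel_measurable borel"
    by (intro borel_measurable_continuous_on_indicator AB continuous_intros continuous_on_compose2[OF H(1)]) auto
  show int: "set_integrable lborel (?A \<times> ?B) ?f"
    unfolding set_integrable_def
  proof (rule integrableI_bounded_set[where A = "?A \<times> ?B" and B = B])
    show "emeasure lborel (?A \<times> ?B) < \<infinity>"
      by (intro emeasure_bounded_finite bounded_Times) auto
    show "AE x in lborel. x \<in> ?A \<times> ?B \<longrightarrow> norm (indicator (?A \<times> ?B) x *\<^sub>R ?f x) \<le> B"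
      using B by (auto simp: norm_mult)
  qed (use meas AB in auto)
  have "(LINT p:?A \<times> ?B|lborel. ?f p)
     = (\<integral>p. (case p of (t, \<phi>) \<Rightarrow> (indicator ?A t *\<^sub>R H t) * (indicator ?B \<phi> *\<^sub>R cis (of_int k * \<phi>))) \<partial>(lborel \<Otimes>\<^sub>M lborel))"
    unfolding set_lebesgue_integral_def lborel_prod
    by (intro Bochner_Integration.integral_cong) (auto simp: indicator_times split: prod.splits)
  also have "\<dots> = (\<integral>t. (\<integral>\<phi>. (indicator ?A t *\<^sub>R H t) * (indicator ?B \<phi> *\<^sub>R cis (of_int k * \<phi>)) \<partial>lborel) \<partial>lborel)"
  proof (rule lborel_pair.integral_fst[symmetric])
    have "(\<lambda>(t, \<phi>). (indicator ?A t *\<^sub>R H t) * (indicator ?B \<phi> *\<^sub>R cis (of_int k * \<phi>)))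
      = (\<lambda>p. indicator (?A \<times> ?B) p *\<^sub>R ?f p)"
      by (auto simp: fun_eq_iff indicator_times)
    then show "integrable (lborel \<Otimes>\<^sub>M lborel) (\<lambda>(t, \<phi>). (indicator ?A t *\<^sub>R H t) * (indicator ?B \<phi> *\<^sub>R cis (of_int k * \<phi>)))"
      using int unfolding set_integrable_def lborel_prod by simp
  qed
  also have "\<dots> = (LINT t:?A|lborel. H t) * (LINT \<phi>:?B|lborel. cis (of_int k * \<phi>))"
    unfolding set_lebesgue_integral_def integral_mult_right_zero integral_mult_left_zero ..
  finally show "(LINT p:?A \<times> ?B|lborel. ?f p) = (if k = 0 then complex_of_real (2 * pi) * (LINT t:?A|lborel. H t) else 0)"
    unfolding integral_cis by simp
qed

lemma polar_cap_iff:
  assumes "-1 \<le> b"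
  shows "x \<in> polar_cap b \<longleftrightarrow> x \<in> Omega \<and> b \<le> lat x"
proof
  assume "x \<in> polar_cap b"
  then show "x \<in> Omega \<and> b \<le> lat x"
    using assms by (auto simp: polar_cap_def intro!: xi_in_Omega)
next
  assume x: "x \<in> Omega \<and> b \<le> lat x"
  then have "(lat x)\<^sup>2 \<le> 1" unfolding Omega_iff lat_def by (smt (verit) zero_le_power2)
  then have "lat x \<le> 1" by (simp add: abs_square_le_1)
  moreover have "0 \<le> lon x" "lon x < 2 * pi" using Arg2pi by (auto simp: lon_def)
  ultimately show "x \<in> polar_cap b"
    using x xi_lat_lon[of x] unfolding polar_cap_def by (metis (mono_tags, lifting) mem_Collect_eq)
qed

lemma closed_Omega: "closed Omega"
  unfolding Omega_def by (rule closed_sphere)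

lemma polar_cap_borel [measurable]:
  assumes "-1 \<le> b"
  shows "polar_cap b \<in> sets borel"
proof -
  have "closed {x :: real ^ 3. b \<le> lat x}"
    unfolding lat_def by (intro closed_Collect_le continuous_intros)
  moreover have "polar_cap b = Omega \<inter> {x. b \<le> lat x}"
    using polar_cap_iff[OF assms] by auto
  ultimately show ?thesis using closed_Omega by (auto intro!: borel_closed closed_Int)
qed

lemma Omega0_borel: "Omega0 \<in> sets borel"
  unfolding Omega0_def using closed_Omega by (auto intro!: sets.Diff borel_closed)

text \<open>The values of \<open>f\<close> at the poles are arbitrary, but single points are Borel
  sets, so the function can be prescribed there separately.\<close>

lemma polar_cap_measurable:
  fixes f :: "real ^ 3 \<Rightarrow> complex"
  assumes b: "-1 \<le> b" and f: "continuous_on Omega0 f"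
  shows "(\<lambda>x. indicator (polar_cap b) x *\<^sub>R f x) \<in> borel_measurable borel"
proof -
  let ?g = "\<lambda>x. indicator (polar_cap b \<inter> Omega0) x *\<^sub>R f x"
  let ?c = "\<lambda>x. indicator (polar_cap b) x *\<^sub>R f x"
  have g: "?g \<in> borel_measurable borel"
    using polar_cap_borel[OF b] Omega0_borel continuous_on_subset[OF f]
    by (intro borel_measurable_continuous_on_indicator) auto
  have "?c = (\<lambda>x. if x \<in> {north_pole} then ?c north_pole else if x \<in> {south_pole} then ?c south_pole else ?g x)"
    using polar_cap_iff[OF b] by (auto simp: fun_eq_iff indicator_def Omega0_def)
  moreover have "\<dots> \<in> borel_measurable borel"
    using g by (intro measurable_If_set) auto
  ultimately show ?thesis by simp
qed

text \<open>Pulled back to the parameter box, profile and character separate by Fubini, and only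
  frequency 0 survives the integration over a full period.\<close>

lemma polar_cap_mode:
  assumes b: "-1 < b" and F: "mode k H F"
    and H: "continuous_on {-1<..<1} H" "bounded (H ` {b..<1})"
  shows "set_integrable surface_measure (polar_cap b) F"
    and "(LINT y:polar_cap b|surface_measure. F y)
      = (if k = 0 then complex_of_real (2 * pi) * (LINT t:{b..<1}|lborel. H t) else 0)"
proof -
  let ?S = "{-1..1} \<times> {0..<2 * pi} :: (real \<times> real) set"
  let ?R = "{b..<1} \<times> {0..2 * pi}"
  let ?g = "\<lambda>x. indicator (polar_cap b) x *\<^sub>R F x"
  let ?h = "\<lambda>p. H (fst p) * cis (of_int k * snd p)"
  have Hb: "continuous_on {b..<1} H" using H(1) b by (auto intro: continuous_on_subset)
  note prod = bounded_integrable_product_cis[OF Hb H(2), of k]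
  have S: "?S \<in> sets borel" by (simp add: borel_prod[symmetric])
  have g: "?g \<in> borel_measurable borel"
    using b by (intro polar_cap_measurable modes_continuous_on[OF F] H) auto
  have xi: "(\<lambda>(t, \<phi>). xi t \<phi>) \<in> borel \<rightarrow>\<^sub>M borel"
    unfolding case_prod_beta by (intro borel_measurable_continuous_onI continuous_on_xi continuous_intros)
  have xi_S: "(\<lambda>(t, \<phi>). xi t \<phi>) \<in> restrict_space lborel ?S \<rightarrow>\<^sub>M borel"
    using xi by (intro measurable_restrict_space1) simp
  have AE: "AE p in lborel. indicator ?S p *\<^sub>R ?g (case p of (t, \<phi>) \<Rightarrow> xi t \<phi>) = indicator ?R p *\<^sub>R ?h p"
    using AE_lborel_fst_snd_neq[of 1 "2 * pi"]
  proof eventually_elim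
    case (elim p)
    obtain t \<phi> where p: "p = (t, \<phi>)" by fastforce
    show ?case
    proof (cases "p \<in> ?S")
      case False
      then show ?thesis using elim b p by (auto simp: indicator_def)
    next
      case True
      then have cap: "xi t \<phi> \<in> polar_cap b \<longleftrightarrow> b \<le> t"
        using polar_cap_iff[of b "xi t \<phi>"] xi_in_Omega[of t \<phi>] b p by auto
      show ?thesis
        using True elim b p modesD[OF F, of t \<phi>] by (auto simp: indicator_def cap)
    qed
  qed
  have m1: "(\<lambda>p. indicator ?S p *\<^sub>R ?g (case p of (t, \<phi>) \<Rightarrow> xi t \<phi>)) \<in> borel_measurable lborel"
    using borel_measurable_scaleR[OF borel_measurable_indicator measurable_compose[OF xi g]] S by simp
  have m2: "(\<lambda>p. indicator ?R p *\<^sub>R ?h p) \<in> borel_measurable lborel"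
    using prod(1) unfolding set_integrable_def by (rule borel_measurable_integrable)
  have S': "?S \<inter> space lborel \<in> sets (lborel :: (real \<times> real) measure)" using S by simp
  show "set_integrable surface_measure (polar_cap b) F"
    using prod(1) integrable_cong_AE[OF m1 m2 AE]
    unfolding set_integrable_def surface_measure_def integrable_distr_eq[OF xi_S g] integrable_restrict_space[OF S']
    by simp
  have "(LINT y:polar_cap b|surface_measure. F y) = (LINT p:?R|lborel. ?h p)"
    unfolding set_lebesgue_integral_def surface_measure_def integral_distr[OF xi_S g] integral_restrict_space[OF S']
    by (rule integral_cong_AE[OF m1 m2 AE])
  then show "(LINT y:polar_cap b|surface_measure. F y)
      = (if k = 0 then complex_of_real (2 * pi) * (LINT t:{b..<1}|lborel. H t) else 0)"
    using prod(2) by simp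
qed

lemma bounded_continuous_integrable:
  fixes f :: "real \<Rightarrow> complex"
  assumes "continuous_on {b..<1} f" "bounded (f ` {b..<1})"
  shows "set_integrable lborel {b..<1} f"
proof -
  obtain B where B: "\<And>t. t \<in> {b..<1} \<Longrightarrow> cmod (f t) \<le> B" using assms(2) unfolding bounded_iff by (metis imageI)
  show ?thesis
    unfolding set_integrable_def
  proof (rule integrableI_bounded_set[where A = "{b..<1}" and B = B])
    show "(\<lambda>x. indicator {b..<1} x *\<^sub>R f x) \<in> borel_measurable lborel"
      using borel_measurable_continuous_on_indicator[OF _ assms(1)] by simp
    show "emeasure lborel {b..<1} < \<infinity>" by (intro emeasure_bounded_finite) auto
    show "AE x in lborel. x \<in> {b..<1} \<longrightarrow> norm (indicator {b..<1} x *\<^sub>R f x) \<le> B"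
      using B by auto
  qed auto
qed

text \<open>The integrands differ by the derivative of
  \<open>(b - t) (1 - t^2) (G H' - G' H)\<close>: the first-order terms are what the product rule
  makes of the factor \<open>b - t\<close>, while the potential and the multiple of \<open>t\<close>
  cancel.\<close>

lemma I_radial_selfadjoint:
  fixes G H :: "real \<Rightarrow> complex"
  assumes b: "-1 < b" "b < 1"
    and G: "\<And>t. t \<in> {-1<..<1} \<Longrightarrow> (G has_vector_derivative G' t) (at t)"
      "\<And>t. t \<in> {-1<..<1} \<Longrightarrow> ((\<lambda>t. complex_of_real (1 - t\<^sup>2) * G' t) has_vector_derivative KG t) (at t)"
    and H: "\<And>t. t \<in> {-1<..<1} \<Longrightarrow> (H has_vector_derivative H' t) (at t)"
      "\<And>t. t \<in> {-1<..<1} \<Longrightarrow> ((\<lambda>t. complex_of_real (1 - t\<^sup>2) * H' t) has_vector_derivative KH t) (at t)"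
    and lim: "((\<lambda>t. complex_of_real (1 - t\<^sup>2) * (G t * H' t - G' t * H t)) \<longlongrightarrow> 0) (at_left 1)"
    and int: "set_integrable lborel {b..<1} (\<lambda>t. G t * I_radial b L N m H H' KH t)"
      "set_integrable lborel {b..<1} (\<lambda>t. I_radial b L N m G G' KG t * H t)"
  shows "(LINT t:{b..<1}|lborel. G t * I_radial b L N m H H' KH t)
    = (LINT t:{b..<1}|lborel. I_radial b L N m G G' KG t * H t)"
proof -
  define d where "d = (\<lambda>t. G t * I_radial b L N m H H' KH t - I_radial b L N m G G' KG t * H t)"
  define P where "P = (\<lambda>t. complex_of_real (b - t) * (complex_of_real (1 - t\<^sup>2) * (G t * H' t - G' t * H t)))"
  \<comment> \<open>Nothing is known of \<open>G'\<close> and \<open>H'\<close> at the pole, so the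
    value 0 is prescribed there; by \<open>lim\<close> this gives continuity on the closed interval,
    as the fundamental theorem requires.\<close>
  define P1 where "P1 = (\<lambda>t. if t = 1 then 0 else P t)"
  have P: "(P has_vector_derivative d t) (at t)" if t: "t \<in> {-1<..<1}" for t
  proof -
    have "((\<lambda>t. complex_of_real (b - t) * (G t * (complex_of_real (1 - t\<^sup>2) * H' t) - (complex_of_real (1 - t\<^sup>2) * G' t) * H t))
      has_vector_derivative (complex_of_real (b - t) * ((G t * KH t + G' t * (complex_of_real (1 - t\<^sup>2) * H' t))
         - ((complex_of_real (1 - t\<^sup>2) * G' t) * H' t + KG t * H t))
         + complex_of_real (0 - 1) * (G t * (complex_of_real (1 - t\<^sup>2) * H' t) - (complex_of_real (1 - t\<^sup>2) * G' t) * H t))) (at t)"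
      by (intro has_vector_derivative_mult has_vector_derivative_diff G[OF t] H[OF t] has_vector_derivative_of_real
          has_real_derivative_iff_has_vector_derivative[THEN iffD1]) (auto intro!: derivative_eq_intros)
    moreover have "P = (\<lambda>t. complex_of_real (b - t) * (G t * (complex_of_real (1 - t\<^sup>2) * H' t) - (complex_of_real (1 - t\<^sup>2) * G' t) * H t))"
      by (simp add: P_def fun_eq_iff right_diff_distrib mult.assoc mult.left_commute)
    moreover have "(complex_of_real (b - t) * ((G t * KH t + G' t * (complex_of_real (1 - t\<^sup>2) * H' t))
         - ((complex_of_real (1 - t\<^sup>2) * G' t) * H' t + KG t * H t))
         + complex_of_real (0 - 1) * (G t * (complex_of_real (1 - t\<^sup>2) * H' t) - (complex_of_real (1 - t\<^sup>2) * G' t) * H t)) = d t"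
      by (simp add: d_def I_radial_def beltrami_radial_def algebra_simps)
    ultimately show ?thesis by simp
  qed
  have P1: "(P1 has_vector_derivative d t) (at t)" if t: "t \<in> {-1<..<1}" for t
    by (rule has_vector_derivative_transform_within_open[OF P[OF t] open_greaterThanLessThan t]) (simp add: P1_def)
  have "(d has_integral P1 1 - P1 b) {b..1}"
  proof (rule fundamental_theorem_of_calculus_interior)
    show "continuous_on {b..1} P1"
      unfolding continuous_on_eq_continuous_within
    proof
      fix t assume t: "t \<in> {b..1}"
      show "continuous (at t within {b..1}) P1"
      proof (cases "t = 1")
        case False
        then have "isCont P1 t" using t b by (intro has_vector_derivative_continuous[OF P1]) auto
        then show ?thesis by (rule continuous_at_imp_continuous_at_within)
      next
        case True
        have "((\<lambda>t. complex_of_real (b - t) * (complex_of_real (1 - t\<^sup>2) * (G t * H' t - G' t * H t))) \<longlongrightarrow> complex_of_real (b - 1) * 0) (at_left 1)"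
          by (intro tendsto_mult lim tendsto_intros)
        then have "(P1 \<longlongrightarrow> complex_of_real (b - 1) * 0) (at_left 1)"
          by (rule Lim_transform_eventually) (auto simp: P_def P1_def eventually_at_filter)
        then have "(P1 \<longlongrightarrow> P1 1) (at 1 within {b..1})"
          using b by (simp add: P1_def at_within_Icc_at_left)
        then show ?thesis by (simp add: True continuous_within)
      qed
    qed
  qed (use b P1 in auto)
  moreover have "P1 1 - P1 b = 0" using b by (simp add: P1_def P_def)
  ultimately have "(d has_integral 0) {b..1}" by simp
  then have "integral {b..1} d = 0" by (rule integral_unique)
  moreover have "integral {b..<1} d = integral {b..1} d"
    by (rule integral_spike_set; rule negligible_subset[of "{1}"]) auto
  moreover have "set_integrable lborel {b..<1} d" unfolding d_def using int by (rule set_integral_diff)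
  ultimately have "(LINT t:{b..<1}|lborel. d t) = 0"
    by (simp add: set_borel_integral_eq_integral)
  then show ?thesis unfolding d_def using set_integral_diff(2)[OF int] by simp
qed

section \<open>Radial profile of the spin-weighted harmonics\<close>

lemma deriv_funpow_poly: "(deriv ^^ k) (poly p) = poly ((pderiv ^^ k) p)" for p :: "real poly"
proof (induction k)
  case (Suc k)
  have "deriv (poly ((pderiv ^^ k) p)) = poly (pderiv ((pderiv ^^ k) p))"
    by (rule ext, rule DERIV_imp_deriv, rule poly_DERIV)
  with Suc show ?case by simp
qed simp

lemma legendre_eq_poly: "legendre n = poly (legendre_poly n)"
proof -
  have "(\<lambda>s :: real. (s\<^sup>2 - 1) ^ n) = poly ([:-1, 0, 1:] ^ n)"
    by (simp add: fun_eq_iff poly_power power2_eq_square)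
  then show ?thesis
    by (simp only: fun_eq_iff legendre_def legendre_poly_def deriv_funpow_poly poly_smult simp_thms)
qed

lemma assoc_legendre_eq_poly:
  "assoc_legendre n k t = sqrt (1 - t\<^sup>2) ^ k * poly ((pderiv ^^ k) (legendre_poly n)) t"
  by (simp add: assoc_legendre_def legendre_eq_poly deriv_funpow_poly)

lemma jacobi_weight_deriv:
  fixes t :: real
  assumes t: "t \<in> {-1<..<1}"
  shows "((\<lambda>t. (1 - t) powr \<alpha> * (1 + t) powr \<beta>) has_real_derivative
    (1 - t) powr \<alpha> * (1 + t) powr \<beta> * ((\<beta> * (1 - t) - \<alpha> * (1 + t)) / (1 - t\<^sup>2))) (at t)"
proof -
  note p = one_minus_square_pos[OF t]
  have "((\<lambda>t. (1 - t) powr \<alpha> * (1 + t) powr \<beta>) has_real_derivative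
     (1 - t) powr \<alpha> * (0 * ln (1 - t) + (0 - 1) * \<alpha> / (1 - t)) * (1 + t) powr \<beta>
     + (1 + t) powr \<beta> * (0 * ln (1 + t) + (0 + 1) * \<beta> / (1 + t)) * (1 - t) powr \<alpha>) (at t)"
    using p by (intro DERIV_mult DERIV_powr derivative_intros) auto
  moreover have "(\<beta> * (1 - t) - \<alpha> * (1 + t)) / (1 - t\<^sup>2) = \<beta> / (1 + t) - \<alpha> / (1 - t)"
    unfolding p(4) using p(2,3) by (simp add: divide_simps)
  moreover have "(1 - t) powr \<alpha> * (0 * ln (1 - t) + (0 - 1) * \<alpha> / (1 - t)) * (1 + t) powr \<beta>
     + (1 + t) powr \<beta> * (0 * ln (1 + t) + (0 + 1) * \<beta> / (1 + t)) * (1 - t) powr \<alpha>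
     = (1 - t) powr \<alpha> * (1 + t) powr \<beta> * (\<beta> / (1 + t) - \<alpha> / (1 - t))"
    by (simp add: algebra_simps)
  ultimately show ?thesis by (simp only:)
qed

definition spin_weight :: "nat \<Rightarrow> int \<Rightarrow> real \<Rightarrow> real" where
  "spin_weight M m t = (1 - t) powr ((real M + of_int m) / 2) * (1 + t) powr ((real M - of_int m) / 2)"

lemma spin_weight_deriv:
  assumes "t \<in> {-1<..<1}"
  shows "(spin_weight M m has_real_derivative
    spin_weight M m t * (- (real M * t + of_int m) / (1 - t\<^sup>2))) (at t)"
proof -
  have "(real M - of_int m) / 2 * (1 - t) - (real M + of_int m) / 2 * (1 + t) = - (real M * t + of_int m)"
    by (simp add: field_simps)
  then show ?thesis
    using jacobi_weight_deriv[OF assms, of "(real M + of_int m) / 2" "(real M - of_int m) / 2"]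
    unfolding spin_weight_def by simp
qed

lemma spin_weight_Suc:
  assumes "t \<in> {-1<..<1}"
  shows "spin_weight (Suc M) m t = sqrt (1 - t\<^sup>2) * spin_weight M m t"
proof -
  note p = one_minus_square_pos[OF assms]
  have "sqrt (1 - t\<^sup>2) = (1 - t) powr (1 / 2) * (1 + t) powr (1 / 2)"
    unfolding p(4) using p by (simp add: real_sqrt_mult powr_half_sqrt)
  moreover have "(1 - t) powr ((real (Suc M) + of_int m) / 2) = (1 - t) powr (1 / 2) * (1 - t) powr ((real M + of_int m) / 2)"
    "(1 + t) powr ((real (Suc M) - of_int m) / 2) = (1 + t) powr (1 / 2) * (1 + t) powr ((real M - of_int m) / 2)"
    by (simp_all add: powr_add[symmetric] field_simps)
  ultimately show ?thesis unfolding spin_weight_def by simp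
qed

text \<open>One factor of the weight has the exponent \<open>k / 2\<close> with
  \<open>k = \<bar>m\<bar>\<close>, as desired; the other has \<open>- k / 2\<close>, and the power
  of the linear factor raises it by \<open>k\<close>.\<close>

lemma sqrt_power_eq_spin_weight:
  assumes "t \<in> {-1<..<1}"
  shows "sqrt (1 - t\<^sup>2) ^ nat \<bar>m\<bar> = spin_weight 0 m t * (1 + sgn_unit m * t) ^ nat \<bar>m\<bar>"
proof -
  note p = one_minus_square_pos[OF assms]
  define k where "k = nat \<bar>m\<bar>"
  have sq: "sqrt x ^ k = x powr (real k / 2)" "x ^ k = x powr real k" if "x > 0" for x
    using that by (simp_all add: powr_half_sqrt[symmetric] powr_power powr_realpow)
  have 1: "sqrt (1 - t\<^sup>2) ^ k = (1 - t) powr (real k / 2) * (1 + t) powr (real k / 2)"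
    unfolding p(4) using p by (simp only: real_sqrt_mult power_mult_distrib sq)
  show ?thesis
  proof (cases "0 \<le> m")
    case True
    then have m: "of_int m = real k" "sgn_unit m = 1" by (auto simp: k_def sgn_unit_def)
    have "(1 + t) powr (- real k / 2) * (1 + t) powr real k = (1 + t) powr (real k / 2)"
      by (simp add: powr_add[symmetric])
    then show ?thesis
      unfolding spin_weight_def k_def[symmetric] 1 m using p by (simp add: sq mult.assoc)
  next
    case False
    then have m: "of_int m = - real k" "sgn_unit m = -1" by (auto simp: k_def sgn_unit_def)
    have "(1 - t) powr (- real k / 2) * (1 - t) powr real k = (1 - t) powr (real k / 2)"
      by (simp add: powr_add[symmetric])
    then show ?thesis
      unfolding spin_weight_def k_def[symmetric] 1 m using p by (simp add: sq mult.commute mult.left_commute)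
  qed
qed

text \<open>The derivatives of the weight times \<open>q\<close> are the weight times a polynomial divided by
  powers of \<open>1 - t\<^sup>2\<close>; these are the polynomials.\<close>

primrec spin_jet :: "nat \<Rightarrow> int \<Rightarrow> real poly \<Rightarrow> nat \<Rightarrow> real poly" where
  "spin_jet M m q 0 = q"
| "spin_jet M m q (Suc k) =
     [:1, 0, -1:] * pderiv (spin_jet M m q k) + [:- of_int m, 2 * real k - real M:] * spin_jet M m q k"

definition spin_deriv :: "nat \<Rightarrow> int \<Rightarrow> real poly \<Rightarrow> nat \<Rightarrow> real \<Rightarrow> real" where
  "spin_deriv M m q k t = spin_weight M m t * poly (spin_jet M m q k) t / (1 - t\<^sup>2) ^ k"

lemma spin_deriv_Suc:
  assumes t: "t \<in> {-1<..<1}"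
  shows "(spin_deriv M m q k has_real_derivative spin_deriv M m q (Suc k) t) (at t)"
proof -
  let ?q = "spin_jet M m q k"
  define a where "a = 1 - t\<^sup>2"
  have a: "a > 0" using one_minus_square_pos[OF t] by (simp add: a_def)
  have "((\<lambda>t. (1 - t\<^sup>2) ^ k) has_real_derivative real k * ((0 - 2 * t) * (1 - t\<^sup>2) ^ (k - 1))) (at t)"
    by (auto intro!: derivative_eq_intros)
  moreover have "real k * ((0 - 2 * t) * (1 - t\<^sup>2) ^ (k - 1)) = - 2 * real k * t * a ^ k / a"
    proof (cases k)
    case (Suc l)
    then show ?thesis using a unfolding a_def[symmetric] by simp (simp add: algebra_simps)
  qed simp
  ultimately have d: "((\<lambda>t. (1 - t\<^sup>2) ^ k) has_real_derivative - 2 * real k * t * a ^ k / a) (at t)"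
    by simp
  have "((\<lambda>t. spin_weight M m t * poly ?q t / (1 - t\<^sup>2) ^ k) has_real_derivative
    ((spin_weight M m t * (- (real M * t + of_int m) / a) * poly ?q t + poly (pderiv ?q) t * spin_weight M m t) * a ^ k
      - (spin_weight M m t * poly ?q t) * (- 2 * real k * t * a ^ k / a)) / (a ^ k * a ^ k)) (at t)"
    using a spin_weight_deriv[OF t, of M m] unfolding a_def
    by (intro DERIV_divide[of _ _ _ _ "\<lambda>t. (1 - t\<^sup>2) ^ k"] DERIV_mult poly_DERIV d[unfolded a_def]) auto
  moreover have "((spin_weight M m t * (- (real M * t + of_int m) / a) * poly ?q t + poly (pderiv ?q) t * spin_weight M m t) * a ^ k
      - (spin_weight M m t * poly ?q t) * (- 2 * real k * t * a ^ k / a)) / (a ^ k * a ^ k)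
     = spin_weight M m t * (a * poly (pderiv ?q) t + (2 * real k * t - (real M * t + of_int m)) * poly ?q t) / (a * a ^ k)"
    using a by (simp add: divide_simps) (simp add: algebra_simps)
  moreover have "spin_deriv M m q (Suc k) t
     = spin_weight M m t * (a * poly (pderiv ?q) t + (2 * real k * t - (real M * t + of_int m)) * poly ?q t) / (a * a ^ k)"
    unfolding spin_deriv_def a_def by (simp add: algebra_simps power2_eq_square)
  moreover have "spin_deriv M m q k = (\<lambda>t. spin_weight M m t * poly ?q t / (1 - t\<^sup>2) ^ k)"
    by (simp add: spin_deriv_def fun_eq_iff)
  ultimately show ?thesis by simp
qed

lemma of_real_has_vector_derivative:
  assumes "(f has_real_derivative d) (at t)"
  shows "((\<lambda>t. complex_of_real (c * f t)) has_vector_derivative complex_of_real (c * d)) (at t)"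
  using assms by (intro has_vector_derivative_of_real DERIV_cmult)

text \<open>The logarithmic derivative of the weight is \<open>- (M t + m) / (1 - t^2)\<close>,
  which cancels the zero-order term. The remaining factor \<open>sqrt (1 - t^2)\<close> turns the
  weight for \<open>M\<close> into that for \<open>M + 1\<close>.\<close>

lemma spin_raise:
  assumes t: "t \<in> {-1<..<1}"
  shows "sqrt (1 - t\<^sup>2) * (c * spin_deriv M m q 1 t)
      + (real M * t + of_int m) * (c * (spin_weight M m t * poly q t)) / sqrt (1 - t\<^sup>2)
    = c * (spin_weight (Suc M) m t * poly (pderiv q) t)"
proof -
  define r where "r = sqrt (1 - t\<^sup>2)"
  have r: "r > 0" "1 - t\<^sup>2 = r\<^sup>2" using one_minus_square_pos[OF t] by (auto simp: r_def)
  have d: "spin_deriv M m q 1 t = spin_weight M m t * (r\<^sup>2 * poly (pderiv q) t - (real M * t + of_int m) * poly q t) / r\<^sup>2"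
    unfolding spin_deriv_def r(2)[symmetric] by (simp add: algebra_simps power2_eq_square)
  show ?thesis
    unfolding r_def[symmetric] spin_weight_Suc[OF t] d using r(1)
    by (simp add: divide_simps power2_eq_square) (simp add: algebra_simps)
qed

lemma mode_d_t_spin:
  assumes "mode j (\<lambda>t. complex_of_real (c * (spin_weight M m t * poly q t))) F"
  shows "mode j (\<lambda>t. complex_of_real (c * spin_deriv M m q 1 t)) (d_t F)"
proof (rule modes_d_t[OF assms])
  fix t :: real assume t: "t \<in> {-1<..<1}"
  show "((\<lambda>t. complex_of_real (c * (spin_weight M m t * poly q t))) has_vector_derivative complex_of_real (c * spin_deriv M m q 1 t)) (at t)"
    using of_real_has_vector_derivative[OF spin_deriv_Suc[OF t, of M m q 0]] by (simp add: spin_deriv_def)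
qed

lemma mode_eth:
  assumes F: "mode m (\<lambda>t. complex_of_real (c * (spin_weight M m t * poly q t))) F"
  shows "mode m (\<lambda>t. complex_of_real (c * (spin_weight (Suc M) m t * poly (pderiv q) t))) (eth (int M) F)"
  unfolding modes_def
proof (intro ballI allI)
  fix t \<phi> :: real assume t: "t \<in> {-1<..<1}"
  let ?G = "c * (spin_weight M m t * poly q t)" and ?e = "cis (of_int m * \<phi>)"
  have "eth (int M) F (xi t \<phi>) = complex_of_real (sqrt (1 - t\<^sup>2)) * (complex_of_real (c * spin_deriv M m q 1 t) * ?e)
     + (of_int (int M) * complex_of_real t * (complex_of_real ?G * ?e) - \<i> * (\<i> * of_int m * complex_of_real ?G * ?e)) / complex_of_real (sqrt (1 - t\<^sup>2))"
    using modesD[OF mode_d_t_spin[OF F] t, of \<phi>] modesD[OF modes_d_phi[OF F] t, of \<phi>] modesD[OF F t, of \<phi>]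
    unfolding eth_def by (simp only: lat_xi sum.insert[OF finite.emptyI empty_iff[THEN iffD1, THEN notI]] sum.empty add_0_right)
  also have "\<dots> = complex_of_real (sqrt (1 - t\<^sup>2) * (c * spin_deriv M m q 1 t) + (real M * t + of_int m) * ?G / sqrt (1 - t\<^sup>2)) * ?e"
    by (simp add: add_divide_distrib diff_divide_distrib algebra_simps)
  finally show "eth (int M) F (xi t \<phi>) = (\<Sum>i\<in>{()}. complex_of_real (c * (spin_weight (Suc M) m t * poly (pderiv q) t)) * ?e)"
    unfolding spin_raise[OF t] by simp
qed

text \<open>On profiles, \<open>ethbar\<close> with spin \<open>- M\<close> at order
  \<open>- m\<close> is the same operator as \<open>eth\<close> with spin \<open>M\<close> at order
  \<open>m\<close>. This is why the order changes sign for negative spin.\<close>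

lemma mode_ethbar:
  assumes F: "mode (- m) (\<lambda>t. complex_of_real (c * (spin_weight M m t * poly q t))) F"
  shows "mode (- m) (\<lambda>t. complex_of_real (c * (spin_weight (Suc M) m t * poly (pderiv q) t))) (ethbar (- int M) F)"
  unfolding modes_def
proof (intro ballI allI)
  fix t \<phi> :: real assume t: "t \<in> {-1<..<1}"
  let ?G = "c * (spin_weight M m t * poly q t)" and ?e = "cis (of_int (- m) * \<phi>)"
  have "ethbar (- int M) F (xi t \<phi>) = complex_of_real (sqrt (1 - t\<^sup>2)) * (complex_of_real (c * spin_deriv M m q 1 t) * ?e)
     - (of_int (- int M) * complex_of_real t * (complex_of_real ?G * ?e) - \<i> * (\<i> * of_int (- m) * complex_of_real ?G * ?e)) / complex_of_real (sqrt (1 - t\<^sup>2))"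
    using modesD[OF mode_d_t_spin[OF F] t, of \<phi>] modesD[OF modes_d_phi[OF F] t, of \<phi>] modesD[OF F t, of \<phi>]
    unfolding ethbar_def by (simp only: lat_xi sum.insert[OF finite.emptyI empty_iff[THEN iffD1, THEN notI]] sum.empty add_0_right)
  also have "\<dots> = complex_of_real (sqrt (1 - t\<^sup>2) * (c * spin_deriv M m q 1 t) + (real M * t + of_int m) * ?G / sqrt (1 - t\<^sup>2)) * ?e"
    by (simp add: add_divide_distrib diff_divide_distrib algebra_simps)
  finally show "ethbar (- int M) F (xi t \<phi>) = (\<Sum>i\<in>{()}. complex_of_real (c * (spin_weight (Suc M) m t * poly (pderiv q) t)) * ?e)"
    unfolding spin_raise[OF t] by simp
qed

text \<open>For \<open>j < 0\<close> the sign in \<open>sph_Y\<close> cancels the one in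
  \<open>sph_Y_nonneg\<close>, hence the value 1 there.\<close>

definition ang_coeff :: "nat \<Rightarrow> int \<Rightarrow> real" where
  "ang_coeff n j = (if 0 \<le> j then (-1) ^ nat j else 1) * (sqrt ((2 * real n + 1) / (4 * pi))
     * sqrt (fact (n - nat \<bar>j\<bar>) / fact (n + nat \<bar>j\<bar>)))"

text \<open>Before any raising, the profile depends only on \<open>\<bar>j\<bar>\<close> apart from
  its sign factor, so it can be split with \<open>m = j\<close> or with \<open>m = - j\<close>. The
  first choice starts the chain of \<open>eth\<close>, the second that of
  \<open>ethbar\<close>.\<close>

lemma sph_Y_mode:
  assumes m: "\<bar>m\<bar> = \<bar>j\<bar>"
  shows "mode j (\<lambda>t. complex_of_real (ang_coeff n j * (spin_weight 0 m t * poly (spin_poly 0 m n) t))) (sph_Y n j)"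
  unfolding modes_def
proof (intro ballI allI)
  fix t \<phi> :: real assume t: "t \<in> {-1<..<1}"
  define k where "k = nat \<bar>j\<bar>"
  define A where "A = sqrt ((2 * real n + 1) / (4 * pi)) * sqrt (fact (n - k) / fact (n + k)) * assoc_legendre n k t"
  have A: "assoc_legendre n k t = spin_weight 0 m t * poly (spin_poly 0 m n) t"
    unfolding assoc_legendre_eq_poly k_def m[symmetric] sqrt_power_eq_spin_weight[OF t]
    by (simp add: spin_poly_def poly_power mult.commute[of t])
  have e: "exp (\<i> * of_nat k * complex_of_real (lon (xi t \<phi>))) = cis (of_int (int k) * \<phi>)"
    using cis_lon_xi[OF t, of "int k" \<phi>] by (simp add: cis_conv_exp mult.assoc)
  have Y: "sph_Y_nonneg n k (xi t \<phi>) = (- 1) ^ k * complex_of_real A * cis (of_int (int k) * \<phi>)"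
    unfolding sph_Y_nonneg_def e lat_xi A_def ..
  have "sph_Y n j (xi t \<phi>) = complex_of_real ((if 0 \<le> j then (-1) ^ nat j else 1) * A) * cis (of_int j * \<phi>)"
  proof (cases "0 \<le> j")
    case True
    then show ?thesis using Y unfolding sph_Y_def k_def by simp
  next
    case False
    then have k: "nat (- j) = k" "of_int j = - real k" by (auto simp: k_def)
    have "(- 1 :: complex) powi j * (- 1) ^ k = 1"
      using False k(1) by (simp add: power_int_def power_mult_distrib[symmetric])
    then show ?thesis
      using False unfolding sph_Y_def k Y
      by (simp add: cis_cnj mult.assoc[symmetric])
  qed
  moreover have "(if 0 \<le> j then (-1) ^ nat j else 1) * A = ang_coeff n j * (spin_weight 0 m t * poly (spin_poly 0 m n) t)"
    unfolding A_def A ang_coeff_def k_def[symmetric] by (simp only: mult.assoc)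
  ultimately show "sph_Y n j (xi t \<phi>) = (\<Sum>i\<in>{()}. complex_of_real (ang_coeff n j * (spin_weight 0 m t * poly (spin_poly 0 m n) t)) * cis (of_int j * \<phi>))"
    by simp
qed

lemma eth0_pow_mode:
  "mode j (\<lambda>t. complex_of_real (ang_coeff n j * (spin_weight M j t * poly (spin_poly M j n) t))) (eth0_pow M (sph_Y n j))"
proof (induction M)
  case (Suc M)
  from mode_eth[OF this] show ?case unfolding pderiv_spin_poly eth0_pow.simps .
qed (simp only: sph_Y_mode eth0_pow.simps)

lemma ethbar0_pow_mode:
  "mode j (\<lambda>t. complex_of_real (ang_coeff n j * (spin_weight M (- j) t * poly (spin_poly M (- j) n) t))) (ethbar0_pow M (sph_Y n j))"
proof (induction M)
  case (Suc M)
  from mode_ethbar[of "- j", unfolded minus_minus, OF Suc] show ?case unfolding pderiv_spin_poly ethbar0_pow.simps .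
qed (simp only: sph_Y_mode ethbar0_pow.simps abs_minus_cancel)

definition spin_ang :: "int \<Rightarrow> int \<Rightarrow> int" where
  "spin_ang N j = (if 0 \<le> N then j else - j)"

definition spin_coeff :: "int \<Rightarrow> nat \<Rightarrow> int \<Rightarrow> real" where
  "spin_coeff N n j = (if 0 \<le> N then 1 else (-1) powi N) * (if 0 \<le> j then (-1) ^ nat j else 1)
     * sqrt (spin_norm (nat \<bar>N\<bar>) (spin_ang N j) n / (4 * pi))"

definition spin_radial :: "int \<Rightarrow> int \<Rightarrow> nat \<Rightarrow> nat \<Rightarrow> real \<Rightarrow> real" where
  "spin_radial N j n k t = spin_coeff N n j
     * spin_deriv (nat \<bar>N\<bar>) (spin_ang N j) (spin_poly (nat \<bar>N\<bar>) (spin_ang N j) n) k t"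

lemma spin_Y_mode: "mode j (\<lambda>t. complex_of_real (spin_radial N j n 0 t)) (spin_Y N n j)"
proof -
  have sq: "sqrt (spin_norm M m n / (4 * pi))
      = sqrt ((2 * real n + 1) / (4 * pi)) * sqrt (fact (n - nat \<bar>m\<bar>) / fact (n + nat \<bar>m\<bar>)) * sqrt (fact (n - M) / fact (n + M))"
    for M m by (simp add: spin_norm_def real_sqrt_mult[symmetric])
  show ?thesis
  proof (cases "0 \<le> N")
    case True
    then have f: "nat (int n - N) = n - nat N" "nat (int n + N) = n + nat N" "nat \<bar>N\<bar> = nat N" by auto
    show ?thesis
      using modes_times_lat[OF eth0_pow_mode[of j n "nat N"], of "\<lambda>_. complex_of_real (sqrt (fact (n - nat N) / fact (n + nat N)))"] True
      unfolding spin_Y_def[abs_def] spin_radial_def spin_coeff_def spin_ang_def spin_deriv_def sq ang_coeff_def f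
      by (simp add: mult.assoc mult.left_commute mult.commute)
  next
    case False
    then have f: "nat (int n + N) = n - nat (- N)" "nat (int n - N) = n + nat (- N)" "nat \<bar>N\<bar> = nat (- N)" by auto
    show ?thesis
      using modes_times_lat[OF ethbar0_pow_mode[of j n "nat (- N)"], of "\<lambda>_. (- 1) powi N * complex_of_real (sqrt (fact (n - nat (- N)) / fact (n + nat (- N))))"] False
      unfolding spin_Y_def[abs_def] spin_radial_def spin_coeff_def spin_ang_def spin_deriv_def sq ang_coeff_def f
      by (simp add: mult.assoc mult.left_commute mult.commute)
  qed
qed

lemma spin_radial_has_vector_derivative:
  assumes t: "t \<in> {-1<..<1}"
  shows "((\<lambda>t. complex_of_real (spin_radial N j n k t)) has_vector_derivative
    complex_of_real (spin_radial N j n (Suc k) t)) (at t)"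
  using of_real_has_vector_derivative[OF spin_deriv_Suc[OF t]] by (simp only: spin_radial_def)

definition spin_K :: "int \<Rightarrow> int \<Rightarrow> nat \<Rightarrow> real \<Rightarrow> real" where
  "spin_K N j n t = (1 - t\<^sup>2) * spin_radial N j n 2 t - 2 * t * spin_radial N j n 1 t"

lemma mult_has_vector_derivative_K:
  assumes "(h has_vector_derivative h') (at t)"
  shows "((\<lambda>t. complex_of_real (1 - t\<^sup>2) * h t) has_vector_derivative
    complex_of_real (1 - t\<^sup>2) * h' - 2 * complex_of_real t * h t) (at t)"
proof -
  have "((\<lambda>t. complex_of_real (1 - t\<^sup>2)) has_vector_derivative complex_of_real (0 - 2 * t)) (at t)"
    by (rule has_vector_derivative_of_real) (auto intro!: derivative_eq_intros)
  from has_vector_derivative_mult[OF this assms] show ?thesis by (simp add: algebra_simps)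
qed

lemma spin_K_has_vector_derivative:
  assumes t: "t \<in> {-1<..<1}"
  shows "((\<lambda>t. complex_of_real (1 - t\<^sup>2) * complex_of_real (spin_radial N j n 1 t)) has_vector_derivative
    complex_of_real (spin_K N j n t)) (at t)"
  using mult_has_vector_derivative_K[OF spin_radial_has_vector_derivative[OF t, of N j n 1]]
  by (simp add: spin_K_def numeral_2_eq_2)

text \<open>The Beltrami potential sees spin and order only through their squares and their product,
  and these do not change when both reverse sign.\<close>

lemma spin_ang_simps:
  "(of_int (spin_ang N j) :: real)\<^sup>2 = (of_int j)\<^sup>2" "(real (nat \<bar>N\<bar>))\<^sup>2 = (of_int N)\<^sup>2"
  "real (nat \<bar>N\<bar>) * of_int (spin_ang N j) = of_int N * of_int j" "nat \<bar>spin_ang N j\<bar> = nat \<bar>j\<bar>"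
  by (auto simp: spin_ang_def)

text \<open>This is \<open>spin_ode\<close> conjugated by the weight; the terms in \<open>M\<close>
  and \<open>m\<close> combine so that the eigenvalue depends on the degree alone.\<close>

lemma spin_eigen:
  assumes t: "t \<in> {-1<..<1}"
  shows "spin_K N j n t - (((of_int j)\<^sup>2 + (of_int N)\<^sup>2 + 2 * of_int N * of_int j * t) / (1 - t\<^sup>2)) * spin_radial N j n 0 t
    = - (real n * (real n + 1)) * spin_radial N j n 0 t"
proof -
  define M where "M = real (nat \<bar>N\<bar>)"
  define m where "m = (of_int (spin_ang N j) :: real)"
  define p where "p = spin_poly (nat \<bar>N\<bar>) (spin_ang N j) n"
  define q q' q'' where "q = poly p t" and "q' = poly (pderiv p) t" and "q'' = poly (pderiv (pderiv p)) t"
  define w where "w = spin_coeff N n j * spin_weight (nat \<bar>N\<bar>) (spin_ang N j) t"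
  define a where "a = 1 - t\<^sup>2"
  have a: "a > 0" using one_minus_square_pos[OF t] by (simp add: a_def)
  \<comment> \<open>The value at \<open>t\<close> of the first polynomial in
    \<open>spin_jet\<close>, and of its derivative.\<close>
  define J1 J1' where "J1 = a * q' - (M * t + m) * q" and "J1' = a * q'' - 2 * t * q' - (M * t + m) * q' - M * q"
  have r0: "spin_radial N j n 0 t = w * q"
    by (simp add: spin_radial_def spin_deriv_def w_def q_def p_def)
  have r1: "spin_radial N j n 1 t = w * J1 / a"
    unfolding spin_radial_def spin_deriv_def w_def q_def p_def[symmetric] J1_def q'_def a_def M_def m_def
    by (simp add: algebra_simps power2_eq_square)
  have r2: "spin_radial N j n 2 t = w * (a * J1' + (2 * t - M * t - m) * J1) / a\<^sup>2"
    unfolding spin_radial_def spin_deriv_def w_def q_def p_def[symmetric] J1_def J1'_def q'_def q''_def a_def M_def m_def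
    by (simp add: numeral_2_eq_2 pderiv_mult pderiv_add pderiv_diff pderiv_smult pderiv_minus pderiv_pCons algebra_simps)
  have ode: "a * q'' - 2 * ((M + 1) * t + m) * q' + (real n - M) * (real n + M + 1) * q = 0"
    using spin_ode_spin_poly[of "nat \<bar>N\<bar>" "spin_ang N j" n]
    unfolding spin_ode_def a_def q_def q'_def q''_def p_def M_def m_def by blast
  have key: "a * J1' - (M * t + m) * J1 - (m\<^sup>2 + M\<^sup>2 + 2 * M * m * t) * q = - (real n * (real n + 1)) * a * q"
    using ode unfolding J1_def J1'_def a_def by algebra
  have "spin_K N j n t - ((m\<^sup>2 + M\<^sup>2 + 2 * M * m * t) / a) * spin_radial N j n 0 t
     = w * (a * J1' - (M * t + m) * J1 - (m\<^sup>2 + M\<^sup>2 + 2 * M * m * t) * q) / a"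
    unfolding spin_K_def r0 r1 r2 a_def[symmetric] using a
    by (simp add: divide_simps power2_eq_square) (simp add: algebra_simps)
  also have "\<dots> = - (real n * (real n + 1)) * (w * q)"
    unfolding key using a by simp
  finally have "spin_K N j n t - ((m\<^sup>2 + M\<^sup>2 + 2 * (M * m) * t) / a) * spin_radial N j n 0 t
     = - (real n * (real n + 1)) * (w * q)" by (simp only: mult.assoc)
  then show ?thesis unfolding r0 a_def M_def m_def spin_ang_simps by (simp only: mult.assoc)
qed

definition spin_I :: "real \<Rightarrow> nat \<Rightarrow> int \<Rightarrow> int \<Rightarrow> nat \<Rightarrow> real \<Rightarrow> real" where
  "spin_I b L N j n t = (b - t) * (- (real n * (real n + 1)) * spin_radial N j n 0 t)
     + (t\<^sup>2 - 1) * spin_radial N j n 1 t - real (L * (L + 2)) * t * spin_radial N j n 0 t"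

lemma I_radial_spin:
  assumes t: "t \<in> {-1<..<1}"
  shows "I_radial b L N j (\<lambda>t. complex_of_real (spin_radial N j n 0 t)) (\<lambda>t. complex_of_real (spin_radial N j n 1 t))
      (\<lambda>t. complex_of_real (spin_K N j n t)) t = complex_of_real (spin_I b L N j n t)"
proof -
  have "beltrami_radial N j (\<lambda>t. complex_of_real (spin_radial N j n 0 t)) (\<lambda>t. complex_of_real (spin_K N j n t)) t
    = complex_of_real (- (real n * (real n + 1)) * spin_radial N j n 0 t)"
    unfolding spin_eigen[OF t, symmetric] beltrami_radial_def by (simp only: of_real_diff of_real_mult)
  then show ?thesis
    unfolding I_radial_def spin_I_def
    by (simp only: of_real_diff of_real_mult of_real_add of_real_of_nat_eq)
qed

lemma spin_I_eq_tridiag: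
  assumes t: "t \<in> {-1<..<1}"
  shows "spin_I b L N j n t = spin_coeff N n j * spin_weight (nat \<bar>N\<bar>) (spin_ang N j) t
    * tridiag_op b L (nat \<bar>N\<bar>) (spin_ang N j) n t"
proof -
  define p where "p = spin_poly (nat \<bar>N\<bar>) (spin_ang N j) n"
  define M where "M = real (nat \<bar>N\<bar>)"
  define m where "m = (of_int (spin_ang N j) :: real)"
  define w where "w = spin_coeff N n j * spin_weight (nat \<bar>N\<bar>) (spin_ang N j) t"
  define J where "J = (1 - t\<^sup>2) * poly (pderiv p) t - (M * t + m) * poly p t"
  have r0: "spin_radial N j n 0 t = w * poly p t"
    by (simp add: spin_radial_def spin_deriv_def w_def p_def)
  have r1: "spin_radial N j n 1 t = w * J / (1 - t\<^sup>2)"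
    unfolding spin_radial_def spin_deriv_def w_def p_def[symmetric] J_def M_def m_def
    by (simp add: algebra_simps power2_eq_square)
  have "(t\<^sup>2 - 1) * spin_radial N j n 1 t = - (w * J) * ((1 - t\<^sup>2) / (1 - t\<^sup>2))"
    unfolding r1 times_divide_eq_right by (simp add: left_diff_distrib right_diff_distrib mult.commute)
  then have r1': "(t\<^sup>2 - 1) * spin_radial N j n 1 t = - (w * J)"
    using one_minus_square_pos[OF t] by simp
  show ?thesis
    unfolding spin_I_def r1' r0 J_def tridiag_op_def p_def[symmetric] w_def[symmetric] M_def[symmetric] m_def[symmetric]
    by algebra
qed

lemma spin_coeff_square: "(spin_coeff N n j)\<^sup>2 = spin_norm (nat \<bar>N\<bar>) (spin_ang N j) n / (4 * pi)"
proof -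
  have "0 \<le> spin_norm (nat \<bar>N\<bar>) (spin_ang N j) n" by (simp add: spin_norm_def)
  moreover have "((-1 :: real) powi N)\<^sup>2 = 1" by (simp add: power_int_def power_mult[symmetric] mult.commute)
  ultimately show ?thesis
    by (simp add: spin_coeff_def power_mult_distrib power_mult[symmetric] mult.commute)
qed

text \<open>The weights at \<open>s\<close> and \<open>t\<close> do not depend on \<open>n\<close>,
  and the signs in \<open>spin_coeff\<close> disappear in the square. What is left is
  \<open>tridiag_kernel_commute\<close> up to a common factor.\<close>

lemma spin_kernel_commute:
  assumes s: "s \<in> {-1<..<1}" and t: "t \<in> {-1<..<1}"
  shows "(\<Sum>n = max (nat \<bar>N\<bar>) (nat \<bar>j\<bar>)..L. spin_radial N j n 0 s * spin_I b L N j n t)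
    = (\<Sum>n = max (nat \<bar>N\<bar>) (nat \<bar>j\<bar>)..L. spin_I b L N j n s * spin_radial N j n 0 t)"
proof -
  let ?M = "nat \<bar>N\<bar>" and ?m = "spin_ang N j"
  let ?w = "spin_weight ?M ?m"
  have r: "spin_radial N j n 0 t = spin_coeff N n j * ?w t * poly (spin_poly ?M ?m n) t" for n t
    by (simp add: spin_radial_def spin_deriv_def)
  have 1: "spin_radial N j n 0 s * spin_I b L N j n t
     = (?w s * ?w t / (4 * pi)) * (spin_norm ?M ?m n * (poly (spin_poly ?M ?m n) s * tridiag_op b L ?M ?m n t))" for n
  proof -
    have "spin_radial N j n 0 s * spin_I b L N j n t
      = (?w s * ?w t) * ((spin_coeff N n j)\<^sup>2 * (poly (spin_poly ?M ?m n) s * tridiag_op b L ?M ?m n t))"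
      unfolding r spin_I_eq_tridiag[OF t] by (simp add: power2_eq_square ac_simps)
    then show ?thesis unfolding spin_coeff_square by simp
  qed
  have 2: "spin_I b L N j n s * spin_radial N j n 0 t
     = (?w s * ?w t / (4 * pi)) * (spin_norm ?M ?m n * (tridiag_op b L ?M ?m n s * poly (spin_poly ?M ?m n) t))" for n
  proof -
    have "spin_I b L N j n s * spin_radial N j n 0 t
      = (?w s * ?w t) * ((spin_coeff N n j)\<^sup>2 * (tridiag_op b L ?M ?m n s * poly (spin_poly ?M ?m n) t))"
      unfolding r spin_I_eq_tridiag[OF s] by (simp add: power2_eq_square ac_simps)
    then show ?thesis unfolding spin_coeff_square by simp
  qed
  show ?thesis
    using tridiag_kernel_commute[where M = ?M and m = ?m and L = L and b = b and s = s and t = t]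
    unfolding 1 2 sum_distrib_left[symmetric] spin_ang_simps(4) by (simp only:)
qed

text \<open>Each derivative lowers the order of the zero at \<open>t = 1\<close> by at most
  one.\<close>

lemma pderiv_funpow_linear_power:
  fixes r :: "real poly"
  shows "\<exists>Q. (pderiv ^^ k) ([:1, -1:] ^ (a + k) * r) = [:1, -1:] ^ a * Q"
proof (induction k arbitrary: a)
  case (Suc k)
  from Suc[of "Suc a"] obtain Q where "(pderiv ^^ k) ([:1, -1:] ^ (Suc a + k) * r) = [:1, -1:] ^ Suc a * Q" by blast
  then have "(pderiv ^^ Suc k) ([:1, -1:] ^ (a + Suc k) * r) = pderiv ([:1, -1:] ^ Suc a * Q)"
    by simp
  also have "\<dots> = [:1, -1:] ^ a * ([:1, -1:] * pderiv Q + smult (- real (Suc a)) Q)"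
    unfolding pderiv_mult pderiv_power_Suc by (simp add: pderiv_pCons algebra_simps) (simp flip: smult_add_left)
  finally show ?case by blast
qed auto

text \<open>Near the north pole a spin-weighted harmonic behaves like \<open>(1 - t)\<close> to the power
  \<open>\<bar>N + j\<bar> / 2\<close>; when the weight itself is singular there, the polynomial factor compensates.\<close>

lemma spin_radial_north_form:
  obtains a :: nat and c :: real and Q :: "real poly"
  where "\<And>t. t \<in> {-1<..<1} \<Longrightarrow>
    spin_weight M m t * poly (spin_poly M m n) t = (1 - t) powr (real a / 2) * (1 + t) powr c * poly Q t"
proof (cases "0 \<le> int M + m")
  case True
  then have "real (nat (int M + m)) = real M + of_int m" by simp
  then show ?thesis
    by (intro that[of "nat (int M + m)" "(real M - of_int m) / 2" "spin_poly M m n"]) (simp add: spin_weight_def)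
next
  case False
  define a where "a = nat (- (int M + m))"
  \<comment> \<open>The polynomial differentiated \<open>M\<close> times contains
    \<open>(1 - t)^(a + M)\<close>, so a factor \<open>(1 - t)^a\<close> survives and turns the
    weight exponent \<open>- a / 2\<close> into \<open>a / 2\<close>.\<close>
  have a: "nat \<bar>m\<bar> = a + M" "real M + of_int m = - real a" "sgn_unit m = -1" using False by (auto simp: a_def sgn_unit_def)
  obtain Q where Q: "spin_poly M m n = [:1, -1:] ^ a * Q"
    unfolding spin_poly_def a using pderiv_funpow_linear_power by blast
  show ?thesis
  proof (rule that[of a "(real M - of_int m) / 2" Q])
    fix t :: real assume t: "t \<in> {-1<..<1}"
    note p = one_minus_square_pos[OF t]
    have "(1 - t) powr (- real a / 2) * (1 - t) ^ a = (1 - t) powr (real a / 2)"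
      using p by (simp add: powr_realpow[symmetric] powr_add[symmetric])
    then show "spin_weight M m t * poly (spin_poly M m n) t
       = (1 - t) powr (real a / 2) * (1 + t) powr ((real M - of_int m) / 2) * poly Q t"
      unfolding spin_weight_def Q a(2) by (simp add: poly_power ac_simps)
  qed
qed

text \<open>The derivative may blow up like \<open>(1 - t) powr (- 1 / 2)\<close>. Its product with
  \<open>1 - t^2\<close> extends continuously by 0, which is the form in which it enters the
  boundary term.\<close>

lemma spin_radial_north:
  obtains g B :: "real \<Rightarrow> real"
  where "continuous_on {-1<..1} g" "continuous_on {-1<..1} B" "B 1 = 0"
    "\<And>t. t \<in> {-1<..<1} \<Longrightarrow> spin_radial N j n 0 t = g t"
    "\<And>t. t \<in> {-1<..<1} \<Longrightarrow> (1 - t\<^sup>2) * spin_radial N j n 1 t = B t"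
proof -
  let ?M = "nat \<bar>N\<bar>" and ?m = "spin_ang N j"
  define k where "k = spin_coeff N n j"
  obtain a :: nat and c :: real and Q where form: "\<And>t. t \<in> {-1<..<1} \<Longrightarrow>
    spin_weight ?M ?m t * poly (spin_poly ?M ?m n) t = (1 - t) powr (real a / 2) * (1 + t) powr c * poly Q t"
    using spin_radial_north_form by metis
  have pw: "(1 - t) powr (real a / 2) = sqrt (1 - t) ^ a" if "t \<in> {-1<..<1}" for t :: real
    using one_minus_square_pos[OF that] by (simp add: powr_half_sqrt[symmetric] powr_power)
  \<comment> \<open>A natural power of the root replaces \<open>powr\<close>: as
    \<open>0 powr 0 = 0\<close>, the case \<open>a = 0\<close> would be discontinuous at
    \<open>t = 1\<close>.\<close>
  define g where "g = (\<lambda>t. k * (sqrt (1 - t) ^ a * (1 + t) powr c * poly Q t))"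
  define B where "B = (\<lambda>t. k * (sqrt (1 - t) ^ a * (1 + t) powr c
     * ((c * (1 - t) - real a / 2 * (1 + t)) * poly Q t + (1 - t\<^sup>2) * poly (pderiv Q) t)))"
  have gr: "spin_radial N j n 0 t = g t" if "t \<in> {-1<..<1}" for t
    using form[OF that] pw[OF that] by (simp add: spin_radial_def spin_deriv_def g_def k_def)
  show ?thesis
  proof (rule that[of g B])
    show "continuous_on {-1<..1} g"
      unfolding g_def by (intro continuous_intros) auto
    show "continuous_on {-1<..1} B"
      unfolding B_def by (intro continuous_intros) auto
    \<comment> \<open>For \<open>a > 0\<close> the root vanishes at 1; for \<open>a = 0\<close> the
      last factor does.\<close>
    show "B 1 = 0" by (cases a) (simp_all add: B_def)
    fix t :: real assume t: "t \<in> {-1<..<1}"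
    note p = one_minus_square_pos[OF t]
    show "spin_radial N j n 0 t = g t" by (rule gr[OF t])
    let ?W = "\<lambda>t. (1 - t) powr (real a / 2) * (1 + t) powr c"
    have "((\<lambda>t. k * (?W t * poly Q t)) has_real_derivative
       k * (?W t * ((c * (1 - t) - real a / 2 * (1 + t)) / (1 - t\<^sup>2)) * poly Q t + poly (pderiv Q) t * ?W t)) (at t)"
      by (intro DERIV_cmult DERIV_mult jacobi_weight_deriv[OF t] poly_DERIV)
    moreover have "((\<lambda>t. k * (?W t * poly Q t)) has_real_derivative spin_radial N j n 1 t) (at t)"
    proof (rule has_field_derivative_transform_within_open)
      show "(spin_radial N j n 0 has_real_derivative spin_radial N j n 1 t) (at t)"
        using DERIV_cmult[OF spin_deriv_Suc[OF t, of ?M ?m _ 0]]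
        by (simp add: spin_radial_def[abs_def])
      show "spin_radial N j n 0 x = k * (?W x * poly Q x)" if "x \<in> {-1<..<1}" for x
        using form[OF that] by (simp add: spin_radial_def spin_deriv_def k_def)
    qed (use t in auto)
    ultimately have "spin_radial N j n 1 t =
       k * (?W t * ((c * (1 - t) - real a / 2 * (1 + t)) / (1 - t\<^sup>2)) * poly Q t + poly (pderiv Q) t * ?W t)"
      by (rule DERIV_unique[THEN sym])
    moreover have "x * (k * (W * (e / x) * y + y' * W)) = k * (W * (e * (x / x) * y + x * y'))" for x W e y y' :: real
      unfolding divide_inverse by algebra
    ultimately have "(1 - t\<^sup>2) * spin_radial N j n 1 t =
       k * (?W t * ((c * (1 - t) - real a / 2 * (1 + t)) * ((1 - t\<^sup>2) / (1 - t\<^sup>2)) * poly Q t + (1 - t\<^sup>2) * poly (pderiv Q) t))"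
      by (simp only:)
    also have "(1 - t\<^sup>2) / (1 - t\<^sup>2) = 1" using p by simp
    finally show "(1 - t\<^sup>2) * spin_radial N j n 1 t = B t"
      using pw[OF t] by (simp add: B_def)
  qed
qed

section \<open>Radial profile of the functions in \<open>X2\<close>\<close>

text \<open>Composition with the meridian \<open>\<phi> = 0\<close> turns the growth conditions at
  the pole into one-sided statements about profiles.\<close>

lemma xi_pole_filterlim: "filterlim (\<lambda>t. xi t 0) (at north_pole within Omega) (at_left 1)"
proof -
  have n: "xi 1 0 = north_pole" by (simp add: xi_def north_pole_def)
  have ev: "\<forall>\<^sub>F t in at_left 1. t \<in> {-1<..<1 :: real}"
    by (rule eventually_at_leftI[of 0]) auto
  have "isCont (\<lambda>t. xi t 0) 1"
    using continuous_on_xi[of UNIV "\<lambda>t. t" "\<lambda>_. 0"] by (simp add: continuous_on_eq_continuous_at)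
  then have "((\<lambda>t. xi t 0) \<longlongrightarrow> north_pole) (at_left 1)"
    unfolding isCont_def n by (rule filterlim_mono) (auto intro: at_le)
  moreover have "\<forall>\<^sub>F t in at_left 1. xi t 0 \<in> Omega \<and> xi t 0 \<noteq> north_pole"
    using ev by eventually_elim (use xi_in_Omega0 in \<open>auto simp: Omega0_def\<close>)
  ultimately show ?thesis by (simp add: filterlim_at)
qed

lemma bounded_near_north:
  fixes f :: "real \<Rightarrow> complex"
  assumes f: "continuous_on {-1<..<1} f" and b: "-1 < b"
    and ev: "\<forall>\<^sub>F t in at_left 1. cmod (f t) \<le> C"
  shows "bounded (f ` {b..<1})"
proof -
  obtain d where d: "d < 1" "\<And>t. d < t \<Longrightarrow> t < 1 \<Longrightarrow> cmod (f t) \<le> C"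
    using ev unfolding eventually_at_left[OF zero_less_one] by blast
  have "compact (f ` {b..max b d})"
    if "b < 1" using d b that by (intro compact_continuous_image continuous_on_subset[OF f]) auto
  then have "bounded (f ` {b..max b d})" by (cases "b < 1") (use d in \<open>auto intro: compact_imp_bounded\<close>)
  moreover have "bounded (f ` {d<..<1})" unfolding bounded_iff using d(2) by (intro exI[of _ C]) auto
  moreover have "f ` {b..<1} \<subseteq> f ` {b..max b d} \<union> f ` {d<..<1}"
    unfolding image_Un[symmetric] by (rule image_mono) auto
  ultimately show ?thesis using bounded_Un bounded_subset by blast
qed

text \<open>The bound on the first derivative makes \<open>(1 - t^2) H'\<close> of order
  \<open>sqrt (1 - t^2)\<close>, so it tends to 0 at the pole. The bound on the Beltrami operator
  will make \<open>I_op b L N u\<close> bounded on the cap.\<close>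

lemma X2_radial:
  assumes "u \<in> X2 N"
  obtains m H H' H'' where "mode m H u"
    "\<forall>t\<in>{-1<..<1}. (H has_vector_derivative H' t) (at t)"
    "\<forall>t\<in>{-1<..<1}. (H' has_vector_derivative H'' t) (at t)"
    "continuous_on {-1<..<1} H''"
    "bounded (H ` {-1<..<1})"
    "((\<lambda>t. complex_of_real (1 - t\<^sup>2) * H' t) \<longlongrightarrow> 0) (at_left 1)"
    "\<exists>C. \<forall>\<^sub>F t in at_left 1. cmod (beltrami_radial N m H (\<lambda>t. complex_of_real (1 - t\<^sup>2) * H'' t - 2 * complex_of_real t * H' t) t) \<le> C"
proof -
  from assms obtain H :: "real \<Rightarrow> complex" and m :: int where C: "C_diff 2 u" and bd: "bounded (u ` Omega0)"
    and u: "\<forall>t\<in>{-1<..<1}. \<forall>\<phi>\<in>{0..<2 * pi}. u (xi t \<phi>) = H t * exp (\<i> * of_int m * complex_of_real \<phi>)"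
    and O: "\<forall>i\<in>{1, 2 :: nat}. (\<lambda>x. cmod ((d_t ^^ i) u x)) \<in> O[at north_pole within Omega](\<lambda>x. (1 - (lat x)\<^sup>2) powr (1 / 2 - real i))"
    and OB: "(\<lambda>x. cmod (beltrami N u x)) \<in> O[at north_pole within Omega](\<lambda>_. 1)"
    unfolding X2_def by blast
  \<comment> \<open>The product form is given for longitudes in \<open>{0..<2 * pi}\<close> only;
    replacing \<open>\<phi>\<close> by the longitude of the same point extends it to all
    reals.\<close>
  have mode: "mode m H u"
    unfolding modes_def
  proof (intro ballI allI)
    fix t \<phi> :: real assume t: "t \<in> {-1<..<1}"
    let ?l = "lon (xi t \<phi>)"
    have "?l \<in> {0..<2 * pi}" using Arg2pi by (auto simp: lon_def)
    then have "u (xi t ?l) = H t * cis (of_int m * ?l)" using u t by (simp add: cis_conv_exp mult.assoc)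
    moreover have "xi t ?l = xi t \<phi>"
      using xi_lat_lon[of "xi t \<phi>"] xi_in_Omega0[OF t, of \<phi>] by (simp add: Omega0_def)
    ultimately show "u (xi t \<phi>) = (\<Sum>i\<in>{()}. H t * cis (of_int m * \<phi>))"
      by (simp add: cis_lon_xi[OF t])
  qed
  have C0: "C_diff (Suc (Suc 0)) u" using C by (simp only: numeral_2_eq_2)
  then have C1: "C_diff (Suc 0) (d_t u)" unfolding C_diff.simps(2)[of "Suc 0"] by blast
  then have C2: "continuous_on Omega0 (d_t (d_t u))" unfolding C_diff.simps by blast
  define H' where "H' = (\<lambda>t. d_t u (xi t 0))"
  define H'' where "H'' = (\<lambda>t. d_t (d_t u) (xi t 0))"
  have H: "(H has_vector_derivative H' t) (at t)" if "t \<in> {-1<..<1}" for t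
    unfolding H'_def by (rule mode_C_diff_Suc[OF mode C0 that])
  have mode': "mode m H' (d_t u)" by (rule modes_d_t[OF mode H])
  have H': "(H' has_vector_derivative H'' t) (at t)" if "t \<in> {-1<..<1}" for t
    unfolding H''_def by (rule mode_C_diff_Suc[OF mode' C1 that])
  have mode'': "mode m H'' (d_t (d_t u))" by (rule modes_d_t[OF mode' H'])
  show ?thesis
  proof (rule that[OF mode ballI[OF H] ballI[OF H']])
    show "continuous_on {-1<..<1} H''" by (rule mode_continuous_on_radial[OF mode'' C2])
    have "H ` {-1<..<1} \<subseteq> u ` Omega0"
      by (rule image_subsetI) (simp only: mode_radial_eq[OF mode] imageI xi_in_Omega0)
    then show "bounded (H ` {-1<..<1})" by (rule bounded_subset[OF bd])
    have ev: "\<forall>\<^sub>F t in at_left 1. t \<in> {-1<..<1 :: real}"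
      by (rule eventually_at_leftI[of 0]) auto
    have "(\<lambda>x. cmod (d_t u x)) \<in> O[at north_pole within Omega](\<lambda>x. (1 - (lat x)\<^sup>2) powr (- (1 / 2)))"
      using O[rule_format, of 1] by simp
    then obtain c where "c > 0" "\<forall>\<^sub>F x in at north_pole within Omega. norm (cmod (d_t u x)) \<le> c * norm ((1 - (lat x)\<^sup>2) powr (- (1 / 2)))"
      by (rule landau_o.bigE)
    from eventually_compose_filterlim[OF this(2) xi_pole_filterlim]
    have "\<forall>\<^sub>F t in at_left 1. cmod (complex_of_real (1 - t\<^sup>2) * H' t) \<le> c * sqrt (1 - t\<^sup>2)"
      using ev
    proof eventually_elim
      case (elim t)
      have a: "0 < 1 - t\<^sup>2" using one_minus_square_pos[OF elim(2)] by simp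
      have "cmod (complex_of_real (1 - t\<^sup>2) * H' t) = (1 - t\<^sup>2) * cmod (H' t)"
        using a by (simp only: norm_mult norm_of_real abs_of_pos)
      also have "\<dots> \<le> (1 - t\<^sup>2) * (c * (1 - t\<^sup>2) powr (- (1 / 2)))"
        using elim(1) a unfolding H'_def lat_xi real_norm_def abs_norm_cancel abs_of_nonneg[OF powr_ge_zero]
        by (intro mult_left_mono) (simp_all only: less_imp_le)
      also have "\<dots> = c * ((1 - t\<^sup>2) powr 1 * (1 - t\<^sup>2) powr (- (1 / 2)))"
        using a by simp
      also have "\<dots> = c * sqrt (1 - t\<^sup>2)"
      proof -
        have "1 + - (1 / 2) = (1 / 2 :: real)" by simp
        then show ?thesis unfolding powr_add[symmetric] by (simp only: powr_half_sqrt[OF less_imp_le[OF a]])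
      qed
      finally show ?case .
    qed
    moreover have "((\<lambda>t :: real. c * sqrt (1 - t\<^sup>2)) \<longlongrightarrow> c * sqrt (1 - 1\<^sup>2)) (at_left 1)"
      by (intro tendsto_intros)
    then have "((\<lambda>t :: real. c * sqrt (1 - t\<^sup>2)) \<longlongrightarrow> 0) (at_left 1)" by simp
    ultimately show "((\<lambda>t. complex_of_real (1 - t\<^sup>2) * H' t) \<longlongrightarrow> 0) (at_left 1)"
      by (rule Lim_null_comparison)
    have bm: "mode m (beltrami_radial N m H (\<lambda>t. complex_of_real (1 - t\<^sup>2) * H'' t - 2 * complex_of_real t * H' t)) (beltrami N u)"
      by (rule modes_beltrami[OF mode H mult_has_vector_derivative_K[OF H']])
    obtain c' where "\<forall>\<^sub>F x in at north_pole within Omega. norm (cmod (beltrami N u x)) \<le> c' * norm (1 :: real)"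
      using OB by (rule landau_o.bigE)
    from eventually_compose_filterlim[OF this xi_pole_filterlim]
    have "\<forall>\<^sub>F t in at_left 1. cmod (beltrami_radial N m H (\<lambda>t. complex_of_real (1 - t\<^sup>2) * H'' t - 2 * complex_of_real t * H' t) t) \<le> c'"
      using ev by eventually_elim (simp only: mode_radial_eq[OF bm] real_norm_def abs_norm_cancel abs_one mult_1_right)
    then show "\<exists>C. \<forall>\<^sub>F t in at_left 1. cmod (beltrami_radial N m H (\<lambda>t. complex_of_real (1 - t\<^sup>2) * H'' t - 2 * complex_of_real t * H' t) t) \<le> C" ..
  qed
qed

lemma tendsto_imp_eventually_cmod_le:
  assumes "(f \<longlongrightarrow> 0) F"
  shows "\<forall>\<^sub>F t in F. cmod (f t) \<le> 1"
  using tendstoD[OF assms, of 1] by (auto simp: dist_norm elim!: eventually_mono)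

lemma continuous_on_spin_radial: "continuous_on {-1<..<1} (\<lambda>t. complex_of_real (spin_radial N j n k t))"
  by (rule continuous_at_imp_continuous_on)
    (use spin_radial_has_vector_derivative has_vector_derivative_continuous in blast)

lemma spin_radial_bounded:
  assumes "-1 < b"
  shows "bounded ((\<lambda>t. complex_of_real (spin_radial N j n 0 t)) ` {b..<1})"
    and "((\<lambda>t. complex_of_real (1 - t\<^sup>2) * complex_of_real (spin_radial N j n 1 t)) \<longlongrightarrow> 0) (at_left 1)"
proof -
  obtain g B :: "real \<Rightarrow> real" where g: "continuous_on {-1<..1} g" and B: "continuous_on {-1<..1} B" "B 1 = 0"
    and eq: "\<And>t. t \<in> {-1<..<1} \<Longrightarrow> spin_radial N j n 0 t = g t"
    "\<And>t. t \<in> {-1<..<1} \<Longrightarrow> (1 - t\<^sup>2) * spin_radial N j n 1 t = B t"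
    by (rule spin_radial_north[of N j n], rule that, simp_all)
  have "compact ((\<lambda>t. complex_of_real (g t)) ` {b..1})"
    using assms by (intro compact_continuous_image continuous_on_of_real continuous_on_subset[OF g]) auto
  then have "bounded ((\<lambda>t. complex_of_real (g t)) ` {b..<1})"
    by (rule bounded_subset[OF compact_imp_bounded]) auto
  moreover have "(\<lambda>t. complex_of_real (spin_radial N j n 0 t)) ` {b..<1} = (\<lambda>t. complex_of_real (g t)) ` {b..<1}"
    using assms by (intro image_cong) (auto simp: eq)
  ultimately show "bounded ((\<lambda>t. complex_of_real (spin_radial N j n 0 t)) ` {b..<1})" by simp
  have "((\<lambda>t. complex_of_real (B t)) \<longlongrightarrow> complex_of_real (B 1)) (at 1 within {-1<..1})"
    using B(1) by (intro tendsto_of_real) (simp add: continuous_on)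
  then have "((\<lambda>t. complex_of_real (B t)) \<longlongrightarrow> 0) (at 1 within {0..1})"
    unfolding B(2) of_real_0 by (rule tendsto_within_subset) auto
  then have "((\<lambda>t. complex_of_real (B t)) \<longlongrightarrow> 0) (at_left 1)"
    by (simp add: at_within_Icc_at_left)
  moreover have "\<forall>\<^sub>F t in at_left 1. complex_of_real (B t) = complex_of_real (1 - t\<^sup>2) * complex_of_real (spin_radial N j n 1 t)"
  proof (rule eventually_at_leftI[of 0])
    fix t :: real assume "t \<in> {0<..<1}"
    then have "t \<in> {-1<..<1}" by auto
    from eq(2)[OF this] show "complex_of_real (B t) = complex_of_real (1 - t\<^sup>2) * complex_of_real (spin_radial N j n 1 t)"
      by (simp only: of_real_mult[symmetric])
  qed simp
  ultimately show "((\<lambda>t. complex_of_real (1 - t\<^sup>2) * complex_of_real (spin_radial N j n 1 t)) \<longlongrightarrow> 0) (at_left 1)"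
    by (rule Lim_transform_eventually)
qed

lemma bounded_mult_image:
  fixes f g :: "real \<Rightarrow> complex"
  assumes "bounded (f ` S)" "bounded (g ` S)"
  shows "bounded ((\<lambda>t. f t * g t) ` S)"
proof -
  obtain A B where "\<forall>t\<in>S. cmod (f t) \<le> A" "\<forall>t\<in>S. cmod (g t) \<le> B"
    using assms unfolding bounded_iff by (metis imageI)
  then have "\<forall>t\<in>S. cmod (f t * g t) \<le> A * B"
    unfolding norm_mult by (meson mult_mono' norm_ge_zero)
  then show ?thesis unfolding bounded_iff by blast
qed

text \<open>\<open>H'\<close> and \<open>K\<close> may be unbounded individually; they enter only
  through \<open>(1 - t^2) H'\<close> and the Beltrami part.\<close>

lemma I_radial_bounded:
  assumes b: "-1 < b" and H: "bounded (H ` {b..<1})"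
    and H': "bounded ((\<lambda>t. complex_of_real (1 - t\<^sup>2) * H' t) ` {b..<1})"
    and K: "bounded (beltrami_radial N m H K ` {b..<1})"
  shows "bounded (I_radial b L N m H H' K ` {b..<1})"
proof -
  have poly: "bounded ((\<lambda>t. complex_of_real (f t)) ` {b..<1})" if "continuous_on {b..1} f" for f :: "real \<Rightarrow> real"
    by (rule bounded_subset[OF compact_imp_bounded[OF compact_continuous_image[OF continuous_on_of_real[OF that] compact_Icc]]]) auto
  have 1: "bounded ((\<lambda>t. complex_of_real (b - t) * beltrami_radial N m H K t) ` {b..<1})"
    by (intro bounded_mult_image poly K continuous_intros)
  have 2: "bounded ((\<lambda>t. complex_of_real (real (L * (L + 2)) * t) * H t) ` {b..<1})"
    by (intro bounded_mult_image poly H continuous_intros)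
  have "I_radial b L N m H H' K = (\<lambda>t. complex_of_real (b - t) * beltrami_radial N m H K t
      - complex_of_real (1 - t\<^sup>2) * H' t - complex_of_real (real (L * (L + 2)) * t) * H t)"
    by (simp add: I_radial_def fun_eq_iff algebra_simps)
  then show ?thesis using bounded_minus_comp[OF bounded_minus_comp[OF 1 H'] 2] by simp
qed

section \<open>The commutation theorem\<close>

lemma set_integral_lincomb:
  fixes f :: "'i \<Rightarrow> 'a \<Rightarrow> complex"
  assumes "\<And>i. i \<in> I \<Longrightarrow> set_integrable M A (f i)"
  shows "set_integrable M A (\<lambda>y. \<Sum>i\<in>I. c i * f i y)"
    and "(LINT y:A|M. \<Sum>i\<in>I. c i * f i y) = (\<Sum>i\<in>I. c i * (LINT y:A|M. f i y))"
proof -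
  have e: "(\<lambda>y. indicator A y *\<^sub>R (\<Sum>i\<in>I. c i * f i y)) = (\<lambda>y. \<Sum>i\<in>I. c i * (indicator A y *\<^sub>R f i y))"
    by (simp add: scaleR_sum_right)
  have i: "integrable M (\<lambda>y. c i * (indicator A y *\<^sub>R f i y))" if "i \<in> I" for i
    using assms[OF that] unfolding set_integrable_def by (rule integrable_mult_right)
  show "set_integrable M A (\<lambda>y. \<Sum>i\<in>I. c i * f i y)"
    unfolding set_integrable_def e by (rule Bochner_Integration.integrable_sum[OF i])
  show "(LINT y:A|M. \<Sum>i\<in>I. c i * f i y) = (\<Sum>i\<in>I. c i * (LINT y:A|M. f i y))"
    unfolding set_lebesgue_integral_def e
    by (subst Bochner_Integration.integral_sum[OF i]) (simp_all only: integral_mult_right_zero)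
qed

lemma mode_cnj:
  assumes "mode j G F"
  shows "mode (- j) (\<lambda>t. cnj (G t)) (\<lambda>x. cnj (F x))"
  unfolding modes_def using modesD[OF assms] by (simp add: cis_cnj)

lemma mode_mult:
  assumes "mode j G F" "mode k H E"
  shows "mode (j + k) (\<lambda>t. G t * H t) (\<lambda>x. F x * E x)"
  unfolding modes_def
proof (intro ballI allI)
  fix t \<phi> :: real assume t: "t \<in> {-1<..<1}"
  have "cis (of_int (j + k) * \<phi>) = cis (of_int j * \<phi>) * cis (of_int k * \<phi>)"
    by (simp add: cis_mult distrib_right)
  then show "F (xi t \<phi>) * E (xi t \<phi>) = (\<Sum>i\<in>{()}. G t * H t * cis (of_int (j + k) * \<phi>))"
    using modesD[OF assms(1) t, of \<phi>] modesD[OF assms(2) t, of \<phi>] by (simp add: ac_simps)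
qed

lemma I_radial_mult_right:
  "I_radial b L N m (\<lambda>t. G t * c) (\<lambda>t. G' t * c) (\<lambda>t. K t * c) t = I_radial b L N m G G' K t * c"
  unfolding I_radial_def beltrami_radial_def by (simp only: left_diff_distrib distrib_right mult.assoc right_diff_distrib)

abbreviation spin_index :: "int \<Rightarrow> nat \<Rightarrow> (nat \<times> int) set" where
  "spin_index N L \<equiv> (SIGMA n : {nat \<bar>N\<bar>..L}. {- int n..int n})"

lemma modes_spin_sum:
  "modes J snd (\<lambda>p t. complex_of_real (spin_radial N (snd p) (fst p) 0 t) * C p)
     (\<lambda>z. \<Sum>p\<in>J. spin_Y N (fst p) (snd p) z * C p)"
  unfolding modes_def
proof (intro ballI allI sum.cong)
  fix t \<phi> :: real and p assume t: "t \<in> {-1<..<1}"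
  show "spin_Y N (fst p) (snd p) (xi t \<phi>) * C p
    = complex_of_real (spin_radial N (snd p) (fst p) 0 t) * C p * cis (of_int (snd p) * \<phi>)"
    using modesD[OF spin_Y_mode t, of N "fst p" "snd p" \<phi>] by simp
qed simp

lemma C_diff_spin_sum: "C_diff k (\<lambda>z. \<Sum>p\<in>J. spin_Y N (fst p) (snd p) z * C p)"
  by (rule C_diff_modes[of J snd "\<lambda>p k t. complex_of_real (spin_radial N (snd p) (fst p) k t) * C p"])
    (rule modes_spin_sum, rule has_vector_derivative_mult_left, rule spin_radial_has_vector_derivative)

text \<open>With \<open>C p\<close> a conjugated harmonic at \<open>y\<close> this is the operator
  on the kernel; with \<open>C p\<close> a cap integral it is the operator on the integral. One
  computation serves both.\<close>

lemma I_op_spin_sum: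
  assumes x: "x \<in> Omega0"
  shows "I_op b L N (\<lambda>z. \<Sum>p\<in>J. spin_Y N (fst p) (snd p) z * C p) x
    = (\<Sum>p\<in>J. complex_of_real (spin_I b L N (snd p) (fst p) (lat x)) * cis (of_int (snd p) * lon x) * C p)"
proof -
  let ?r = "\<lambda>k p t. complex_of_real (spin_radial N (snd p) (fst p) k t)"
  let ?K = "\<lambda>p t. complex_of_real (spin_K N (snd p) (fst p) t)"
  have "modes J snd (\<lambda>p. I_radial b L N (snd p) (\<lambda>t. ?r 0 p t * C p) (\<lambda>t. ?r 1 p t * C p) (\<lambda>t. ?K p t * C p))
     (I_op b L N (\<lambda>z. \<Sum>p\<in>J. spin_Y N (fst p) (snd p) z * C p))"
  proof (rule modes_I_op[OF modes_spin_sum])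
    fix p and t :: real assume t: "t \<in> {-1<..<1}"
    show "((\<lambda>t. ?r 0 p t * C p) has_vector_derivative ?r 1 p t * C p) (at t)"
      using has_vector_derivative_mult_left[OF spin_radial_has_vector_derivative[OF t, of N "snd p" "fst p" 0]] by simp
    show "((\<lambda>t. complex_of_real (1 - t\<^sup>2) * (?r 1 p t * C p)) has_vector_derivative ?K p t * C p) (at t)"
      using has_vector_derivative_mult_left[OF spin_K_has_vector_derivative[OF t, of N "snd p" "fst p"]]
      by (simp only: mult.assoc)
  qed
  from modes_at[OF this x] show ?thesis
    unfolding I_radial_mult_right I_radial_spin[OF Omega0_lat[OF x]] by (simp add: ac_simps)
qed

lemma cnj_spin_kernel:
  "cnj (spin_kernel N L z y) = (\<Sum>p\<in>spin_index N L. spin_Y N (fst p) (snd p) z * cnj (spin_Y N (fst p) (snd p) y))"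
  unfolding spin_kernel_def by (simp add: sum.Sigma case_prod_beta)

text \<open>Order \<open>m\<close> occurs exactly in the degrees \<open>n\<close> with
  \<open>\<bar>m\<bar> \<le> n\<close>, which yields the range of summation of
  \<open>spin_kernel_commute\<close>.\<close>

lemma sum_spin_index_delta:
  fixes f :: "nat \<Rightarrow> complex"
  shows "(\<Sum>p\<in>spin_index N L. if snd p = m then f (fst p) else 0) = (\<Sum>n = max (nat \<bar>N\<bar>) (nat \<bar>m\<bar>)..L. f n)"
proof -
  have "(\<Sum>p\<in>spin_index N L. if snd p = m then f (fst p) else 0)
     = (\<Sum>n = nat \<bar>N\<bar>..L. \<Sum>j = - int n..int n. if j = m then f n else 0)"
    by (subst sum.Sigma) (auto simp: case_prod_unfold)
  also have "\<dots> = (\<Sum>n = nat \<bar>N\<bar>..L. if m \<in> {- int n..int n} then f n else 0)"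
    by (intro sum.cong refl) (rule sum.delta, simp)
  also have "\<dots> = (\<Sum>n\<in>{n \<in> {nat \<bar>N\<bar>..L}. m \<in> {- int n..int n}}. f n)"
    by (rule sum.inter_filter[symmetric]) simp
  also have "{n \<in> {nat \<bar>N\<bar>..L}. m \<in> {- int n..int n}} = {max (nat \<bar>N\<bar>) (nat \<bar>m\<bar>)..L}"
    by auto
  finally show ?thesis .
qed

lemma bounded_mult_tendsto_0:
  fixes f g :: "real \<Rightarrow> complex"
  assumes b: "b < 1" and f: "bounded (f ` {b..<1})" and g: "(g \<longlongrightarrow> 0) (at_left 1)"
  shows "((\<lambda>t. f t * g t) \<longlongrightarrow> 0) (at_left 1)"
proof -
  obtain C where C: "\<forall>t\<in>{b..<1}. cmod (f t) \<le> C" using f unfolding bounded_iff by (metis imageI)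
  have "\<forall>\<^sub>F t in at_left 1. cmod (f t * g t) \<le> C * cmod (g t)"
    by (rule eventually_at_leftI[OF _ b]) (use C in \<open>auto simp: norm_mult intro!: mult_right_mono\<close>)
  moreover have "((\<lambda>t. C * cmod (g t)) \<longlongrightarrow> 0) (at_left 1)"
    using tendsto_mult_left[OF tendsto_norm_zero[OF g], of C] by simp
  ultimately show ?thesis by (rule Lim_null_comparison)
qed

lemma spin_I_bounded:
  assumes b: "-1 < b"
  shows "bounded ((\<lambda>t. complex_of_real (spin_I b L N j n t)) ` {b..<1})"
proof -
  let ?r = "\<lambda>k t. complex_of_real (spin_radial N j n k t)"
  let ?K = "\<lambda>t. complex_of_real (spin_K N j n t)"
  have ev: "\<forall>\<^sub>F t in at_left 1. cmod (complex_of_real (1 - t\<^sup>2) * ?r 1 t) \<le> 1"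
    by (rule tendsto_imp_eventually_cmod_le[OF spin_radial_bounded(2)[OF b]])
  have 1: "bounded ((\<lambda>t. complex_of_real (1 - t\<^sup>2) * ?r 1 t) ` {b..<1})"
    by (rule bounded_near_north[OF _ b ev]) (intro continuous_intros continuous_on_spin_radial)
  have "beltrami_radial N j (?r 0) ?K t = complex_of_real (- (real n * (real n + 1))) * ?r 0 t" if "t \<in> {b..<1}" for t
  proof -
    have t: "t \<in> {-1<..<1}" using that b by auto
    show ?thesis
      unfolding beltrami_radial_def of_real_mult[symmetric] spin_eigen[OF t, symmetric] of_real_diff ..
  qed
  then have "beltrami_radial N j (?r 0) ?K ` {b..<1} = (\<lambda>t. complex_of_real (- (real n * (real n + 1))) * ?r 0 t) ` {b..<1}"
    by (intro image_cong refl)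
  moreover have "bounded ((\<lambda>t. complex_of_real (- (real n * (real n + 1))) * ?r 0 t) ` {b..<1})"
    by (intro bounded_mult_image spin_radial_bounded b) (auto simp: bounded_iff)
  ultimately have 2: "bounded (beltrami_radial N j (?r 0) ?K ` {b..<1})" by simp
  have "bounded (I_radial b L N j (?r 0) (?r 1) ?K ` {b..<1})"
    by (rule I_radial_bounded[OF b spin_radial_bounded(1)[OF b] 1 2])
  moreover have "I_radial b L N j (?r 0) (?r 1) ?K ` {b..<1} = (\<lambda>t. complex_of_real (spin_I b L N j n t)) ` {b..<1}"
    using b by (intro image_cong refl I_radial_spin) auto
  ultimately show ?thesis by simp
qed

lemma continuous_on_spin_I: "continuous_on {-1<..<1} (\<lambda>t. complex_of_real (spin_I b L N j n t))"
proof -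
  have "(\<lambda>t. complex_of_real (spin_I b L N j n t)) = (\<lambda>t. complex_of_real (b - t) * (complex_of_real (- (real n * (real n + 1))) * complex_of_real (spin_radial N j n 0 t))
     + complex_of_real (t\<^sup>2 - 1) * complex_of_real (spin_radial N j n 1 t) - complex_of_real (real (L * (L + 2)) * t) * complex_of_real (spin_radial N j n 0 t))"
    unfolding spin_I_def by (simp only: of_real_add of_real_diff of_real_mult)
  then show ?thesis by (simp only:) (intro continuous_intros continuous_on_spin_radial)
qed

text \<open>The integrability and smoothness conjuncts give the equalities their intended content: a
  non-integrable function has integral 0 by convention, and \<open>vector_derivative\<close> is
  unspecified where no derivative exists.\<close>

theorem theorem3p8:
  fixes N :: int and L :: nat and b \<theta> :: real
    and u :: "real ^ 3 \<Rightarrow> complex" and x :: "real ^ 3"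
  assumes "\<bar>N\<bar> \<le> int L"
    and "b = cos \<theta>" and "0 < b" and "b < 1"
    and "u \<in> X2 N"
    and "x \<in> Omega0"
  shows
    "set_integrable surface_measure (polar_cap b) (\<lambda>y. cnj (spin_kernel N L x y) * I_op b L N u y) \<and>
     set_integrable surface_measure (polar_cap b)
       (\<lambda>y. I_op b L N (\<lambda>z. cnj (spin_kernel N L z y)) x * u y) \<and>
     set_integrable surface_measure (polar_cap b) (\<lambda>y. cnj (spin_kernel N L x y) * u y) \<and>
     C_diff 2 (\<lambda>z. LINT y:polar_cap b|surface_measure. cnj (spin_kernel N L z y) * u y) \<and>
     (LINT y:polar_cap b|surface_measure. cnj (spin_kernel N L x y) * I_op b L N u y)
       = (LINT y:polar_cap b|surface_measure. I_op b L N (\<lambda>z. cnj (spin_kernel N L z y)) x * u y) \<and>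
     (LINT y:polar_cap b|surface_measure. I_op b L N (\<lambda>z. cnj (spin_kernel N L z y)) x * u y)
       = I_op b L N (\<lambda>z. LINT y:polar_cap b|surface_measure. cnj (spin_kernel N L z y) * u y) x"
proof -
  have b: "-1 < b" "b < 1" using assms by auto
  have sub: "{b..<1} \<subseteq> {-1<..<1}" using b by auto
  obtain m H H' H'' where mode: "mode m H u"
    and derivs: "\<forall>t\<in>{-1<..<1}. (H has_vector_derivative H' t) (at t)" "\<forall>t\<in>{-1<..<1}. (H' has_vector_derivative H'' t) (at t)"
    and cH'': "continuous_on {-1<..<1} H''"
    and bH: "bounded (H ` {-1<..<1})"
    and limH': "((\<lambda>t. complex_of_real (1 - t\<^sup>2) * H' t) \<longlongrightarrow> 0) (at_left 1)"
    and evB: "\<exists>C. \<forall>\<^sub>F t in at_left 1. cmod (beltrami_radial N m H (\<lambda>t. complex_of_real (1 - t\<^sup>2) * H'' t - 2 * complex_of_real t * H' t) t) \<le> C"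
    by (rule X2_radial[OF \<open>u \<in> X2 N\<close>])
  note H = bspec[OF derivs(1)] and H' = bspec[OF derivs(2)]
  define K where "K = (\<lambda>t. complex_of_real (1 - t\<^sup>2) * H'' t - 2 * complex_of_real t * H' t)"
  have HK: "((\<lambda>t. complex_of_real (1 - t\<^sup>2) * H' t) has_vector_derivative K t) (at t)" if "t \<in> {-1<..<1}" for t
    unfolding K_def by (rule mult_has_vector_derivative_K[OF H'[OF that]])
  have cH: "continuous_on {-1<..<1} H" "continuous_on {-1<..<1} H'"
    by (rule continuous_at_imp_continuous_on, rule ballI, rule has_vector_derivative_continuous[OF H], assumption)
      (rule continuous_at_imp_continuous_on, rule ballI, rule has_vector_derivative_continuous[OF H'], assumption)
  have cK: "continuous_on {-1<..<1} K"
    unfolding K_def by (intro continuous_intros cH cH'')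
  have cB: "continuous_on {-1<..<1} (beltrami_radial N m H K)"
    unfolding beltrami_radial_def[abs_def]
    by (intro continuous_intros cH cK) (use one_minus_square_pos(1) in fastforce)
  define IH where "IH = I_radial b L N m H H' K"
  have cIH: "continuous_on {-1<..<1} IH"
    unfolding IH_def I_radial_def[abs_def] by (intro continuous_intros cB cH)
  have bH1: "bounded (H ` {b..<1})" by (rule bounded_subset[OF bH image_mono[OF sub]])
  have bIH: "bounded (IH ` {b..<1})"
    unfolding IH_def
  proof (rule I_radial_bounded[OF b(1) bH1])
    show "bounded ((\<lambda>t. complex_of_real (1 - t\<^sup>2) * H' t) ` {b..<1})"
      by (rule bounded_near_north[OF _ b(1) tendsto_imp_eventually_cmod_le[OF limH']]) (intro continuous_intros cH)
    show "bounded (beltrami_radial N m H K ` {b..<1})"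
    proof -
      from evB obtain B where "\<forall>\<^sub>F t in at_left 1. cmod (beltrami_radial N m H K t) \<le> B"
        unfolding K_def ..
      then show ?thesis by (rule bounded_near_north[OF cB b(1)])
    qed
  qed
  have modeI: "mode m IH (I_op b L N u)"
    unfolding IH_def by (rule modes_I_op[OF mode H HK])

  let ?Y = "\<lambda>p. spin_Y N (fst p) (snd p)"
  let ?r = "\<lambda>p t. complex_of_real (spin_radial N (snd p) (fst p) 0 t)"
  let ?J = "spin_index N L" and ?R = "polar_cap b" and ?\<omega> = "surface_measure"
  let ?q = "\<lambda>n t. complex_of_real (spin_radial N m n 0 t)"
  have modeY: "mode (- snd p + m) (\<lambda>t. ?r p t * V t) (\<lambda>y. cnj (?Y p y) * v y)" if "mode m V v" for p V v
    using mode_mult[OF mode_cnj[OF spin_Y_mode[of "snd p" N "fst p"]] that] by simp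
  \<comment> \<open>Stated for an arbitrary function of order \<open>m\<close>, since it is applied
    to \<open>u\<close> and to \<open>I_op b L N u\<close>.\<close>
  have rad: "set_integrable ?\<omega> ?R (\<lambda>y. cnj (?Y p y) * v y)"
      "(LINT y:?R|?\<omega>. cnj (?Y p y) * v y)
        = (if snd p = m then complex_of_real (2 * pi) * (LINT t:{b..<1}|lborel. ?r p t * V t) else 0)"
      "set_integrable lborel {b..<1} (\<lambda>t. ?r p t * V t)"
    if v: "mode m V v" and c: "continuous_on {-1<..<1} V" and bd: "bounded (V ` {b..<1})" for p V v
  proof -
    have c': "continuous_on {-1<..<1} (\<lambda>t. ?r p t * V t)"
      by (intro continuous_intros continuous_on_spin_radial c)
    have bd': "bounded ((\<lambda>t. ?r p t * V t) ` {b..<1})"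
      by (rule bounded_mult_image[OF spin_radial_bounded(1)[OF b(1)] bd])
    show "set_integrable ?\<omega> ?R (\<lambda>y. cnj (?Y p y) * v y)"
      by (rule polar_cap_mode(1)[OF b(1) modeY[OF v] c' bd'])
    show "(LINT y:?R|?\<omega>. cnj (?Y p y) * v y)
        = (if snd p = m then complex_of_real (2 * pi) * (LINT t:{b..<1}|lborel. ?r p t * V t) else 0)"
      unfolding polar_cap_mode(2)[OF b(1) modeY[OF v] c' bd'] by (rule if_cong) auto
    show "set_integrable lborel {b..<1} (\<lambda>t. ?r p t * V t)"
      by (rule bounded_continuous_integrable[OF continuous_on_subset[OF c' sub] bd'])
  qed
  note u_rad = rad[OF mode cH(1) bH1] and Iu_rad = rad[OF modeI cIH bIH]
  define C where "C = (\<lambda>p. LINT y:?R|?\<omega>. cnj (?Y p y) * u y)"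
  define Ix where "Ix = (\<lambda>p. complex_of_real (spin_I b L N (snd p) (fst p) (lat x)) * cis (of_int (snd p) * lon x))"

  have k1: "cnj (spin_kernel N L z y) * w = (\<Sum>p\<in>?J. ?Y p z * (cnj (?Y p y) * w))" for z y w
    unfolding cnj_spin_kernel sum_distrib_right by (simp only: mult.assoc)
  have k2: "I_op b L N (\<lambda>z. cnj (spin_kernel N L z y)) x * u y = (\<Sum>p\<in>?J. Ix p * (cnj (?Y p y) * u y))" for y
    unfolding cnj_spin_kernel I_op_spin_sum[OF \<open>x \<in> Omega0\<close>] Ix_def sum_distrib_right by (simp only: mult.assoc)
  \<comment> \<open>The kernel is a finite sum of products, so the integral is a finite combination
    of harmonics in \<open>z\<close>, and differentiation under the integral sign does not
    arise.\<close>
  have \<Phi>: "(\<lambda>z. LINT y:?R|?\<omega>. cnj (spin_kernel N L z y) * u y) = (\<lambda>z. \<Sum>p\<in>?J. ?Y p z * C p)"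
    unfolding k1 C_def by (rule ext, rule set_integral_lincomb(2)[OF u_rad(1)])

  have green: "(LINT t:{b..<1}|lborel. ?q n t * IH t)
      = (LINT t:{b..<1}|lborel. complex_of_real (spin_I b L N m n t) * H t)"
    and I_int: "set_integrable lborel {b..<1} (\<lambda>t. complex_of_real (spin_I b L N m n t) * H t)" for n
  proof -
    let ?g = "\<lambda>k t. complex_of_real (spin_radial N m n k t)" and ?K = "\<lambda>t. complex_of_real (spin_K N m n t)"
    show int: "set_integrable lborel {b..<1} (\<lambda>t. complex_of_real (spin_I b L N m n t) * H t)"
      by (intro bounded_continuous_integrable bounded_mult_image spin_I_bounded b bH1
          continuous_on_subset[OF _ sub] continuous_on_mult continuous_on_spin_I cH)
    have eq: "I_radial b L N m (?g 0) (?g 1) ?K t * H t = complex_of_real (spin_I b L N m n t) * H t" if "t \<in> {b..<1}" for t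
      using I_radial_spin[of t b L N m n] that sub by auto
    \<comment> \<open>Each half of the boundary term is a bounded profile times a quantity tending
      to 0, namely \<open>1 - t^2\<close> times the derivative of the other profile.\<close>
    have "((\<lambda>t. ?g 0 t * (complex_of_real (1 - t\<^sup>2) * H' t) - H t * (complex_of_real (1 - t\<^sup>2) * ?g 1 t)) \<longlongrightarrow> 0 - 0) (at_left 1)"
      by (rule tendsto_diff[OF bounded_mult_tendsto_0[OF b(2) spin_radial_bounded(1)[OF b(1)] limH']
            bounded_mult_tendsto_0[OF b(2) bH1 spin_radial_bounded(2)[OF b(1)]]])
    moreover have "(\<lambda>t. ?g 0 t * (complex_of_real (1 - t\<^sup>2) * H' t) - H t * (complex_of_real (1 - t\<^sup>2) * ?g 1 t))
      = (\<lambda>t. complex_of_real (1 - t\<^sup>2) * (?g 0 t * H' t - ?g 1 t * H t))"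
      by (simp only: right_diff_distrib mult.assoc mult.left_commute mult.commute)
    ultimately have lim: "((\<lambda>t. complex_of_real (1 - t\<^sup>2) * (?g 0 t * H' t - ?g 1 t * H t)) \<longlongrightarrow> 0) (at_left 1)"
      by (simp only: diff_zero)
    have "(LINT t:{b..<1}|lborel. ?g 0 t * I_radial b L N m H H' K t)
      = (LINT t:{b..<1}|lborel. I_radial b L N m (?g 0) (?g 1) ?K t * H t)"
    proof (rule I_radial_selfadjoint[OF b _ spin_K_has_vector_derivative H HK lim])
      show "(?g 0 has_vector_derivative ?g 1 t) (at t)" if "t \<in> {-1<..<1}" for t
        using spin_radial_has_vector_derivative[OF that, of N m n 0] by simp
      show "set_integrable lborel {b..<1} (\<lambda>t. ?g 0 t * I_radial b L N m H H' K t)"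
        using Iu_rad(3)[of "(n, m)"] by (simp add: IH_def)
      show "set_integrable lborel {b..<1} (\<lambda>t. I_radial b L N m (?g 0) (?g 1) ?K t * H t)"
        by (rule set_integrable_cong[OF refl refl eq, THEN iffD2]) (assumption, rule int)
    qed
    also have "\<dots> = (LINT t:{b..<1}|lborel. complex_of_real (spin_I b L N m n t) * H t)"
      by (rule set_lebesgue_integral_cong[OF _ allI[OF impI[OF eq]]]) simp
    finally show "(LINT t:{b..<1}|lborel. ?q n t * IH t)
      = (LINT t:{b..<1}|lborel. complex_of_real (spin_I b L N m n t) * H t)"
      by (simp only: IH_def)
  qed

  \<comment> \<open>Once orthogonality has reduced the sum to order \<open>m\<close>, the operator
    is moved twice: \<open>green\<close> takes it from \<open>u\<close> to the harmonic in the
    integration variable, and \<open>spin_kernel_commute\<close>, applied under the integral, takes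
    it from there to the harmonic at \<open>x\<close>.\<close>
  have main: "(\<Sum>p\<in>?J. ?Y p x * (LINT y:?R|?\<omega>. cnj (?Y p y) * I_op b L N u y)) = (\<Sum>p\<in>?J. Ix p * C p)"
  proof -
    let ?A = "{max (nat \<bar>N\<bar>) (nat \<bar>m\<bar>)..L}" and ?s = "lat x"
    let ?e = "cis (of_int m * lon x) * complex_of_real (2 * pi)"
    have s: "?s \<in> {-1<..<1}" by (rule Omega0_lat[OF \<open>x \<in> Omega0\<close>])
    have Yx: "?Y p x = ?r p ?s * cis (of_int (snd p) * lon x)" for p
      using modes_at[OF spin_Y_mode \<open>x \<in> Omega0\<close>] by simp
    have "(\<Sum>p\<in>?J. ?Y p x * (LINT y:?R|?\<omega>. cnj (?Y p y) * I_op b L N u y))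
       = (\<Sum>p\<in>?J. if snd p = m then ?e * (?q (fst p) ?s * (LINT t:{b..<1}|lborel. ?q (fst p) t * IH t)) else 0)"
      unfolding Iu_rad(2) Yx by (intro sum.cong refl) auto
    also have "\<dots> = ?e * (\<Sum>n\<in>?A. complex_of_real (spin_radial N m n 0 ?s) * (LINT t:{b..<1}|lborel. complex_of_real (spin_I b L N m n t) * H t))"
      unfolding green sum_distrib_left by (rule sum_spin_index_delta)
    also have "(\<Sum>n\<in>?A. complex_of_real (spin_radial N m n 0 ?s) * (LINT t:{b..<1}|lborel. complex_of_real (spin_I b L N m n t) * H t))
      = (LINT t:{b..<1}|lborel. \<Sum>n\<in>?A. complex_of_real (spin_radial N m n 0 ?s) * (complex_of_real (spin_I b L N m n t) * H t))"
      by (rule set_integral_lincomb(2)[OF I_int, symmetric])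
    also have "\<dots> = (LINT t:{b..<1}|lborel. \<Sum>n\<in>?A. complex_of_real (spin_I b L N m n ?s) * (complex_of_real (spin_radial N m n 0 t) * H t))"
    proof (rule set_lebesgue_integral_cong)
      show "\<forall>t. t \<in> {b..<1} \<longrightarrow> (\<Sum>n\<in>?A. complex_of_real (spin_radial N m n 0 ?s) * (complex_of_real (spin_I b L N m n t) * H t))
        = (\<Sum>n\<in>?A. complex_of_real (spin_I b L N m n ?s) * (complex_of_real (spin_radial N m n 0 t) * H t))"
      proof (intro allI impI)
        fix t assume "t \<in> {b..<1}"
        then have t: "t \<in> {-1<..<1}" using sub by blast
        show "(\<Sum>n\<in>?A. complex_of_real (spin_radial N m n 0 ?s) * (complex_of_real (spin_I b L N m n t) * H t))
        = (\<Sum>n\<in>?A. complex_of_real (spin_I b L N m n ?s) * (complex_of_real (spin_radial N m n 0 t) * H t))"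
          unfolding mult.assoc[symmetric] of_real_mult[symmetric] sum_distrib_right[symmetric] of_real_sum[symmetric]
            spin_kernel_commute[OF s t] ..
      qed
    qed simp
    also have "\<dots> = (\<Sum>n\<in>?A. complex_of_real (spin_I b L N m n ?s) * (LINT t:{b..<1}|lborel. complex_of_real (spin_radial N m n 0 t) * H t))"
      using u_rad(3)[of "(_, m)"] by (intro set_integral_lincomb(2)) simp
    also have "?e * \<dots> = (\<Sum>p\<in>?J. if snd p = m then ?e * (complex_of_real (spin_I b L N m (fst p) ?s) * (LINT t:{b..<1}|lborel. ?q (fst p) t * H t)) else 0)"
      unfolding sum_distrib_left by (rule sum_spin_index_delta[symmetric])
    also have "\<dots> = (\<Sum>p\<in>?J. Ix p * C p)"
      unfolding C_def u_rad(2) Ix_def by (intro sum.cong refl) auto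
    finally show ?thesis .
  qed

  have "set_integrable ?\<omega> ?R (\<lambda>y. cnj (spin_kernel N L x y) * I_op b L N u y)"
    unfolding k1 by (rule set_integral_lincomb(1)[OF Iu_rad(1)])
  moreover have "set_integrable ?\<omega> ?R (\<lambda>y. I_op b L N (\<lambda>z. cnj (spin_kernel N L z y)) x * u y)"
    unfolding k2 by (rule set_integral_lincomb(1)[OF u_rad(1)])
  moreover have "set_integrable ?\<omega> ?R (\<lambda>y. cnj (spin_kernel N L x y) * u y)"
    unfolding k1 by (rule set_integral_lincomb(1)[OF u_rad(1)])
  moreover have "C_diff 2 (\<lambda>z. LINT y:?R|?\<omega>. cnj (spin_kernel N L z y) * u y)"
    unfolding \<Phi> by (rule C_diff_spin_sum)
  moreover have mid: "(LINT y:?R|?\<omega>. I_op b L N (\<lambda>z. cnj (spin_kernel N L z y)) x * u y) = (\<Sum>p\<in>?J. Ix p * C p)"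
    unfolding k2 C_def by (rule set_integral_lincomb(2)[OF u_rad(1)])
  moreover have "(LINT y:?R|?\<omega>. cnj (spin_kernel N L x y) * I_op b L N u y) = (\<Sum>p\<in>?J. Ix p * C p)"
    unfolding k1 set_integral_lincomb(2)[OF Iu_rad(1)] by (rule main)
  moreover have "I_op b L N (\<lambda>z. LINT y:?R|?\<omega>. cnj (spin_kernel N L z y) * u y) x = (\<Sum>p\<in>?J. Ix p * C p)"
    unfolding \<Phi> I_op_spin_sum[OF \<open>x \<in> Omega0\<close>] Ix_def ..
  ultimately show ?thesis by (simp only: simp_thms)
qed

end
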